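(* Let $(X,\alpha)$ and $(Y,\beta)$ be Cantor minimal systems. The following are equivalent. (1) There is a unital order homomorphism $\rho$ from $K^0(Y,\beta)$ to $K^0(X,\alpha)$. (2) There exist a continuous map $F:X\to Y$ and a minimal homeomorphism $\gamma\in[\alpha]$ such that the integer valued cocycle $n:X\to\mathbb{Z}$ associated with $\gamma$ (defined by $\gamma(x)=\alpha^{n(x)}(x)$) has at most one point of discontinuity and $\beta F=F\gamma$. (3) There exists a continuous map $F:X\to Y$ such that $\{g\circ F:g\in B_\beta\}\subset B_\alpha$. (4) There exists a sequence of homeomorphisms $\sigma_n:X\to Y$ such that $\sigma_n\alpha\sigma_n^{-1}\to\beta$ in $\operatorname{Homeo}(Y)$ and $\lim_{n\to\infty}[f\circ\sigma_n]_\alpha$ exists in $K^0(X,\alpha)$ (with the discrete topology, i.e. the sequence is eventually constant) for every $f\in C(Y,\mathbb{Z})$.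
   Context: A Cantor minimal system $(X,\alpha)$ consists of a Cantor set $X$ and a homeomorphism $\alpha$ of $X$ with no nontrivial closed invariant subsets. $\operatorname{Homeo}(Y)$ carries the topology of uniform convergence: $\gamma_n\to\gamma$ iff $\sup_{y}d(\gamma_n(y),\gamma(y))\to0$ for a compatible metric $d$. $B_\alpha=\{f-f\circ\alpha^{-1}: f\in C(X,\mathbb{Z})\}$, $K^0(X,\alpha)=C(X,\mathbb{Z})/B_\alpha$ with class of $f$ written $[f]_\alpha$; it is an ordered group with positive cone the classes of nonnegative functions and order unit $[1_X]_\alpha$. A unital order homomorphism is a group homomorphism mapping the positive cone into the positive cone and the order unit to the order unit. The full group $[\alpha]$ is the group of homeomorphisms $\gamma$ of $X$ such that $\gamma(x)$ lies in the $\alpha$-orbit of $x$ for every $x\in X$. *)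

theory Defs
  imports "HOL-Analysis.Analysis" "HOL-Algebra.Group"
begin

definition cantor_set :: "'a::metric_space set \<Rightarrow> bool" where
  "cantor_set X \<longleftrightarrow> X \<noteq> {} \<and> compact X \<and> (\<forall>x\<in>X. x islimpt X)
     \<and> (\<forall>x\<in>X. connected_component_set X x = {x})"

definition is_homeo :: "'a::topological_space set \<Rightarrow> ('a \<Rightarrow> 'a) \<Rightarrow> bool" where
  "is_homeo X h \<longleftrightarrow> (\<exists>g. homeomorphism X X h g)"

definition minimal_on :: "'a::topological_space set \<Rightarrow> ('a \<Rightarrow> 'a) \<Rightarrow> bool" where
  "minimal_on X h \<longleftrightarrow> (\<forall>A. A \<subseteq> X \<longrightarrow> closedin (top_of_set X) A \<longrightarrow> h ` A = A
       \<longrightarrow> A = {} \<or> A = X)"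

definition cantor_minimal_system :: "'a::metric_space set \<Rightarrow> ('a \<Rightarrow> 'a) \<Rightarrow> bool" where
  "cantor_minimal_system X h \<longleftrightarrow> cantor_set X \<and> is_homeo X h \<and> minimal_on X h"

definition hpow :: "'a set \<Rightarrow> ('a \<Rightarrow> 'a) \<Rightarrow> int \<Rightarrow> 'a \<Rightarrow> 'a" where
  "hpow X h n = (if 0 \<le> n then h ^^ nat n else inv_into X h ^^ nat (- n))"

definition cont_int :: "'a::topological_space set \<Rightarrow> ('a \<Rightarrow> int) \<Rightarrow> bool" where
  "cont_int X f \<longleftrightarrow> continuous_on X (\<lambda>x. real_of_int (f x))"

definition cob :: "'a::topological_space set \<Rightarrow> ('a \<Rightarrow> 'a) \<Rightarrow> ('a \<Rightarrow> int) \<Rightarrow> bool" where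
  "cob X h g \<longleftrightarrow> (\<exists>f. cont_int X f \<and> (\<forall>x\<in>X. g x = f x - f (hpow X h (-1) x)))"

definition k0_class :: "'a::topological_space set \<Rightarrow> ('a \<Rightarrow> 'a) \<Rightarrow> ('a \<Rightarrow> int) \<Rightarrow> ('a \<Rightarrow> int) set" where
  "k0_class X h f = {g. cont_int X g \<and> cob X h (\<lambda>x. g x - f x)}"

definition k0 :: "'a::topological_space set \<Rightarrow> ('a \<Rightarrow> 'a) \<Rightarrow> ('a \<Rightarrow> int) set monoid" where
  "k0 X h = \<lparr> carrier = {k0_class X h f | f. cont_int X f},
              mult = (\<lambda>A B. {(\<lambda>x. f x + g x) | f g. f \<in> A \<and> g \<in> B}),
              one = k0_class X h (\<lambda>x. 0) \<rparr>"

definition k0_pos :: "'a::topological_space set \<Rightarrow> ('a \<Rightarrow> 'a) \<Rightarrow> ('a \<Rightarrow> int) set set" where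
  "k0_pos X h = {k0_class X h f | f. cont_int X f \<and> (\<forall>x\<in>X. 0 \<le> f x)}"

definition k0_unit :: "'a::topological_space set \<Rightarrow> ('a \<Rightarrow> 'a) \<Rightarrow> ('a \<Rightarrow> int) set" where
  "k0_unit X h = k0_class X h (\<lambda>x. 1)"

definition unital_order_hom ::
  "('b::topological_space set) \<Rightarrow> ('b \<Rightarrow> 'b) \<Rightarrow> ('a::topological_space set) \<Rightarrow> ('a \<Rightarrow> 'a)
    \<Rightarrow> (('b \<Rightarrow> int) set \<Rightarrow> ('a \<Rightarrow> int) set) \<Rightarrow> bool" where
  "unital_order_hom Y k X h \<rho> \<longleftrightarrow> \<rho> \<in> hom (k0 Y k) (k0 X h)
      \<and> \<rho> ` k0_pos Y k \<subseteq> k0_pos X h \<and> \<rho> (k0_unit Y k) = k0_unit X h"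

definition full_group :: "'a::topological_space set \<Rightarrow> ('a \<Rightarrow> 'a) \<Rightarrow> ('a \<Rightarrow> 'a) set" where
  "full_group X h = {g. is_homeo X g \<and> (\<forall>x\<in>X. \<exists>n::int. g x = hpow X h n x)}"

definition orbit_cocycle :: "'a set \<Rightarrow> ('a \<Rightarrow> 'a) \<Rightarrow> ('a \<Rightarrow> 'a) \<Rightarrow> 'a \<Rightarrow> int" where
  "orbit_cocycle X h g x = (THE n. g x = hpow X h n x)"

end

theory Submission
  imports Defs
begin

text \<open>
  Over a clopen base \<open>B\<close> the space \<open>X\<close> splits into columns, the orbit segments between consecutive
  visits to \<open>B\<close>. Two functions are cohomologous iff their column sums agree over some sufficiently
  small base, so equality and order in $K^0$ become statements about integers, column by column. In
  particular a class between \<open>0\<close> and $[1_A]$ is realised by a clopen subset of \<open>A\<close>, and clopen sets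
  of equal class are matched by a map that is locally a power of \<open>\<alpha>\<close>.

  (1) implies (4): every column of \<open>X\<close> can be tiled by towers of a fine Kakutani--Rokhlin partition
  of \<open>Y\<close> so that the classes prescribed by \<open>\<rho>\<close> come out; any homeomorphism respecting this labelling
  conjugates \<open>\<alpha>\<close> to a map close to \<open>\<beta>\<close>.

  (1) implies (2): labellings \<open>\<kappa>\<close> of \<open>X\<close> by atoms of ever finer Kakutani--Rokhlin partitions of \<open>Y\<close>,
  with bases shrinking to \<open>y0\<close>, are built together with maps \<open>\<gamma>\<close> that are locally powers of \<open>\<alpha>\<close> and
  follow \<open>\<beta>\<close> below the roof. The base and the roof of the labelling shrink to points \<open>q = \<alpha> p\<close> and
  \<open>p\<close>, so the limit of the \<open>\<gamma>\<close> extends by \<open>p \<mapsto> q\<close> and its cocycle is discontinuous at most at \<open>p\<close>.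
  At each stage every tower is made to pass close to a prescribed point, whence the limit is minimal.

  The remaining implications are direct: a homeomorphism in the full group whose cocycle has a single
  discontinuity acts trivially on $K^0$, which gives (3) from (2), and (3) and (4) induce \<open>\<rho>\<close> by
  composition with \<open>F\<close> and with the tail of the \<open>\<sigma> n\<close>.
\<close>

section \<open>Locally constant functions\<close>

abbreviation const_on :: "('a \<Rightarrow> 'c) \<Rightarrow> 'a set \<Rightarrow> bool" where
  "const_on f A \<equiv> \<forall>x\<in>A. \<forall>y\<in>A. f x = f y"

abbreviation diam_less :: "real \<Rightarrow> 'a::metric_space set \<Rightarrow> bool" where
  "diam_less e A \<equiv> \<forall>x\<in>A. \<forall>y\<in>A. dist x y < e"

definition locally_const :: "'a::topological_space set \<Rightarrow> ('a \<Rightarrow> 'c) \<Rightarrow> bool" where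
  "locally_const X f \<longleftrightarrow> (\<forall>x\<in>X. \<forall>\<^sub>F y in at x within X. f y = f x)"

definition clopen_in :: "'a::topological_space set \<Rightarrow> 'a set \<Rightarrow> bool" where
  "clopen_in X A \<longleftrightarrow> openin (top_of_set X) A \<and> closedin (top_of_set X) A"

lemma locally_constI:
  "(\<And>x. x \<in> X \<Longrightarrow> \<forall>\<^sub>F y in at x within X. f y = f x) \<Longrightarrow> locally_const X f"
  by (simp add: locally_const_def)

lemma locally_constD: "locally_const X f \<Longrightarrow> x \<in> X \<Longrightarrow> \<forall>\<^sub>F y in at x within X. f y = f x"
  by (simp add: locally_const_def)

lemma eventually_at_within_mem: "\<forall>\<^sub>F y in at x within X. y \<in> X"
  by (simp add: eventually_at_filter)

lemma locally_const_iff_open: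
  "locally_const X f \<longleftrightarrow> (\<forall>x\<in>X. \<exists>U. open U \<and> x \<in> U \<and> (\<forall>y\<in>U \<inter> X. f y = f x))"
  unfolding locally_const_def eventually_at_topological by (intro ball_cong refl iff_exI) auto

lemma locally_const_open:
  assumes "locally_const X f" "x \<in> X"
  obtains U where "open U" "x \<in> U" "\<And>y. y \<in> U \<Longrightarrow> y \<in> X \<Longrightarrow> f x = f y"
  using assms unfolding locally_const_iff_open by (metis IntI)

lemma locally_const_const [simp, intro]: "locally_const X (\<lambda>x. c)"
  by (simp add: locally_const_def)

lemma locally_const_comp: "locally_const X f \<Longrightarrow> locally_const X (\<lambda>x. h (f x))"
  unfolding locally_const_def by (auto elim!: eventually_mono ballE)

lemma locally_const_select:
  assumes "locally_const X f" "\<And>v. locally_const X (g v)"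
  shows "locally_const X (\<lambda>x. g (f x) x)"
proof (rule locally_constI)
  fix x assume "x \<in> X"
  with assms have "\<forall>\<^sub>F y in at x within X. f y = f x" "\<forall>\<^sub>F y in at x within X. g (f x) y = g (f x) x"
    by (auto dest: locally_constD)
  then show "\<forall>\<^sub>F y in at x within X. g (f y) y = g (f x) x"
    by eventually_elim simp
qed

lemma locally_const_comp2:
  assumes "locally_const X f" "locally_const X g"
  shows "locally_const X (\<lambda>x. h (f x) (g x))"
  using assms(1) by (rule locally_const_select[where g="\<lambda>v x. h v (g x)"]) (rule locally_const_comp[OF assms(2)])

lemma locally_const_add [intro]:
  "locally_const X f \<Longrightarrow> locally_const X g \<Longrightarrow> locally_const X (\<lambda>x. f x + g x)"
  by (rule locally_const_comp2)

lemma locally_const_diff [intro]: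
  "locally_const X f \<Longrightarrow> locally_const X g \<Longrightarrow> locally_const X (\<lambda>x. f x - g x)"
  by (rule locally_const_comp2)

lemma locally_const_uminus [intro]: "locally_const X f \<Longrightarrow> locally_const X (\<lambda>x. - f x)"
  by (rule locally_const_comp)

lemma locally_const_mult [intro]:
  "locally_const X f \<Longrightarrow> locally_const X g \<Longrightarrow> locally_const X (\<lambda>x. f x * g x)"
  by (rule locally_const_comp2)

lemma locally_const_if:
  assumes "locally_const X P" "locally_const X f" "locally_const X g"
  shows "locally_const X (\<lambda>x. if P x then f x else g x)"
proof -
  have "locally_const X (\<lambda>x. (if P x then f else g) x)"
    using assms by (intro locally_const_select[of X P "\<lambda>b. if b then f else g"]) simp_all
  then show ?thesis by (simp add: if_distribR)
qed

lemma locally_const_cong: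
  assumes "locally_const X f" "\<And>x. x \<in> X \<Longrightarrow> f x = g x"
  shows "locally_const X g"
  using assms unfolding locally_const_iff_open by (metis IntD2)

lemma locally_const_restrict:
  assumes "finite I" "\<And>i. i \<in> I \<Longrightarrow> locally_const X (f i)"
  shows "locally_const X (\<lambda>x. restrict (\<lambda>i. f i x) I)"
proof (rule locally_constI)
  fix x assume "x \<in> X"
  with assms have "\<forall>\<^sub>F y in at x within X. \<forall>i\<in>I. f i y = f i x"
    by (auto simp: eventually_ball_finite_distrib dest: locally_constD)
  then show "\<forall>\<^sub>F y in at x within X. restrict (\<lambda>i. f i y) I = restrict (\<lambda>i. f i x) I"
    by eventually_elim (auto simp: restrict_def)
qed

lemma locally_const_Collect:
  assumes "finite I" "\<And>i. i \<in> I \<Longrightarrow> locally_const X (Q i)"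
  shows "locally_const X (\<lambda>x. {i\<in>I. Q i x})"
  using locally_const_comp[where h="\<lambda>\<phi>. {i\<in>I. \<phi> i}", OF locally_const_restrict[OF assms]]
  by (rule locally_const_cong) auto

lemma locally_const_Bex:
  assumes "finite I" "\<And>i. i \<in> I \<Longrightarrow> locally_const X (Q i)"
  shows "locally_const X (\<lambda>x. \<exists>i\<in>I. Q i x)"
  using locally_const_comp[where h="\<lambda>J. J \<noteq> {}", OF locally_const_Collect[OF assms]]
  by (rule locally_const_cong) auto

lemma locally_const_sum:
  assumes "\<And>i. i \<in> I \<Longrightarrow> locally_const X (f i)"
  shows "locally_const X (\<lambda>x. \<Sum>i\<in>I. f i x)"
  using assms by (induction I rule: infinite_finite_induct) auto

lemma locally_const_Least:
  fixes Q :: "nat \<Rightarrow> 'a::topological_space \<Rightarrow> bool"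
  assumes "\<And>n. locally_const X (Q n)" "\<And>x. x \<in> X \<Longrightarrow> \<exists>n. Q n x"
  shows "locally_const X (\<lambda>x. LEAST n. Q n x)"
proof (rule locally_constI)
  fix x assume x: "x \<in> X"
  let ?N = "LEAST n. Q n x"
  have "\<forall>\<^sub>F y in at x within X. \<forall>n\<in>{..?N}. Q n y = Q n x"
    using assms(1) x by (auto simp: eventually_ball_finite_distrib dest: locally_constD)
  then show "\<forall>\<^sub>F y in at x within X. (LEAST n. Q n y) = ?N"
  proof eventually_elim
    case (elim y)
    have "?N \<le> m" if "Q m y" for m
    proof (cases "m \<le> ?N")
      case True
      then have "Q m x" using elim that by simp
      then show ?thesis by (rule Least_le)
    qed simp
    then show ?case using elim LeastI_ex[OF assms(2)[OF x]] by (intro Least_equality) auto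
  qed
qed

lemma locally_const_compose:
  assumes "locally_const Z f" "continuous_on X t" "t ` X \<subseteq> Z"
  shows "locally_const X (\<lambda>x. f (t x))"
  unfolding locally_const_iff_open
proof
  fix x assume x: "x \<in> X"
  then have "t x \<in> Z" using assms(3) by blast
  with assms(1) obtain V where V: "open V" "t x \<in> V" "\<And>z. z \<in> V \<Longrightarrow> z \<in> Z \<Longrightarrow> f (t x) = f z"
    by (rule locally_const_open) blast
  then obtain U where "open U" "x \<in> U" "\<forall>y\<in>X. y \<in> U \<longrightarrow> t y \<in> V"
    using assms(2) x V(1,2) unfolding continuous_on_topological by blast
  moreover from this have "\<forall>y\<in>U \<inter> X. f (t y) = f (t x)" using assms(3) by (blast intro: V(3)[symmetric])
  ultimately show "\<exists>U. open U \<and> x \<in> U \<and> (\<forall>y\<in>U \<inter> X. f (t y) = f (t x))" by blast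
qed

lemma tendsto_of_int_iff:
  "((\<lambda>y. real_of_int (f y)) \<longlongrightarrow> real_of_int c) F \<longleftrightarrow> (\<forall>\<^sub>F y in F. f y = c)"
proof
  assume "((\<lambda>y. real_of_int (f y)) \<longlongrightarrow> real_of_int c) F"
  then have "\<forall>\<^sub>F y in F. dist (real_of_int (f y)) (real_of_int c) < 1" by (rule tendstoD) simp
  then show "\<forall>\<^sub>F y in F. f y = c" by eventually_elim (simp add: dist_real_def flip: of_int_diff)
next
  assume "\<forall>\<^sub>F y in F. f y = c"
  then have "\<forall>\<^sub>F y in F. real_of_int (f y) = real_of_int c" by eventually_elim simp
  then show "((\<lambda>y. real_of_int (f y)) \<longlongrightarrow> real_of_int c) F" by (rule tendsto_eventually)
qed

lemma cont_int_iff: "cont_int X f \<longleftrightarrow> locally_const X f"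
  by (simp add: cont_int_def continuous_on_def tendsto_of_int_iff locally_const_def)

lemma openin_locally_const:
  assumes "locally_const X f"
  shows "openin (top_of_set X) {x\<in>X. Q (f x)}"
proof (subst openin_subopen, safe)
  fix x assume x: "x \<in> X" "Q (f x)"
  with assms obtain U where U: "open U" "x \<in> U" "\<And>y. y \<in> U \<Longrightarrow> y \<in> X \<Longrightarrow> f x = f y"
    using locally_const_open by metis
  have "Q (f y)" if "y \<in> X \<inter> U" for y using x(2) U(3)[of y] that by simp
  then have "X \<inter> U \<subseteq> {x\<in>X. Q (f x)}" by blast
  then show "\<exists>T. openin (top_of_set X) T \<and> x \<in> T \<and> T \<subseteq> {x\<in>X. Q (f x)}"
    using U(1,2) x(1) by (intro exI[of _ "X \<inter> U"]) auto
qed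

lemma clopen_in_level:
  assumes "locally_const X f"
  shows "clopen_in X {x\<in>X. Q (f x)}"
proof -
  have "X - {x\<in>X. Q (f x)} = {x\<in>X. \<not> Q (f x)}" by auto
  then show ?thesis
    using openin_locally_const[OF assms, of Q] openin_locally_const[OF assms, of "\<lambda>v. \<not> Q v"]
    by (simp add: clopen_in_def closedin_def)
qed

lemma clopen_in_subset: "clopen_in X A \<Longrightarrow> A \<subseteq> X"
  unfolding clopen_in_def using openin_imp_subset by blast

lemma locally_const_mem:
  assumes "clopen_in X A"
  shows "locally_const X (\<lambda>x. x \<in> A)"
  unfolding locally_const_iff_open
proof
  fix x assume x: "x \<in> X"
  obtain U V where U: "open U" "A = X \<inter> U" and V: "closed V" "A = X \<inter> V"
    using assms by (metis clopen_in_def openin_open closedin_closed)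
  show "\<exists>W. open W \<and> x \<in> W \<and> (\<forall>y\<in>W \<inter> X. (y \<in> A) = (x \<in> A))"
  proof (cases "x \<in> A")
    case True
    then have "x \<in> U" "\<forall>y\<in>U \<inter> X. y \<in> A" unfolding U(2) by blast+
    then show ?thesis using U(1) True by metis
  next
    case False
    then have "x \<in> - V" "\<forall>y\<in>- V \<inter> X. y \<notin> A" using x unfolding V(2) by blast+
    then show ?thesis using V(1) False by (metis open_Compl)
  qed
qed

lemma clopen_inI: "A \<subseteq> X \<Longrightarrow> locally_const X (\<lambda>x. x \<in> A) \<Longrightarrow> clopen_in X A"
  using clopen_in_level[of X "\<lambda>x. x \<in> A" "\<lambda>b. b"] by (simp add: Collect_conj_eq Int_absorb1)

lemma clopen_in_self [simp]: "clopen_in X X"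
  by (simp add: clopen_in_def)

lemma clopen_in_Diff: "clopen_in X A \<Longrightarrow> clopen_in X B \<Longrightarrow> clopen_in X (A - B)"
  by (auto simp: clopen_in_def)

lemma clopen_in_Int: "clopen_in X A \<Longrightarrow> clopen_in X B \<Longrightarrow> clopen_in X (A \<inter> B)"
  by (auto simp: clopen_in_def)

lemma clopen_in_Union: "finite \<A> \<Longrightarrow> (\<And>A. A \<in> \<A> \<Longrightarrow> clopen_in X A) \<Longrightarrow> clopen_in X (\<Union>\<A>)"
  by (auto simp: clopen_in_def intro: closedin_Union)

lemma clopen_in_compact: "clopen_in X A \<Longrightarrow> compact X \<Longrightarrow> compact A"
  unfolding clopen_in_def using closedin_compact by blast

lemma locally_const_indicator: "clopen_in X A \<Longrightarrow> locally_const X (indicator A)"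
  unfolding indicator_def[abs_def] by (rule locally_const_comp[OF locally_const_mem])

lemma locally_const_uniform:
  fixes X :: "'a::metric_space set"
  assumes "compact X" "locally_const X f"
  shows "\<exists>e>0. \<forall>x\<in>X. \<forall>y\<in>X. dist x y < e \<longrightarrow> f x = f y"
proof -
  define \<U> where "\<U> = {U. open U \<and> (\<forall>x\<in>U \<inter> X. \<forall>y\<in>U \<inter> X. f x = f y)}"
  have "X \<subseteq> \<Union>\<U>"
  proof
    fix x assume "x \<in> X"
    with assms(2) obtain U where U: "open U" "x \<in> U" "\<And>y. y \<in> U \<Longrightarrow> y \<in> X \<Longrightarrow> f x = f y"
      by (rule locally_const_open) blast
    then have "\<forall>y\<in>U \<inter> X. \<forall>z\<in>U \<inter> X. f y = f z" by (metis IntD1 IntD2)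
    then show "x \<in> \<Union>\<U>" using U(1,2) unfolding \<U>_def by blast
  qed
  then obtain e where e: "e > 0" "\<And>x. x \<in> X \<Longrightarrow> \<exists>U\<in>\<U>. ball x e \<subseteq> U"
    using Heine_Borel_lemma[OF assms(1), of \<U>] unfolding \<U>_def by blast
  have "f x = f y" if xy: "x \<in> X" "y \<in> X" "dist x y < e" for x y
  proof -
    obtain U where U: "U \<in> \<U>" "ball x e \<subseteq> U" using e(2)[OF xy(1)] by blast
    then have "x \<in> U \<inter> X" "y \<in> U \<inter> X" using xy e(1) by auto
    then show "f x = f y" using U(1) unfolding \<U>_def by blast
  qed
  then show ?thesis using e(1) by blast
qed

lemma locally_const_finite_image:
  fixes X :: "'a::metric_space set"
  assumes "compact X" "locally_const X f"
  shows "finite (f ` X)"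
proof -
  obtain e where e: "e > 0" "\<forall>x\<in>X. \<forall>y\<in>X. dist x y < e \<longrightarrow> f x = f y"
    using locally_const_uniform[OF assms] by blast
  have "X \<subseteq> (\<Union>x\<in>X. ball x e)" using e(1) by force
  then obtain D where D: "D \<subseteq> X" "finite D" "X \<subseteq> (\<Union>d\<in>D. ball d e)"
    using compactE_image[OF assms(1), of X "\<lambda>x. ball x e"] by (metis open_ball)
  have "f x \<in> f ` D" if x: "x \<in> X" for x
  proof -
    obtain d where d: "d \<in> D" "dist d x < e" using D(3) x by auto
    then have "f d = f x" using e(2) D(1) x by blast
    then show ?thesis using d(1) by (metis imageI)
  qed
  then have "f ` X \<subseteq> f ` D" by blast
  then show ?thesis using D(2) by (meson finite_imageI finite_subset)
qed

definition clopen_partition :: "'a::topological_space set \<Rightarrow> 'a set set \<Rightarrow> bool" where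
  "clopen_partition X P \<longleftrightarrow> finite P \<and> partition_on X P \<and> (\<forall>C\<in>P. clopen_in X C)"

lemma clopen_partitionD:
  assumes "clopen_partition X P"
  shows "finite P" "\<Union>P = X" "C \<in> P \<Longrightarrow> C \<noteq> {}" "C \<in> P \<Longrightarrow> clopen_in X C" "C \<in> P \<Longrightarrow> C \<subseteq> X"
    "C \<in> P \<Longrightarrow> D \<in> P \<Longrightarrow> x \<in> C \<Longrightarrow> x \<in> D \<Longrightarrow> C = D"
proof -
  have part: "partition_on X P" using assms by (simp add: clopen_partition_def)
  show "\<Union>P = X" using partition_onD1[OF part] by simp
  then show "C \<in> P \<Longrightarrow> C \<subseteq> X" by blast
  show "C \<in> P \<Longrightarrow> C \<noteq> {}" using partition_onD3[OF part] by blast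
  show "C \<in> P \<Longrightarrow> D \<in> P \<Longrightarrow> x \<in> C \<Longrightarrow> x \<in> D \<Longrightarrow> C = D"
    using partition_onD2[OF part] by (auto simp: disjoint_def)
qed (use assms in \<open>simp_all add: clopen_partition_def\<close>)

lemma clopen_partitionI:
  assumes "finite P" "\<Union>P = X" "\<And>C. C \<in> P \<Longrightarrow> C \<noteq> {}" "\<And>C. C \<in> P \<Longrightarrow> clopen_in X C"
    "\<And>C D x. C \<in> P \<Longrightarrow> D \<in> P \<Longrightarrow> x \<in> C \<Longrightarrow> x \<in> D \<Longrightarrow> C = D"
  shows "clopen_partition X P"
proof -
  have "partition_on X P" using assms(2,3,5) by (intro partition_onI) (auto simp: disjnt_iff)
  then show ?thesis using assms(1,4) by (simp add: clopen_partition_def)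
qed

lemma clopen_partition_fibres:
  fixes X :: "'a::metric_space set"
  assumes "compact X" "locally_const X f"
  shows "clopen_partition X ((\<lambda>x. {y\<in>X. f y = f x}) ` X)"
proof (rule clopen_partitionI)
  have "(\<lambda>x. {y\<in>X. f y = f x}) ` X = (\<lambda>v. {y\<in>X. f y = v}) ` (f ` X)" by auto
  then show "finite ((\<lambda>x. {y\<in>X. f y = f x}) ` X)"
    using locally_const_finite_image[OF assms] by simp
qed (use clopen_in_level[OF assms(2)] in auto)

lemma locally_const_partition:
  assumes P: "clopen_partition X P" and const: "\<forall>C\<in>P. const_on f C"
  shows "locally_const X f"
proof (rule locally_constI)
  fix x assume x: "x \<in> X"
  then obtain C where C: "C \<in> P" "x \<in> C" using clopen_partitionD(2)[OF P] by blast
  show "\<forall>\<^sub>F y in at x within X. f y = f x"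
    using locally_constD[OF locally_const_mem[OF clopen_partitionD(4)[OF P C(1)]] x]
  proof eventually_elim
    case (elim y)
    then have "y \<in> C" using C(2) by simp
    then show ?case using const C by blast
  qed
qed

lemma clopen_partition_split:
  assumes P: "clopen_partition X P" and C: "C \<in> P" and W: "clopen_in X W" "W \<noteq> {}" "W \<subset> C"
  defines "P' \<equiv> insert W (insert (C - W) (P - {C}))"
  shows "clopen_partition X P'" and "refines X P' P"
proof -
  show P': "clopen_partition X P'"
  proof (rule clopen_partitionI)
    show "finite P'" using clopen_partitionD(1)[OF P] by (simp add: P'_def)
    show "\<Union>P' = X" using clopen_partitionD(2)[OF P] C W(3) unfolding P'_def by auto
    show "D \<noteq> {}" if "D \<in> P'" for D using that clopen_partitionD(3)[OF P] W(2,3) by (auto simp: P'_def)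
    show "clopen_in X D" if "D \<in> P'" for D
      using that clopen_partitionD(4)[OF P] clopen_in_Diff[OF clopen_partitionD(4)[OF P C] W(1)] W(1)
      by (auto simp: P'_def)
    have "D \<inter> C = {}" if "D \<in> P - {C}" for D using clopen_partitionD(6)[OF P _ C] that by blast
    then show "D = E" if "D \<in> P'" "E \<in> P'" "x \<in> D" "x \<in> E" for D E x
      using that clopen_partitionD(6)[OF P, of D E x] W(3) unfolding P'_def by fast
  qed
  show "refines X P' P"
    using P P' C W(3) by (auto simp: refines_def P'_def clopen_partition_def)
qed

section \<open>Cantor sets\<close>

lemma cantor_setD: "cantor_set X \<Longrightarrow> compact X" "cantor_set X \<Longrightarrow> X \<noteq> {}"
  by (simp_all add: cantor_set_def)

lemma cantor_set_clopen_nbhd: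
  assumes "cantor_set X" "x \<in> X" "open U" "x \<in> U"
  obtains S where "clopen_in X S" "x \<in> S" "S \<subseteq> U"
proof -
  let ?T = "top_of_set X"
  have comp: "compact X" and conn: "connected_component_set X x = {x}"
    using assms by (auto simp: cantor_set_def)
  have "connected_component_of ?T x y \<longleftrightarrow> connected_component X x y" for y
    unfolding connected_component_of_def connected_component_def connectedin_subtopology
      connectedin_iff_connected by blast
  then have "connected_component_of_set ?T x = {x}" using conn by (simp add: set_eq_iff)
  then have "{x} \<in> connected_components_of ?T"
    unfolding connected_components_of_def using assms(2) by (auto intro!: image_eqI[of _ _ x])
  moreover have "closedin ?T (X - U)" using assms(3) by (auto simp: closedin_closed intro: exI[of _ "- U"])
  ultimately have "separated_between ?T {x} (X - U)"
    using comp assms by (intro separated_between_compact_connected_component)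
      (auto simp: compact_space_subtopology compact_imp_locally_compact_space Hausdorff_space_subtopology
        compactin_subtopology disjnt_def)
  then obtain S where "openin ?T S" "closedin ?T S" "x \<in> S" "X - U \<subseteq> X - S"
    unfolding separated_between by auto
  moreover from this have "S \<subseteq> U" using openin_imp_subset by blast
  ultimately show ?thesis using that unfolding clopen_in_def by blast
qed

lemma cantor_set_infinite_open:
  assumes "cantor_set X" "x \<in> X" "open U" "x \<in> U"
  shows "infinite (X \<inter> U)"
proof -
  have "x islimpt (X \<inter> U)"
    using assms by (metis Int_commute cantor_set_def islimpt_Int_eventually eventually_at_topological)
  then show ?thesis using islimpt_finite by blast
qed

lemma clopen_in_infinite:
  assumes "cantor_set X" "clopen_in X A" "A \<noteq> {}"
  shows "infinite A"
proof -
  obtain U where U: "open U" "A = X \<inter> U" using assms(2) by (auto simp: clopen_in_def openin_open)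
  then show ?thesis using cantor_set_infinite_open[OF assms(1) _ U(1)] assms(3) by blast
qed

lemma clopen_in_other_point:
  assumes "cantor_set X" "clopen_in X A" "finite F" "A \<noteq> {}"
  obtains x where "x \<in> A" "x \<notin> F"
  using clopen_in_infinite[OF assms(1,2,4)] assms(3) by (meson finite_subset subsetI)

lemma cantor_set_fine_labelling:
  fixes X :: "'a::metric_space set"
  assumes "cantor_set X" "e > 0"
  obtains l :: "'a \<Rightarrow> 'a set" where "locally_const X l"
    "\<And>x y. x \<in> X \<Longrightarrow> y \<in> X \<Longrightarrow> l x = l y \<Longrightarrow> dist x y < e"
proof -
  have "\<exists>S. clopen_in X S \<and> x \<in> S \<and> S \<subseteq> ball x (e/2)" if "x \<in> X" for x
    using cantor_set_clopen_nbhd[OF assms(1) that, of "ball x (e/2)"] assms(2)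
    by (metis centre_in_ball half_gt_zero open_ball)
  then obtain S where S: "\<And>x. x \<in> X \<Longrightarrow> clopen_in X (S x) \<and> x \<in> S x \<and> S x \<subseteq> ball x (e/2)" by metis
  then have "\<exists>V. open V \<and> S x = X \<inter> V" if "x \<in> X" for x
    using that unfolding clopen_in_def openin_open by blast
  then obtain V where V: "\<And>x. x \<in> X \<Longrightarrow> open (V x) \<and> S x = X \<inter> V x" by metis
  then have "X \<subseteq> (\<Union>x\<in>X. V x)" using S by blast
  then obtain D where D: "D \<subseteq> X" "finite D" "X \<subseteq> (\<Union>x\<in>D. V x)"
    using compactE_image[OF cantor_setD(1)[OF assms(1)], of X V] V by blast
  define l where "l x = {d\<in>D. x \<in> S d}" for x
  show thesis
  proof
    show "locally_const X l"
      unfolding l_def using S D(1,2) by (intro locally_const_Collect locally_const_mem) auto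
    fix x y assume xy: "x \<in> X" "y \<in> X" "l x = l y"
    obtain d where d: "d \<in> l x" using D V xy(1) unfolding l_def by blast
    moreover from this have "d \<in> l y" using xy(3) by simp
    ultimately have "d \<in> X" "x \<in> S d" "y \<in> S d" using D(1) by (auto simp: l_def)
    then have "dist d x < e/2" "dist d y < e/2" using S[of d] by auto
    then show "dist x y < e" by (rule dist_triangle_half_r)
  qed
qed

section \<open>Homeomorphisms between Cantor sets\<close>

lemma limit_of_nested_sets:
  fixes \<kappa> :: "nat \<Rightarrow> 'a::metric_space \<Rightarrow> 'b::metric_space set"
  assumes lc: "\<And>n. locally_const X (\<kappa> n)"
    and ne: "\<And>n x. x \<in> X \<Longrightarrow> \<kappa> n x \<noteq> {}" and comp: "\<And>n x. x \<in> X \<Longrightarrow> compact (\<kappa> n x)"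
    and dec: "\<And>n x. x \<in> X \<Longrightarrow> \<kappa> (Suc n) x \<subseteq> \<kappa> n x"
    and small: "\<And>e. e > 0 \<Longrightarrow> \<exists>n. \<forall>x\<in>X. diam_less e (\<kappa> n x)"
  obtains F where "continuous_on X F" "\<And>x n. x \<in> X \<Longrightarrow> F x \<in> \<kappa> n x"
proof -
  have "\<exists>y. \<forall>n. y \<in> \<kappa> n x" if x: "x \<in> X" for x
  proof -
    have dec: "decseq (\<lambda>n. \<kappa> n x)" using dec[OF x] by (simp add: decseq_Suc_iff)
    then have "closedin (top_of_set (\<kappa> 0 x)) (\<kappa> n x)" for n
      using comp[OF x] by (intro closed_subset compact_imp_closed) (auto dest: decseqD)
    then have "(\<Inter>n. \<kappa> n x) \<noteq> {}"
      using compact_space_imp_nest[of "top_of_set (\<kappa> 0 x)" "\<lambda>n. \<kappa> n x"] comp[OF x] ne[OF x] dec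
      by (simp add: compact_space_subtopology)
    then show ?thesis by blast
  qed
  then obtain F where F: "\<And>x n. x \<in> X \<Longrightarrow> F x \<in> \<kappa> n x" by metis
  have "continuous_on X F"
    unfolding continuous_on_def
  proof (intro ballI tendstoI)
    fix x and e :: real assume x: "x \<in> X" and "e > 0"
    then obtain n where n: "\<forall>x\<in>X. diam_less e (\<kappa> n x)" using small by blast
    have "\<forall>\<^sub>F y in at x within X. \<kappa> n y = \<kappa> n x" using locally_constD[OF lc x] .
    then show "\<forall>\<^sub>F y in at x within X. dist (F y) (F x) < e"
      using eventually_at_within_mem
    proof eventually_elim
      case (elim y)
      then have "F y \<in> \<kappa> n x" using F[of y n] by simp
      then show ?case using n x F[OF x, of n] by blast
    qed
  qed
  then show thesis using that F by blast
qed

definition fine_labelling :: "'a::metric_space set \<Rightarrow> 'a set \<Rightarrow> real \<Rightarrow> ('a \<Rightarrow> 'c) \<Rightarrow> bool" where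
  "fine_labelling X A e l \<longleftrightarrow> locally_const X l \<and> (\<forall>x\<in>A. \<forall>y\<in>A. l x = l y \<longrightarrow> dist x y < e)"

lemma fine_labelling_split:
  fixes l :: "'a::metric_space \<Rightarrow> nat"
  assumes X: "cantor_set X" and A: "clopen_in X A" and l: "fine_labelling X A e l"
    and image: "l ` A = {..<k}" and "k > 0"
  shows "\<exists>l' :: 'a \<Rightarrow> nat. fine_labelling X A e l' \<and> l' ` A = {..<Suc k}"
proof -
  have lc: "locally_const X l" and fine: "\<forall>x\<in>A. \<forall>y\<in>A. l x = l y \<longrightarrow> dist x y < e"
    using l by (auto simp: fine_labelling_def)
  have "0 \<in> l ` A" using image \<open>k > 0\<close> by simp
  then obtain x where x: "x \<in> A" "l x = 0" by auto
  have "clopen_in X (A \<inter> {z\<in>X. l z = 0})"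
    using clopen_in_Int[OF A clopen_in_level[OF lc]] .
  then obtain y where y: "y \<in> A" "l y = 0" "y \<noteq> x"
    using clopen_in_other_point[OF X, of "A \<inter> {z\<in>X. l z = 0}" "{x}"] x clopen_in_subset[OF A] by blast
  obtain S where S: "clopen_in X S" "x \<in> S" "S \<subseteq> - {y}"
    using cantor_set_clopen_nbhd[OF X, of x "- {y}"] x y clopen_in_subset[OF A] by blast
  define l' where "l' z = (if l z = 0 \<and> z \<notin> S then k else l z)" for z
  have "locally_const X l'"
    unfolding l'_def using lc locally_const_mem[OF S(1)]
    by (intro locally_const_if locally_const_comp2[where h="\<lambda>v s. v = 0 \<and> \<not> s"]) simp_all
  moreover have "dist u v < e" if uv: "u \<in> A" "v \<in> A" "l' u = l' v" for u v
  proof -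
    have "l u < k" "l v < k" using image uv by auto
    then have "l u = l v" using uv(3) by (auto simp: l'_def split: if_splits)
    then show ?thesis using fine uv by blast
  qed
  moreover have "l' ` A = {..<Suc k}"
  proof (intro equalityI subsetI)
    fix v assume "v \<in> l' ` A"
    then show "v \<in> {..<Suc k}" using image by (auto simp: l'_def less_Suc_eq)
  next
    fix v assume v: "v \<in> {..<Suc k}"
    have "k = l' y" "0 = l' x" using x y S by (auto simp: l'_def)
    moreover have "v \<in> l' ` A" if "v < k" "v \<noteq> 0"
    proof -
      have "v \<in> l ` A" using image that by simp
      then show ?thesis using that by (auto simp: l'_def)
    qed
    ultimately show "v \<in> l' ` A" using v x(1) y(1) by (metis imageI less_SucE lessThan_iff)
  qed
  ultimately show ?thesis unfolding fine_labelling_def by blast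
qed

lemma ex_fine_labelling_onto:
  fixes X :: "'a::metric_space set"
  assumes X: "cantor_set X" and A: "clopen_in X A" "A \<noteq> {}" and e: "e > 0"
  obtains K where "\<And>k. k \<ge> K \<Longrightarrow> \<exists>l :: 'a \<Rightarrow> nat. fine_labelling X A e l \<and> l ` A = {..<k}"
proof -
  obtain l :: "'a \<Rightarrow> 'a set" where l: "locally_const X l"
    "\<And>x y. x \<in> X \<Longrightarrow> y \<in> X \<Longrightarrow> l x = l y \<Longrightarrow> dist x y < e"
    by (rule cantor_set_fine_labelling[OF X e]) (rule that)
  define K where "K = card (l ` A)"
  have AX: "A \<subseteq> X" using clopen_in_subset[OF A(1)] .
  have fin: "finite (l ` A)"
    using locally_const_finite_image[OF cantor_setD(1)[OF X] l(1)] AX by (meson finite_subset image_mono)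
  then obtain b where b: "bij_betw b (l ` A) {..<K}"
    unfolding K_def using ex_bij_betw_finite_nat by (metis atLeast0LessThan)
  have "K > 0" using fin A(2) by (simp add: K_def card_gt_0_iff)
  have "\<exists>l :: 'a \<Rightarrow> nat. fine_labelling X A e l \<and> l ` A = {..<k}" if "K \<le> k" for k
    using that
  proof (induction k rule: dec_induct)
    case base
    have "dist x y < e" if "x \<in> A" "y \<in> A" "b (l x) = b (l y)" for x y
    proof -
      have "l x = l y" using b that by (meson bij_betw_def image_eqI inj_onD)
      then show ?thesis using l(2) AX that by blast
    qed
    moreover have "(\<lambda>x. b (l x)) ` A = {..<K}" using b by (simp add: bij_betw_def image_image)
    ultimately show ?case
      unfolding fine_labelling_def using locally_const_comp[OF l(1)] by blast
  next
    case (step k)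
    then show ?case using fine_labelling_split[OF X A(1)] \<open>K > 0\<close> by (metis less_le_trans)
  qed
  then show thesis using that by blast
qed

lemma ex_matching_fine_labellings:
  fixes X :: "'a::metric_space set" and Y :: "'b::metric_space set"
  assumes "cantor_set X" "clopen_in X A" "A \<noteq> {}" "cantor_set Y" "clopen_in Y C" "C \<noteq> {}" "e > 0"
  shows "\<exists>(l :: 'a \<Rightarrow> nat) l'. fine_labelling X A e l \<and> fine_labelling Y C e l' \<and> l ` A = l' ` C"
proof -
  obtain K where K: "\<And>k. k \<ge> K \<Longrightarrow> \<exists>l :: 'a \<Rightarrow> nat. fine_labelling X A e l \<and> l ` A = {..<k}"
    by (rule ex_fine_labelling_onto[OF assms(1-3,7)]) (rule that)
  obtain L where L: "\<And>k. k \<ge> L \<Longrightarrow> \<exists>l :: 'b \<Rightarrow> nat. fine_labelling Y C e l \<and> l ` C = {..<k}"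
    by (rule ex_fine_labelling_onto[OF assms(4-7)]) (rule that)
  show ?thesis using K[of "max K L"] L[of "max K L"] by (metis max.cobounded1 max.cobounded2)
qed

definition partition_map ::
  "'a::topological_space set \<Rightarrow> 'b::topological_space set \<Rightarrow> ('a \<Rightarrow> 'b set) \<Rightarrow> bool" where
  "partition_map X Y \<kappa> \<longleftrightarrow> locally_const X \<kappa> \<and> clopen_partition Y (\<kappa> ` X)"

lemma partition_mapD:
  assumes "partition_map X Y \<kappa>"
  shows "locally_const X \<kappa>" "x \<in> X \<Longrightarrow> \<kappa> x \<noteq> {}" "x \<in> X \<Longrightarrow> clopen_in Y (\<kappa> x)"
    "y \<in> Y \<Longrightarrow> \<exists>x\<in>X. y \<in> \<kappa> x" "x \<in> X \<Longrightarrow> z \<in> X \<Longrightarrow> y \<in> \<kappa> x \<Longrightarrow> y \<in> \<kappa> z \<Longrightarrow> \<kappa> x = \<kappa> z"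
proof -
  have part: "clopen_partition Y (\<kappa> ` X)" using assms by (simp add: partition_map_def)
  show "locally_const X \<kappa>" using assms by (simp add: partition_map_def)
  show "x \<in> X \<Longrightarrow> \<kappa> x \<noteq> {}" "x \<in> X \<Longrightarrow> clopen_in Y (\<kappa> x)"
    using clopen_partitionD(3,4)[OF part] by blast+
  show "y \<in> Y \<Longrightarrow> \<exists>x\<in>X. y \<in> \<kappa> x" using clopen_partitionD(2)[OF part] by blast
  show "x \<in> X \<Longrightarrow> z \<in> X \<Longrightarrow> y \<in> \<kappa> x \<Longrightarrow> y \<in> \<kappa> z \<Longrightarrow> \<kappa> x = \<kappa> z"
    using clopen_partitionD(6)[OF part] by blast
qed

lemma partition_map_split:
  fixes X :: "'a::metric_space set" and l :: "'b::metric_space set \<Rightarrow> 'a \<Rightarrow> 'c"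
  assumes X: "compact X" and \<kappa>: "partition_map X Y \<kappa>"
    and l: "\<And>C. locally_const X (l C)" and l': "\<And>C. locally_const Y (l' C)"
    and onto: "\<And>C. C \<in> \<kappa> ` X \<Longrightarrow> l C ` {x\<in>X. \<kappa> x = C} = l' C ` C"
  defines "\<kappa>' \<equiv> \<lambda>x. {y\<in>\<kappa> x. l' (\<kappa> x) y = l (\<kappa> x) x}"
  shows "partition_map X Y \<kappa>'"
    and "x \<in> X \<Longrightarrow> z \<in> X \<Longrightarrow> \<kappa>' x = \<kappa>' z \<Longrightarrow> \<kappa> x = \<kappa> z \<and> l (\<kappa> x) x = l (\<kappa> x) z"
proof -
  have ne: "\<kappa>' x \<noteq> {}" if "x \<in> X" for x
  proof -
    have "l (\<kappa> x) x \<in> l (\<kappa> x) ` {z\<in>X. \<kappa> z = \<kappa> x}" using that by simp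
    then show ?thesis using onto[of "\<kappa> x"] that by (auto simp: \<kappa>'_def)
  qed
  have same: "\<kappa> x = \<kappa> z \<and> l (\<kappa> x) x = l (\<kappa> x) z" if "x \<in> X" "z \<in> X" "y \<in> \<kappa>' x" "y \<in> \<kappa>' z" for x y z
    using that partition_mapD(5)[OF \<kappa>, of x z y] by (simp add: \<kappa>'_def)
  have lc: "locally_const X \<kappa>'"
    unfolding \<kappa>'_def
    by (rule locally_const_select[OF partition_mapD(1)[OF \<kappa>], where g="\<lambda>C x. {y\<in>C. l' C y = l C x}"])
      (rule locally_const_comp[OF l])
  have clopen: "clopen_in Y (\<kappa>' x)" if x: "x \<in> X" for x
  proof -
    have "\<kappa>' x = \<kappa> x \<inter> {y\<in>Y. l' (\<kappa> x) y = l (\<kappa> x) x}"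
      using clopen_in_subset[OF partition_mapD(3)[OF \<kappa> x]] unfolding \<kappa>'_def by blast
    then show ?thesis using clopen_in_Int[OF partition_mapD(3)[OF \<kappa> x] clopen_in_level[OF l']] by simp
  qed
  have cover: "\<exists>z\<in>X. y \<in> \<kappa>' z" if y: "y \<in> Y" for y
  proof -
    obtain x where x: "x \<in> X" "y \<in> \<kappa> x" using partition_mapD(4)[OF \<kappa> y] by blast
    then have "l' (\<kappa> x) y \<in> l (\<kappa> x) ` {z\<in>X. \<kappa> z = \<kappa> x}" using onto[of "\<kappa> x"] by auto
    then obtain z where "z \<in> X" "\<kappa> z = \<kappa> x" "l' (\<kappa> x) y = l (\<kappa> x) z" by auto
    then show ?thesis using x by (auto simp: \<kappa>'_def)
  qed
  have "clopen_partition Y (\<kappa>' ` X)"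
  proof (rule clopen_partitionI)
    show "finite (\<kappa>' ` X)" using locally_const_finite_image[OF X lc] .
    show "\<Union>(\<kappa>' ` X) = Y" using cover clopen clopen_in_subset by blast
    fix C D y assume CD: "C \<in> \<kappa>' ` X" "D \<in> \<kappa>' ` X" "y \<in> C" "y \<in> D"
    then obtain x z where xz: "x \<in> X" "z \<in> X" "C = \<kappa>' x" "D = \<kappa>' z" by blast
    then have "\<kappa> x = \<kappa> z \<and> l (\<kappa> x) x = l (\<kappa> x) z" using CD(3,4) by (intro same) auto
    then show "C = D" unfolding xz(3,4) \<kappa>'_def by metis
  qed (use ne clopen in blast)+
  then show "partition_map X Y \<kappa>'" using lc by (simp add: partition_map_def)
  show "\<kappa> x = \<kappa> z \<and> l (\<kappa> x) x = l (\<kappa> x) z" if xz: "x \<in> X" "z \<in> X" "\<kappa>' x = \<kappa>' z"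
    using ne[OF xz(1)] same[OF xz(1,2)] xz(3) by blast
qed

lemma partition_map_refine:
  fixes X :: "'a::metric_space set" and Y :: "'b::metric_space set"
  assumes X: "cantor_set X" and Y: "cantor_set Y" and \<kappa>: "partition_map X Y \<kappa>" and e: "e > 0"
  shows "\<exists>\<kappa>'. partition_map X Y \<kappa>' \<and> (\<forall>x\<in>X. \<kappa>' x \<subseteq> \<kappa> x)
    \<and> (\<forall>x\<in>X. diam_less e (\<kappa>' x)) \<and> (\<forall>x\<in>X. \<forall>z\<in>X. \<kappa>' x = \<kappa>' z \<longrightarrow> dist x z < e)"
proof -
  define fibre where "fibre C = {x\<in>X. \<kappa> x = C}" for C
  have "\<exists>(l :: 'a \<Rightarrow> nat) l'. locally_const X l \<and> locally_const Y l' \<and> (C \<in> \<kappa> ` X \<longrightarrow>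
      fine_labelling X (fibre C) e l \<and> fine_labelling Y C e l' \<and> l ` fibre C = l' ` C)" for C
  proof (cases "C \<in> \<kappa> ` X")
    case True
    then have "clopen_in X (fibre C)" "fibre C \<noteq> {}" "clopen_in Y C" "C \<noteq> {}"
      using clopen_in_level[OF partition_mapD(1)[OF \<kappa>]] partition_mapD(2,3)[OF \<kappa>]
      unfolding fibre_def by auto
    then obtain l :: "'a \<Rightarrow> nat" and l'
      where "fine_labelling X (fibre C) e l" "fine_labelling Y C e l'" "l ` fibre C = l' ` C"
      using ex_matching_fine_labellings[OF X _ _ Y _ _ e] by blast
    then show ?thesis by (auto simp: fine_labelling_def)
  qed (use locally_const_const in blast)
  then obtain l :: "'b set \<Rightarrow> 'a \<Rightarrow> nat" and l' where
    lc: "\<And>C. locally_const X (l C)" "\<And>C. locally_const Y (l' C)"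
    and fine: "\<And>C. C \<in> \<kappa> ` X \<Longrightarrow> fine_labelling X (fibre C) e (l C)"
      "\<And>C. C \<in> \<kappa> ` X \<Longrightarrow> fine_labelling Y C e (l' C)"
    and onto: "\<And>C. C \<in> \<kappa> ` X \<Longrightarrow> l C ` fibre C = l' C ` C" by metis
  define \<kappa>' where "\<kappa>' x = {y\<in>\<kappa> x. l' (\<kappa> x) y = l (\<kappa> x) x}" for x
  note split = partition_map_split[OF cantor_setD(1)[OF X] \<kappa> lc onto[unfolded fibre_def]]
  have "partition_map X Y \<kappa>'" using split(1) by (simp add: \<kappa>'_def[abs_def])
  moreover have "dist y z < e" if "x \<in> X" "y \<in> \<kappa>' x" "z \<in> \<kappa>' x" for x y z
    using fine(2)[of "\<kappa> x"] that by (auto simp: \<kappa>'_def fine_labelling_def)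
  moreover have "dist x z < e" if xz: "x \<in> X" "z \<in> X" "\<kappa>' x = \<kappa>' z" for x z
  proof -
    have "\<kappa> x = \<kappa> z \<and> l (\<kappa> x) x = l (\<kappa> x) z" using split(2) xz unfolding \<kappa>'_def by blast
    then show ?thesis using fine(1)[of "\<kappa> x"] xz(1,2) unfolding fibre_def fine_labelling_def by blast
  qed
  ultimately show ?thesis by (intro exI[of _ \<kappa>']) (auto simp: \<kappa>'_def)
qed

lemma homeomorphism_of_nested_partition_maps:
  fixes X :: "'a::metric_space set" and Y :: "'b::metric_space set"
  assumes X: "compact X" and Y: "compact Y" and \<kappa>: "\<And>n. partition_map X Y (\<kappa> n)"
    and dec: "\<And>n x. x \<in> X \<Longrightarrow> \<kappa> (Suc n) x \<subseteq> \<kappa> n x"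
    and smallY: "\<And>e. e > 0 \<Longrightarrow> \<exists>n. \<forall>x\<in>X. diam_less e (\<kappa> n x)"
    and smallX: "\<And>e. e > 0 \<Longrightarrow> \<exists>n. \<forall>x\<in>X. \<forall>z\<in>X. \<kappa> n x = \<kappa> n z \<longrightarrow> dist x z < e"
  shows "\<exists>\<sigma> \<tau>. homeomorphism X Y \<sigma> \<tau> \<and> (\<forall>x\<in>X. \<forall>n. \<sigma> x \<in> \<kappa> n x)"
proof -
  note clopen = partition_mapD(3)[OF \<kappa>]
  obtain F where F: "continuous_on X F" "\<And>x n. x \<in> X \<Longrightarrow> F x \<in> \<kappa> n x"
    by (rule limit_of_nested_sets[where X=X and \<kappa>=\<kappa>])
      (use partition_mapD(1,2)[OF \<kappa>] clopen_in_compact[OF clopen Y] dec smallY in auto)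
  have "inj_on F X"
  proof (rule inj_onI, rule ccontr)
    fix x z assume xz: "x \<in> X" "z \<in> X" "F x = F z" "x \<noteq> z"
    then obtain n where n: "\<forall>u\<in>X. \<forall>v\<in>X. \<kappa> n u = \<kappa> n v \<longrightarrow> dist u v < dist x z"
      using smallX[of "dist x z"] by auto
    have "\<kappa> n x = \<kappa> n z" using partition_mapD(5)[OF \<kappa> xz(1,2) F(2)[OF xz(1)]] F(2)[OF xz(2)] xz(3) by simp
    then show False using n xz by blast
  qed
  moreover have "F ` X = Y"
  proof
    show "F ` X \<subseteq> Y" using F(2) clopen_in_subset[OF clopen] by blast
    have "y \<in> closure (F ` X)" if y: "y \<in> Y" for y
      unfolding closure_approachable
    proof (intro allI impI)
      fix e :: real assume "e > 0"
      then obtain n where n: "\<forall>x\<in>X. diam_less e (\<kappa> n x)" using smallY by blast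
      obtain x where "x \<in> X" "y \<in> \<kappa> n x" using partition_mapD(4)[OF \<kappa> y] by blast
      then show "\<exists>z\<in>F ` X. dist z y < e" using n F(2)[of x n] by blast
    qed
    moreover have "closed (F ` X)" using compact_continuous_image[OF F(1) X] compact_imp_closed by blast
    ultimately show "Y \<subseteq> F ` X" by auto
  qed
  ultimately obtain \<tau> where "homeomorphism X Y F \<tau>" using homeomorphism_compact[OF X F(1)] by blast
  then show ?thesis using F(2) by blast
qed

lemma homeomorphism_of_partition_map:
  fixes X :: "'a::metric_space set" and Y :: "'b::metric_space set"
  assumes X: "cantor_set X" and Y: "cantor_set Y" and \<kappa>0: "partition_map X Y \<kappa>0"
  shows "\<exists>\<sigma> \<tau>. homeomorphism X Y \<sigma> \<tau> \<and> (\<forall>x\<in>X. \<sigma> x \<in> \<kappa>0 x)"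
proof -
  define finer where "finer n \<kappa> \<kappa>' \<longleftrightarrow> (\<forall>x\<in>X. \<kappa>' x \<subseteq> \<kappa> x)
    \<and> (\<forall>x\<in>X. \<forall>y\<in>\<kappa>' x. \<forall>z\<in>\<kappa>' x. dist y z < inverse (real (Suc n)))
    \<and> (\<forall>x\<in>X. \<forall>z\<in>X. \<kappa>' x = \<kappa>' z \<longrightarrow> dist x z < inverse (real (Suc n)))"
    for n and \<kappa> \<kappa>' :: "'a \<Rightarrow> 'b set"
  have "\<exists>\<kappa>. \<forall>n. (partition_map X Y (\<kappa> n) \<and> (n = 0 \<longrightarrow> \<kappa> n = \<kappa>0)) \<and> finer n (\<kappa> n) (\<kappa> (Suc n))"
  proof (rule dependent_nat_choice)
    fix \<kappa> and n :: nat assume "partition_map X Y \<kappa> \<and> (n = 0 \<longrightarrow> \<kappa> = \<kappa>0)"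
    then show "\<exists>\<kappa>'. (partition_map X Y \<kappa>' \<and> (Suc n = 0 \<longrightarrow> \<kappa>' = \<kappa>0)) \<and> finer n \<kappa> \<kappa>'"
      unfolding finer_def using partition_map_refine[OF X Y, of \<kappa> "inverse (real (Suc n))"] by auto
  qed (use \<kappa>0 in blast)
  then obtain \<kappa> where \<kappa>: "\<And>n. partition_map X Y (\<kappa> n)" and start: "\<kappa> 0 = \<kappa>0"
    and finer: "\<And>n. finer n (\<kappa> n) (\<kappa> (Suc n))" by blast
  have "\<exists>\<sigma> \<tau>. homeomorphism X Y \<sigma> \<tau> \<and> (\<forall>x\<in>X. \<forall>n. \<sigma> x \<in> \<kappa> n x)"
  proof (rule homeomorphism_of_nested_partition_maps[OF cantor_setD(1)[OF X] cantor_setD(1)[OF Y] \<kappa>])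
    show "\<kappa> (Suc n) x \<subseteq> \<kappa> n x" if "x \<in> X" for n x using finer[of n] that unfolding finer_def by blast
    fix e :: real assume "e > 0"
    then obtain n where "inverse (real (Suc n)) < e" using reals_Archimedean by blast
    then show "\<exists>n. \<forall>x\<in>X. diam_less e (\<kappa> n x)" "\<exists>n. \<forall>x\<in>X. \<forall>z\<in>X. \<kappa> n x = \<kappa> n z \<longrightarrow> dist x z < e"
      using finer[of n] unfolding finer_def by (meson less_trans)+
  qed
  then show ?thesis using start by blast
qed

section \<open>Cantor minimal systems\<close>

lemma hpow_0 [simp]: "hpow X h 0 x = x"
  by (simp add: hpow_def)

lemma hpow_in:
  assumes "bij_betw h X X" "x \<in> X"
  shows "hpow X h n x \<in> X"
proof -
  have "(h ^^ k) x \<in> X" "(inv_into X h ^^ k) x \<in> X" for k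
    using assms by (induction k) (auto simp: bij_betw_def intro: inv_into_into)
  then show ?thesis by (simp add: hpow_def)
qed

lemma hpow_succ:
  assumes "bij_betw h X X" "x \<in> X"
  shows "hpow X h (n + 1) x = h (hpow X h n x)"
proof (cases "0 \<le> n")
  case True
  then show ?thesis by (simp add: hpow_def nat_add_distrib)
next
  case False
  then obtain k where k: "nat (- n) = Suc k" by (cases "nat (- n)") auto
  have "(inv_into X h ^^ k) x \<in> X"
    using assms by (induction k) (auto simp: bij_betw_def intro: inv_into_into)
  then have "h (inv_into X h ((inv_into X h ^^ k) x)) = (inv_into X h ^^ k) x"
    using assms(1) by (auto simp: bij_betw_def f_inv_into_f)
  moreover have "nat (- (n + 1)) = k" "n + 1 \<le> 0" "n + 1 = 0 \<Longrightarrow> k = 0" using k by auto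
  ultimately show ?thesis using False k by (cases "n + 1 = 0") (auto simp: hpow_def)
qed

lemma hpow_pred:
  assumes "bij_betw h X X" "x \<in> X"
  shows "hpow X h (n - 1) x = inv_into X h (hpow X h n x)"
  using hpow_succ[OF assms, of "n - 1"] hpow_in[OF assms, of "n - 1"] assms(1)
  by (simp add: bij_betw_def)

lemma hpow_add:
  assumes "bij_betw h X X" "x \<in> X"
  shows "hpow X h (m + n) x = hpow X h m (hpow X h n x)"
proof (induction m rule: int_induct[where k=0])
  case (step1 i)
  then show ?case
    using hpow_succ[OF assms, of "i + n"] hpow_succ[OF assms(1) hpow_in[OF assms], of i n]
    by (simp add: algebra_simps)
next
  case (step2 i)
  then show ?case
    using hpow_pred[OF assms, of "i + n"] hpow_pred[OF assms(1) hpow_in[OF assms], of i n]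
    by (simp add: algebra_simps)
qed simp

locale cantor_minimal =
  fixes X :: "'a::metric_space set" and \<alpha> :: "'a \<Rightarrow> 'a"
  assumes system: "cantor_minimal_system X \<alpha>"
begin

abbreviation T :: "int \<Rightarrow> 'a \<Rightarrow> 'a" where "T \<equiv> hpow X \<alpha>"

lemma cantor: "cantor_set X" and minimal: "minimal_on X \<alpha>"
  and compact_X: "compact X" and nonempty: "X \<noteq> {}"
  using system by (auto simp: cantor_minimal_system_def cantor_set_def)

lemma bij: "bij_betw \<alpha> X X"
  and continuous_\<alpha>: "continuous_on X \<alpha>"
  and continuous_inv: "continuous_on X (inv_into X \<alpha>)"
proof -
  obtain g where g: "homeomorphism X X \<alpha> g"
    using system by (auto simp: cantor_minimal_system_def is_homeo_def)
  then show b: "bij_betw \<alpha> X X" and "continuous_on X \<alpha>"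
    by (auto simp: homeomorphism_def bij_betw_def intro!: inj_on_inverseI)
  have "inv_into X \<alpha> x = g x" if "x \<in> X" for x
    using g b that by (metis bij_betw_inv_into_left homeomorphism_def image_eqI)
  then show "continuous_on X (inv_into X \<alpha>)"
    using g by (metis continuous_on_cong homeomorphism_def)
qed

lemmas T_in [simp] = hpow_in[OF bij]
lemmas T_succ = hpow_succ[OF bij]
lemmas T_add = hpow_add[OF bij]

lemma T_Suc: "x \<in> X \<Longrightarrow> T (int (Suc n)) x = \<alpha> (T (int n) x)"
  using T_succ[of x "int n"] by (simp add: add.commute)

lemma T_1: "x \<in> X \<Longrightarrow> T 1 x = \<alpha> x"
  using T_succ[of x 0] by simp

lemma \<alpha>_in [simp]: "x \<in> X \<Longrightarrow> \<alpha> x \<in> X"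
  using T_in[of x 1] T_1 by simp

lemma T_minus [simp]: "x \<in> X \<Longrightarrow> T (- n) (T n x) = x" "x \<in> X \<Longrightarrow> T n (T (- n) x) = x"
  using T_add[of x "- n" n] T_add[of x n "- n"] by auto

lemma T_pred_\<alpha> [simp]: "x \<in> X \<Longrightarrow> T (-1) (\<alpha> x) = x"
  and \<alpha>_T_pred [simp]: "x \<in> X \<Longrightarrow> \<alpha> (T (-1) x) = x"
  using T_minus[of x 1] T_1[of x] T_1[of "T (-1) x"] by simp_all

lemma T_\<alpha>: "x \<in> X \<Longrightarrow> T n (\<alpha> x) = T (n + 1) x"
  using T_add[of x n 1] T_1 by simp

lemma T_image_iff: "A \<subseteq> X \<Longrightarrow> x \<in> X \<Longrightarrow> x \<in> T n ` A \<longleftrightarrow> T (- n) x \<in> A"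
  by (metis (no_types, lifting) T_minus image_iff subsetD)

lemma T_image_succ: "A \<subseteq> X \<Longrightarrow> \<alpha> ` (T n ` A) = T (n + 1) ` A"
  unfolding image_image by (rule image_cong) (auto simp: T_succ)

lemma T_1_image: "A \<subseteq> X \<Longrightarrow> T 1 ` A = \<alpha> ` A"
  using T_image_succ[of A 0] by simp

lemma \<alpha>_image_eq_iff: "A \<subseteq> X \<Longrightarrow> B \<subseteq> X \<Longrightarrow> \<alpha> ` A = \<alpha> ` B \<longleftrightarrow> A = B"
  using bij inj_on_image_eq_iff[of \<alpha> X] by (simp add: bij_betw_def)

lemma continuous_T: "continuous_on X (T n)"
proof (induction n rule: int_induct[where k=0])
  case base
  show ?case by (rule continuous_on_eq[OF continuous_on_id]) simp
next
  case (step1 i)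
  have "continuous_on X (\<alpha> \<circ> T i)"
    using step1 continuous_\<alpha> by (intro continuous_on_compose) (auto elim: continuous_on_subset)
  then show ?case by (rule continuous_on_eq) (simp add: T_succ)
next
  case (step2 i)
  have "continuous_on X (inv_into X \<alpha> \<circ> T i)"
    using step2 continuous_inv by (intro continuous_on_compose) (auto elim: continuous_on_subset)
  then show ?case by (rule continuous_on_eq) (simp add: hpow_pred[OF bij])
qed

lemma locally_const_T: "locally_const X f \<Longrightarrow> locally_const X (\<lambda>x. f (T n x))"
  by (rule locally_const_compose[OF _ continuous_T]) auto

lemma locally_const_T_select:
  "locally_const X k \<Longrightarrow> locally_const X f \<Longrightarrow> locally_const X (\<lambda>x. f (T (k x) x))"
  by (rule locally_const_select[where g="\<lambda>n x. f (T n x)"]) (auto intro: locally_const_T)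

lemma clopen_in_T_image:
  assumes "clopen_in X A"
  shows "clopen_in X (T n ` A)"
proof (rule clopen_inI)
  note AX = clopen_in_subset[OF assms]
  show "T n ` A \<subseteq> X" using AX by auto
  show "locally_const X (\<lambda>x. x \<in> T n ` A)"
    using locally_const_T[OF locally_const_mem[OF assms], of "- n"]
    by (rule locally_const_cong) (simp add: T_image_iff[OF AX])
qed

lemma orbit_meets_open:
  assumes E: "clopen_in X E" "E \<noteq> {}" and x: "x \<in> X"
  shows "\<exists>n. T n x \<in> E"
proof -
  define W where "W = {x\<in>X. \<forall>n. T n x \<notin> E}"
  have "openin (top_of_set X) {x\<in>X. T n x \<in> E}" for n
    using openin_locally_const[OF locally_const_T[OF locally_const_mem[OF E(1)]], of "\<lambda>b. b"] .
  then have "openin (top_of_set X) (\<Union>n. {x\<in>X. T n x \<in> E})" by blast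
  moreover have "W = X - (\<Union>n. {x\<in>X. T n x \<in> E})" by (auto simp: W_def)
  ultimately have "closedin (top_of_set X) W"
    using closedin_diff[OF closedin_topspace[of "top_of_set X"]] by simp
  moreover have "\<alpha> ` W = W"
  proof (intro equalityI subsetI)
    fix y assume "y \<in> \<alpha> ` W"
    then show "y \<in> W" by (auto simp: W_def T_\<alpha>)
  next
    fix y assume y: "y \<in> W"
    then have "T n (T (-1) y) \<notin> E" for n
      using T_add[of y n "-1", symmetric] by (simp add: W_def)
    then have "T (-1) y \<in> W" using y by (simp add: W_def)
    then show "y \<in> \<alpha> ` W" using y by (intro image_eqI[of _ _ "T (-1) y"]) (auto simp: W_def)
  qed
  moreover have "W \<noteq> X"
    using E(2) clopen_in_subset[OF E(1)] by (auto simp: W_def dest!: spec[of _ 0])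
  ultimately have "W = {}" using minimal unfolding minimal_on_def W_def by blast
  then show ?thesis using x by (auto simp: W_def)
qed

lemma hits_bounded:
  assumes E: "clopen_in X E" "E \<noteq> {}"
  obtains M :: nat where "\<And>x. x \<in> X \<Longrightarrow> \<exists>i\<le>M. T (int i) x \<in> E"
proof -
  define near where "near k x \<longleftrightarrow> (\<exists>n\<in>{- int k..int k}. T n x \<in> E)" for k x
  have near: "\<exists>k. near k x" if x: "x \<in> X" for x
  proof -
    obtain n where "T n x \<in> E" using orbit_meets_open[OF E x] by blast
    then show ?thesis unfolding near_def by (intro exI[of _ "nat \<bar>n\<bar>"] bexI[of _ n]) auto
  qed
  have "locally_const X (near k)" for k
    unfolding near_def[abs_def]
    by (intro locally_const_Bex locally_const_T locally_const_mem E(1)) simp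
  then have "locally_const X (\<lambda>x. LEAST k. near k x)" using near by (rule locally_const_Least)
  then have "finite ((\<lambda>x. LEAST k. near k x) ` X)" by (rule locally_const_finite_image[OF compact_X])
  then obtain N where N: "\<And>x. x \<in> X \<Longrightarrow> (LEAST k. near k x) \<le> N"
    by (metis finite_nat_set_iff_bounded_le imageI)
  show thesis
  proof (rule that[of "2 * N"])
    fix x assume x: "x \<in> X"
    define k where "k = (LEAST k. near k (T (int N) x))"
    have "near k (T (int N) x)" unfolding k_def using LeastI_ex[OF near] x by simp
    then obtain n where n: "- int k \<le> n" "n \<le> int k" "T n (T (int N) x) \<in> E" by (auto simp: near_def)
    moreover have "k \<le> N" using N x by (simp add: k_def)
    ultimately have "T (int (nat (n + int N))) x \<in> E" "nat (n + int N) \<le> 2 * N"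
      using T_add[OF x, of n "int N"] by auto
    then show "\<exists>i\<le>2 * N. T (int i) x \<in> E" by blast
  qed
qed

lemma hits_forward:
  assumes "clopen_in X E" "E \<noteq> {}" "x \<in> X"
  shows "\<exists>i::nat. T (int i) x \<in> E"
  by (rule hits_bounded[OF assms(1,2)]) (use assms(3) in blast)

lemma hits_backward:
  assumes "clopen_in X E" "E \<noteq> {}" "x \<in> X"
  shows "\<exists>i::nat. T (- int i) x \<in> E"
proof -
  obtain M where M: "\<And>x. x \<in> X \<Longrightarrow> \<exists>i\<le>M. T (int i) x \<in> E" using hits_bounded assms by metis
  then obtain i where i: "i \<le> M" "T (int i) (T (- int M) x) \<in> E" using assms(3) by (meson T_in)
  then have "T (- int (M - i)) x \<in> E"
    using T_add[OF assms(3), of "int i" "- int M"] by (simp add: of_nat_diff)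
  then show ?thesis by blast
qed

lemma not_periodic:
  assumes x: "x \<in> X" and "n > 0"
  shows "T (int n) x \<noteq> x"
proof
  assume per: "T (int n) x = x"
  define A where "A = (\<lambda>i. T (int i) x) ` {..<n}"
  have sub: "A \<subseteq> X" and fin: "finite A" and "A \<noteq> {}" using assms by (auto simp: A_def)
  have "\<alpha> (T (int i) x) \<in> A" if "i < n" for i
  proof (cases "Suc i = n")
    case True
    then have "\<alpha> (T (int i) x) = T (int 0) x" using per T_Suc[OF x, of i] by simp
    then show ?thesis unfolding A_def using \<open>n > 0\<close> by blast
  next
    case False
    then have "Suc i \<in> {..<n}" using that by simp
    then show ?thesis unfolding A_def using T_Suc[OF x, of i] by (metis imageI)
  qed
  then have "\<alpha> ` A \<subseteq> A" by (auto simp: A_def)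
  then have "\<alpha> ` A = A"
    using fin sub bij by (meson bij_betw_def card_subset_eq card_image inj_on_subset)
  moreover have "closedin (top_of_set X) A"
    using fin sub by (simp add: closed_subset finite_imp_closed)
  ultimately have "A = X" using minimal sub \<open>A \<noteq> {}\<close> unfolding minimal_on_def by blast
  then show False using fin clopen_in_infinite[OF cantor clopen_in_self nonempty] by simp
qed

lemma T_inj:
  assumes x: "x \<in> X" and "T m x = T n x"
  shows "m = n"
proof (rule ccontr)
  assume "m \<noteq> n"
  have fixed: "T (m - n) x = x" "T (n - m) x = x"
    using T_add[OF x, of "- n" m] T_add[OF x, of "- m" n] T_minus(1)[OF x, of m] T_minus(1)[OF x, of n]
      assms(2) by simp_all
  have "T (int (nat \<bar>m - n\<bar>)) x = x"
    using fixed by (cases "n \<le> m") simp_all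
  then show False using not_periodic[OF x, of "nat \<bar>m - n\<bar>"] \<open>m \<noteq> n\<close> by simp
qed

section \<open>Columns over a clopen base\<close>

definition clopen_base :: "'a set \<Rightarrow> bool" where
  "clopen_base B \<longleftrightarrow> clopen_in X B \<and> B \<noteq> {}"

definition age :: "'a set \<Rightarrow> 'a \<Rightarrow> nat" where
  "age B x = (LEAST j. T (- int j) x \<in> B)"

definition foot :: "'a set \<Rightarrow> 'a \<Rightarrow> 'a" where
  "foot B x = T (- int (age B x)) x"

definition return_time :: "'a set \<Rightarrow> 'a \<Rightarrow> nat" where
  "return_time B x = Suc (LEAST j. T (int (Suc j)) x \<in> B)"

definition levels :: "'a set \<Rightarrow> 'a set \<Rightarrow> 'a \<Rightarrow> nat set" where
  "levels B A b = {i\<in>{..<return_time B b}. T (int i) b \<in> A}"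

definition column_sum :: "'a set \<Rightarrow> ('a \<Rightarrow> int) \<Rightarrow> 'a \<Rightarrow> int" where
  "column_sum B f b = (\<Sum>i<return_time B b. f (T (int i) b))"

lemma return_time_pos: "0 < return_time B x"
  by (simp add: return_time_def)

lemma not_in_before_return:
  assumes "0 < i" "i < return_time B x"
  shows "T (int i) x \<notin> B"
proof -
  obtain j where j: "i = Suc j" using assms(1) by (cases i) auto
  then have "j < (LEAST j. T (int (Suc j)) x \<in> B)" using assms(2) by (simp add: return_time_def)
  then show ?thesis using not_less_Least j by blast
qed

lemma T_age_foot: "x \<in> X \<Longrightarrow> T (int (age B x)) (foot B x) = x"
  by (simp add: foot_def)

context
  fixes B assumes B: "clopen_base B"
begin

lemma base_subset: "B \<subseteq> X" and base_in: "b \<in> B \<Longrightarrow> b \<in> X" and base_clopen: "clopen_in X B"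
  using B clopen_in_subset by (auto simp: clopen_base_def)

lemma ex_age: "x \<in> X \<Longrightarrow> \<exists>j. T (- int j) x \<in> B"
  using B hits_backward by (simp add: clopen_base_def)

lemma ex_return: "x \<in> X \<Longrightarrow> \<exists>j. T (int (Suc j)) x \<in> B"
  using B hits_forward[of B "\<alpha> x"] T_\<alpha>[of x] by (auto simp: clopen_base_def add.commute)

lemma foot_in: "x \<in> X \<Longrightarrow> foot B x \<in> B"
  unfolding foot_def age_def by (rule LeastI_ex) (rule ex_age)

lemma T_return_in: "x \<in> X \<Longrightarrow> T (int (return_time B x)) x \<in> B"
  unfolding return_time_def using LeastI_ex[OF ex_return] by simp

lemma age_foot_level:
  assumes "b \<in> B" "i < return_time B b"
  shows "age B (T (int i) b) = i" "foot B (T (int i) b) = b"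
proof -
  have bX: "b \<in> X" using assms base_in by blast
  have shift: "T (- int j) (T (int i) b) = T (int i - int j) b" for j
    using T_add[OF bX, of "- int j" "int i"] by simp
  show age: "age B (T (int i) b) = i"
    unfolding age_def
  proof (rule Least_equality)
    show "T (- int i) (T (int i) b) \<in> B" using assms bX by simp
    show "i \<le> j" if "T (- int j) (T (int i) b) \<in> B" for j
    proof (rule ccontr)
      assume "\<not> i \<le> j"
      then have "0 < i - j" "i - j < return_time B b" using assms by auto
      moreover have "T (int (i - j)) b \<in> B" using that shift[of j] \<open>\<not> i \<le> j\<close> by (simp add: of_nat_diff)
      ultimately show False using not_in_before_return by blast
    qed
  qed
  show "foot B (T (int i) b) = b" using age bX by (simp add: foot_def)
qed

lemma age_less_return_time:
  assumes "x \<in> X"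
  shows "age B x < return_time B (foot B x)"
proof (rule ccontr)
  let ?r = "return_time B (foot B x)"
  assume less: "\<not> age B x < ?r"
  have "T (int ?r) (foot B x) \<in> B" using T_return_in base_in foot_in[OF assms] by blast
  also have "T (int ?r) (foot B x) = T (- int (age B x - ?r)) x"
    using T_add[OF assms, of "int ?r" "- int (age B x)"] less
    by (simp add: foot_def of_nat_diff algebra_simps)
  finally have "age B x \<le> age B x - ?r" unfolding age_def by (rule Least_le)
  then show False using return_time_pos[of B "foot B x"] less by linarith
qed

lemma age_base: "b \<in> B \<Longrightarrow> age B b = 0" "b \<in> B \<Longrightarrow> foot B b = b"
  using age_foot_level[of b 0] return_time_pos by auto

lemma age_eq_0: "x \<in> X \<Longrightarrow> age B x = 0 \<longleftrightarrow> x \<in> B"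
  using age_base foot_in[of x] by (auto simp: foot_def)

lemma \<alpha>_eq_T_foot: "x \<in> X \<Longrightarrow> \<alpha> x = T (int (Suc (age B x))) (foot B x)"
  using T_Suc[of "foot B x" "age B x"] T_age_foot base_in foot_in by metis

lemma base_succ_iff:
  assumes "x \<in> X"
  shows "\<alpha> x \<in> B \<longleftrightarrow> Suc (age B x) = return_time B (foot B x)"
  using age_less_return_time[OF assms] T_return_in[OF base_in[OF foot_in[OF assms]]]
    not_in_before_return[of "Suc (age B x)" B "foot B x"]
  unfolding \<alpha>_eq_T_foot[OF assms] by (cases "Suc (age B x) = return_time B (foot B x)") auto

lemma age_foot_succ:
  assumes "x \<in> X" "\<alpha> x \<notin> B"
  shows "age B (\<alpha> x) = Suc (age B x)" "foot B (\<alpha> x) = foot B x"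
proof -
  have "Suc (age B x) < return_time B (foot B x)"
    using base_succ_iff[OF assms(1)] assms(2) age_less_return_time[OF assms(1)] by linarith
  then show "age B (\<alpha> x) = Suc (age B x)" "foot B (\<alpha> x) = foot B x"
    unfolding \<alpha>_eq_T_foot[OF assms(1)] using age_foot_level[OF foot_in[OF assms(1)]] by blast+
qed

lemma bij_betw_levels:
  assumes "A \<subseteq> X"
  shows "bij_betw (\<lambda>(b, i). T (int i) b) (SIGMA b:B. levels B A b) A"
    and "bij_betw (\<lambda>x. (foot B x, age B x)) A (SIGMA b:B. levels B A b)"
proof -
  have level: "\<forall>p\<in>SIGMA b:B. levels B A b. (\<lambda>x. (foot B x, age B x)) ((\<lambda>(b, i). T (int i) b) p) = p"
    using age_foot_level by (auto simp: levels_def)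
  have point: "\<forall>x\<in>A. (\<lambda>(b, i). T (int i) b) (foot B x, age B x) = x"
    using T_age_foot assms by auto
  have into: "(\<lambda>(b, i). T (int i) b) ` (SIGMA b:B. levels B A b) \<subseteq> A"
    by (auto simp: levels_def)
  have onto: "(\<lambda>x. (foot B x, age B x)) ` A \<subseteq> (SIGMA b:B. levels B A b)"
    using assms foot_in age_less_return_time by (auto simp: levels_def T_age_foot subset_iff)
  show "bij_betw (\<lambda>(b, i). T (int i) b) (SIGMA b:B. levels B A b) A"
    using level point into onto by (rule bij_betw_byWitness)
  show "bij_betw (\<lambda>x. (foot B x, age B x)) A (SIGMA b:B. levels B A b)"
    using point level onto into by (rule bij_betw_byWitness)
qed

lemma column_sum_column:
  assumes "b \<in> B"
  shows "column_sum B (\<lambda>x. \<phi> (foot B x) (age B x)) b = (\<Sum>i<return_time B b. \<phi> b i)"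
  unfolding column_sum_def using age_foot_level[OF assms] by (intro sum.cong) auto

lemma column_sum_indicator: "column_sum B (indicator A) b = int (card (levels B A b))"
  by (simp add: column_sum_def levels_def indicator_def Int_def)

lemma locally_const_age: "locally_const X (age B)"
  unfolding age_def using locally_const_T[OF locally_const_mem[OF base_clopen]] ex_age
  by (rule locally_const_Least)

lemma locally_const_return_time: "locally_const X (return_time B)"
proof -
  have "locally_const X (\<lambda>x. LEAST j. T (int (Suc j)) x \<in> B)"
    using locally_const_T[OF locally_const_mem[OF base_clopen]] ex_return by (rule locally_const_Least)
  then show ?thesis unfolding return_time_def[abs_def] by (rule locally_const_comp)
qed

lemma locally_const_foot: "locally_const X f \<Longrightarrow> locally_const X (\<lambda>x. f (foot B x))"
  unfolding foot_def
  by (rule locally_const_T_select[OF locally_const_comp[where h="\<lambda>n. - int n", OF locally_const_age]])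

lemma locally_const_column: "locally_const X \<phi> \<Longrightarrow> locally_const X (\<lambda>x. \<phi> (foot B x) (age B x))"
  by (rule locally_const_comp2[where h="\<lambda>\<psi> n. \<psi> n", OF locally_const_foot locally_const_age])

lemma locally_const_levels:
  assumes "clopen_in X A"
  shows "locally_const X (levels B A)"
  unfolding levels_def[abs_def]
  by (rule locally_const_select[OF locally_const_return_time, where g="\<lambda>n b. {i\<in>{..<n}. T (int i) b \<in> A}"])
    (intro locally_const_Collect locally_const_T locally_const_mem assms finite_lessThan)

lemma locally_const_column_sum:
  assumes "locally_const X f"
  shows "locally_const X (column_sum B f)"
  unfolding column_sum_def[abs_def]
  by (rule locally_const_select[OF locally_const_return_time, where g="\<lambda>n b. \<Sum>i<n. f (T (int i) b)"])
    (intro locally_const_sum locally_const_T assms)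

end

lemma clopen_base_level:
  assumes "locally_const X u" "x \<in> X"
  shows "clopen_base {z\<in>X. u z = u x}"
  using clopen_in_level[OF assms(1)] assms(2) by (auto simp: clopen_base_def)

section \<open>Small bases\<close>

definition small_bases :: "'a set filter" where
  "small_bases = (INF e\<in>{0<..}. principal {B. clopen_base B \<and> diam_less e B})"

lemma eventually_small_bases:
  "eventually Q small_bases \<longleftrightarrow>
    (\<exists>e>0. \<forall>B. clopen_base B \<longrightarrow> diam_less e B \<longrightarrow> Q B)"
proof -
  define small where "small e = {B. clopen_base B \<and> diam_less e B}" for e :: real
  have "eventually Q small_bases \<longleftrightarrow> (\<exists>e\<in>{0<..}. eventually Q (principal (small e)))"
    unfolding small_bases_def small_def[symmetric]
  proof (rule eventually_INF_base)
    fix e e' :: real assume "e \<in> {0<..}" "e' \<in> {0<..}"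
    then show "\<exists>d\<in>{0<..}. principal (small d) \<le> inf (principal (small e)) (principal (small e'))"
      by (intro bexI[of _ "min e e'"]) (auto simp: small_def)
  qed simp
  then show ?thesis by (simp add: eventually_principal small_def Bex_def imp_conjL)
qed

lemma eventually_small_bases_base: "\<forall>\<^sub>F B in small_bases. clopen_base B"
  unfolding eventually_small_bases by (intro exI[of _ 1]) simp

lemma eventually_small_bases_diameter: "e > 0 \<Longrightarrow> \<forall>\<^sub>F B in small_bases. diam_less e B"
  unfolding eventually_small_bases by blast

lemma small_baseE:
  assumes "eventually Q small_bases" "x \<in> X"
  obtains B where "clopen_base B" "x \<in> B" "Q B"
proof -
  obtain e where e: "e > 0" "\<forall>B. clopen_base B \<longrightarrow> diam_less e B \<longrightarrow> Q B"
    using assms(1) unfolding eventually_small_bases by blast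
  obtain l :: "'a \<Rightarrow> 'a set" where l: "locally_const X l"
    "\<And>x y. x \<in> X \<Longrightarrow> y \<in> X \<Longrightarrow> l x = l y \<Longrightarrow> dist x y < e"
    by (rule cantor_set_fine_labelling[OF cantor e(1)]) (rule that)
  have "dist y z < e" if "y \<in> X" "z \<in> X" "l y = l x" "l z = l x" for y z
    using l(2) that by metis
  then show thesis
    using that[of "{z\<in>X. l z = l x}"] clopen_base_level[OF l(1) assms(2)] assms(2) e(2) by blast
qed

lemma eventually_small_bases_constant:
  assumes "locally_const X u"
  shows "\<forall>\<^sub>F B in small_bases. const_on u B"
proof -
  obtain e where e: "e > 0" "\<forall>x\<in>X. \<forall>y\<in>X. dist x y < e \<longrightarrow> u x = u y"
    using locally_const_uniform[OF compact_X assms] by blast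
  show ?thesis using eventually_small_bases_base eventually_small_bases_diameter[OF e(1)]
  proof eventually_elim
    case (elim B)
    then show ?case using e(2) base_subset[OF elim(1)] by blast
  qed
qed

lemma eventually_small_bases_subset:
  assumes "clopen_in X A" "x \<in> A"
  shows "\<forall>\<^sub>F B in small_bases. x \<in> B \<longrightarrow> B \<subseteq> A"
  using eventually_small_bases_constant[OF locally_const_mem[OF assms(1)]]
  by eventually_elim (use assms(2) in blast)

lemma eventually_small_bases_T_image:
  assumes "eventually Q small_bases"
  shows "\<forall>\<^sub>F B in small_bases. Q (T n ` B)"
proof -
  obtain e where e: "e > 0" "\<forall>B. clopen_base B \<longrightarrow> diam_less e B \<longrightarrow> Q B"
    using assms unfolding eventually_small_bases by blast
  obtain l :: "'a \<Rightarrow> 'a set" where l: "locally_const X l"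
    "\<And>x y. x \<in> X \<Longrightarrow> y \<in> X \<Longrightarrow> l x = l y \<Longrightarrow> dist x y < e"
    by (rule cantor_set_fine_labelling[OF cantor e(1)]) (rule that)
  show ?thesis
    using eventually_small_bases_base eventually_small_bases_constant[OF locally_const_T[OF l(1), of n]]
  proof eventually_elim
    case (elim B)
    have "dist (T n x) (T n y) < e" if xy: "x \<in> B" "y \<in> B" for x y
    proof (rule l(2))
      show "T n x \<in> X" "T n y \<in> X" using base_in[OF elim(1)] xy by simp_all
      show "l (T n x) = l (T n y)" using elim(2) xy by blast
    qed
    moreover have "clopen_base (T n ` B)"
      using clopen_in_T_image elim(1) by (simp add: clopen_base_def)
    ultimately show ?case using e(2) by blast
  qed
qed

lemma eventually_le_return_time: "\<forall>\<^sub>F B in small_bases. \<forall>b\<in>B. n \<le> return_time B b"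
proof (induction n)
  case (Suc n)
  show ?case
  proof (cases "n = 0")
    case True
    then show ?thesis using return_time_pos by (simp add: Suc_leI)
  next
    case False
    have "\<forall>x\<in>X. 0 < dist x (T (int n) x)" using not_periodic False by (metis zero_less_dist_iff neq0_conv)
    moreover have "continuous_on X (\<lambda>x. dist x (T (int n) x))"
      by (intro continuous_intros continuous_T)
    ultimately obtain e where e: "e > 0" "\<forall>x\<in>X. e \<le> dist x (T (int n) x)"
      using continuous_attains_inf[OF compact_X nonempty, of "\<lambda>x. dist x (T (int n) x)"] by metis
    show ?thesis
      using Suc eventually_small_bases_base eventually_small_bases_diameter[OF e(1)]
    proof eventually_elim
      case (elim B)
      have "Suc n \<le> return_time B b" if b: "b \<in> B" for b
      proof -
        have bX: "b \<in> X" using base_in[OF elim(2) b] .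
        have "dist b (T (int (return_time B b)) b) < e" using elim(3) b T_return_in[OF elim(2) bX] by blast
        then have "n \<noteq> return_time B b" using e(2) bX by force
        then show ?thesis using elim(1) b by (simp add: Suc_le_eq order.not_eq_order_implies_strict)
      qed
      then show ?case by blast
    qed
  qed
qed simp

section \<open>Cohomology and the order on classes\<close>

definition cohomologous :: "('a \<Rightarrow> int) \<Rightarrow> ('a \<Rightarrow> int) \<Rightarrow> bool" where
  "cohomologous f g \<longleftrightarrow> cob X \<alpha> (\<lambda>x. f x - g x)"

definition class_le :: "('a \<Rightarrow> int) \<Rightarrow> ('a \<Rightarrow> int) \<Rightarrow> bool" where
  "class_le f g \<longleftrightarrow> (\<exists>u. locally_const X u \<and> (\<forall>x\<in>X. f x + (u x - u (T (-1) x)) \<le> g x))"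

lemma cob_iff: "cob X \<alpha> f \<longleftrightarrow> (\<exists>u. locally_const X u \<and> (\<forall>x\<in>X. f x = u x - u (T (-1) x)))"
  by (simp add: cob_def cont_int_iff)

lemma cohomologous_iff:
  "cohomologous f g \<longleftrightarrow> (\<exists>u. locally_const X u \<and> (\<forall>x\<in>X. f x - g x = u x - u (T (-1) x)))"
  by (simp add: cohomologous_def cob_iff)

lemma cohomologousI:
  "locally_const X u \<Longrightarrow> (\<And>x. x \<in> X \<Longrightarrow> f x - g x = u x - u (T (-1) x)) \<Longrightarrow> cohomologous f g"
  by (auto simp: cohomologous_iff)

lemma cohomologous_cong: "(\<And>x. x \<in> X \<Longrightarrow> f x = g x) \<Longrightarrow> cohomologous f g"
  by (rule cohomologousI[of "\<lambda>_. 0"]) auto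

lemma cohomologous_refl [simp]: "cohomologous f f"
  by (rule cohomologous_cong) simp

lemma cohomologous_add:
  assumes "cohomologous f g" "cohomologous f' g'"
  shows "cohomologous (\<lambda>x. f x + f' x) (\<lambda>x. g x + g' x)"
proof -
  obtain u where u: "locally_const X u" "\<forall>x\<in>X. f x - g x = u x - u (T (-1) x)"
    using assms(1) unfolding cohomologous_iff by blast
  obtain v where v: "locally_const X v" "\<forall>x\<in>X. f' x - g' x = v x - v (T (-1) x)"
    using assms(2) unfolding cohomologous_iff by blast
  show ?thesis
  proof (rule cohomologousI)
    show "locally_const X (\<lambda>x. u x + v x)" using u(1) v(1) by (rule locally_const_add)
    show "f x + f' x - (g x + g' x) = u x + v x - (u (T (-1) x) + v (T (-1) x))" if "x \<in> X" for x
      using u(2)[rule_format, OF that] v(2)[rule_format, OF that] by linarith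
  qed
qed

lemma cohomologous_mult:
  assumes "cohomologous f g"
  shows "cohomologous (\<lambda>x. c * f x) (\<lambda>x. c * g x)"
proof -
  obtain u where u: "locally_const X u" "\<forall>x\<in>X. f x - g x = u x - u (T (-1) x)"
    using assms unfolding cohomologous_iff by blast
  show ?thesis
    by (rule cohomologousI[of "\<lambda>x. c * u x"]) (use u in \<open>auto simp flip: right_diff_distrib\<close>)
qed

lemma cohomologous_uminus: "cohomologous f g \<Longrightarrow> cohomologous (\<lambda>x. - f x) (\<lambda>x. - g x)"
  using cohomologous_mult[of f g "-1"] by simp

lemma cohomologous_diff:
  "cohomologous f g \<Longrightarrow> cohomologous f' g' \<Longrightarrow> cohomologous (\<lambda>x. f x - f' x) (\<lambda>x. g x - g' x)"
  using cohomologous_add[OF _ cohomologous_uminus, of f g f' g'] by simp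

lemma cohomologous_sym: "cohomologous f g \<Longrightarrow> cohomologous g f"
  using cohomologous_uminus[of f g] by (simp add: cohomologous_def)

lemma cohomologous_trans [trans]:
  assumes "cohomologous f g" "cohomologous g h"
  shows "cohomologous f h"
  using cohomologous_add[OF assms] by (simp add: cohomologous_def add.commute)

lemma cohomologous_diff_zero_iff: "cohomologous (\<lambda>x. f x - g x) (\<lambda>_. 0) \<longleftrightarrow> cohomologous f g"
  by (simp add: cohomologous_def)

lemma cohomologous_indicator_Diff:
  "B \<subseteq> A \<Longrightarrow> cohomologous (indicator (A - B)) (\<lambda>x. indicator A x - indicator B x)"
  by (rule cohomologous_cong) (auto simp: indicator_def)

lemma cohomologous_sum:
  assumes "\<And>i. i \<in> I \<Longrightarrow> cohomologous (f i) (g i)"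
  shows "cohomologous (\<lambda>x. \<Sum>i\<in>I. f i x) (\<lambda>x. \<Sum>i\<in>I. g i x)"
  using assms by (induction I rule: infinite_finite_induct) (auto intro: cohomologous_add)

lemma cohomologous_shift_one:
  assumes "locally_const X f"
  shows "cohomologous f (\<lambda>x. f (T 1 x))"
proof (rule cohomologousI)
  show "locally_const X (\<lambda>x. - f (T 1 x))" using locally_const_T[OF assms] by (rule locally_const_uminus)
  show "f x - f (T 1 x) = - f (T 1 x) - - f (T 1 (T (- 1) x))" if "x \<in> X" for x
    using T_minus(2)[OF that, of 1] by simp
qed

lemma cohomologous_shift:
  assumes "locally_const X f"
  shows "cohomologous f (\<lambda>x. f (T n x))"
proof (induction n rule: int_induct[where k=0])
  case base
  show ?case by simp
next
  case (step1 i)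
  have "cohomologous (\<lambda>x. f (T i x)) (\<lambda>x. f (T i (T 1 x)))"
    using cohomologous_shift_one[OF locally_const_T[OF assms]] .
  also have "cohomologous \<dots> (\<lambda>x. f (T (i + 1) x))" by (rule cohomologous_cong) (simp add: T_add)
  finally show ?case using step1 cohomologous_trans by blast
next
  case (step2 i)
  have "cohomologous (\<lambda>x. f (T (i - 1) x)) (\<lambda>x. f (T (i - 1) (T 1 x)))"
    using cohomologous_shift_one[OF locally_const_T[OF assms]] .
  also have "cohomologous \<dots> (\<lambda>x. f (T i x))" by (rule cohomologous_cong) (simp flip: T_add)
  finally show ?case using step2 cohomologous_trans cohomologous_sym by blast
qed

lemma cohomologous_imp_class_le:
  assumes "cohomologous f g"
  shows "class_le f g"
proof -
  obtain u where u: "locally_const X u" "\<forall>x\<in>X. f x - g x = u x - u (T (-1) x)"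
    using assms unfolding cohomologous_iff by blast
  have "f x + (- u x - - u (T (-1) x)) \<le> g x" if "x \<in> X" for x
    using u(2)[rule_format, OF that] by linarith
  then show "class_le f g" unfolding class_le_def using locally_const_uminus[OF u(1)] by blast
qed

lemma class_le_pointwise: "(\<And>x. x \<in> X \<Longrightarrow> f x \<le> g x) \<Longrightarrow> class_le f g"
  unfolding class_le_def by (intro exI[of _ "\<lambda>_. 0"]) auto

lemma class_le_add:
  assumes "class_le f g" "class_le f' g'"
  shows "class_le (\<lambda>x. f x + f' x) (\<lambda>x. g x + g' x)"
proof -
  obtain u where u: "locally_const X u" "\<forall>x\<in>X. f x + (u x - u (T (-1) x)) \<le> g x"
    using assms(1) unfolding class_le_def by blast
  obtain v where v: "locally_const X v" "\<forall>x\<in>X. f' x + (v x - v (T (-1) x)) \<le> g' x"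
    using assms(2) unfolding class_le_def by blast
  have "f x + f' x + ((u x + v x) - (u (T (-1) x) + v (T (-1) x))) \<le> g x + g' x" if "x \<in> X" for x
    using u(2)[rule_format, OF that] v(2)[rule_format, OF that] by linarith
  then show ?thesis unfolding class_le_def using locally_const_add[OF u(1) v(1)] by blast
qed

lemma class_le_sum:
  assumes "\<And>i. i \<in> I \<Longrightarrow> class_le (f i) (g i)"
  shows "class_le (\<lambda>x. \<Sum>i\<in>I. f i x) (\<lambda>x. \<Sum>i\<in>I. g i x)"
  using assms by (induction I rule: infinite_finite_induct) (auto intro: class_le_add class_le_pointwise)

lemma class_le_trans [trans]:
  assumes "class_le f g" "class_le g h"
  shows "class_le f h"
  using class_le_add[OF assms] by (simp add: class_le_def add.commute add_le_cancel_left add.left_commute)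

lemma class_le_cohomologous_trans [trans]: "class_le f g \<Longrightarrow> cohomologous g h \<Longrightarrow> class_le f h"
  by (rule class_le_trans[OF _ cohomologous_imp_class_le])

lemma cohomologous_class_le_trans [trans]: "cohomologous f g \<Longrightarrow> class_le g h \<Longrightarrow> class_le f h"
  by (rule class_le_trans[OF cohomologous_imp_class_le])

lemma class_le_diff_iff: "class_le (\<lambda>_. 0) (\<lambda>x. g x - f x) \<longleftrightarrow> class_le f g"
  by (simp add: class_le_def le_diff_eq add.commute)

lemma class_le_mult:
  assumes "class_le f g" "0 \<le> c"
  shows "class_le (\<lambda>x. c * f x) (\<lambda>x. c * g x)"
proof -
  obtain u where u: "locally_const X u" "\<forall>x\<in>X. f x + (u x - u (T (-1) x)) \<le> g x"
    using assms(1) unfolding class_le_def by blast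
  have "c * f x + (c * u x - c * u (T (-1) x)) \<le> c * g x" if "x \<in> X" for x
    using mult_left_mono[OF u(2)[rule_format, OF that] assms(2)] by (simp add: algebra_simps)
  then show ?thesis unfolding class_le_def using locally_const_comp[OF u(1), of "(*) c"] by blast
qed

lemma sum_coboundary:
  fixes u :: "'a \<Rightarrow> int"
  assumes "b \<in> X"
  shows "(\<Sum>i<n. u (T (int i) b) - u (T (-1) (T (int i) b))) = u (T (-1) (T (int n) b)) - u (T (-1) b)"
proof (induction n)
  case (Suc n)
  have "T (-1) (T (int (Suc n)) b) = T (int n) b"
    using T_add[OF assms, of "-1" "int (Suc n)"] by simp
  then show ?case using Suc by simp
qed simp

lemma eventually_column_sum_le:
  assumes "class_le f g"
  shows "\<forall>\<^sub>F B in small_bases. \<forall>b\<in>B. column_sum B f b \<le> column_sum B g b"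
proof -
  obtain u where u: "locally_const X u" "\<forall>x\<in>X. f x + (u x - u (T (-1) x)) \<le> g x"
    using assms unfolding class_le_def by blast
  have "\<forall>\<^sub>F B in small_bases. \<forall>x\<in>B. \<forall>y\<in>B. u (T (-1) x) = u (T (-1) y)"
    using eventually_small_bases_constant[OF locally_const_T[OF u(1)]] .
  then show ?thesis using eventually_small_bases_base
  proof eventually_elim
    case (elim B)
    have "column_sum B f b \<le> column_sum B g b" if b: "b \<in> B" for b
    proof -
      have bX: "b \<in> X" using base_in[OF elim(2) b] .
      have "u (T (-1) (T (int (return_time B b)) b)) = u (T (-1) b)"
        using elim(1) b T_return_in[OF elim(2) bX] by blast
      then have "column_sum B f b = (\<Sum>i<return_time B b. f (T (int i) b)
          + (u (T (int i) b) - u (T (-1) (T (int i) b))))"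
        using sum_coboundary[OF bX, of u] by (simp add: column_sum_def sum.distrib)
      also have "\<dots> \<le> column_sum B g b"
        unfolding column_sum_def using u(2) bX by (intro sum_mono) simp
      finally show ?thesis .
    qed
    then show ?case by blast
  qed
qed

lemma eventually_column_sum_eq:
  assumes "cohomologous f g"
  shows "\<forall>\<^sub>F B in small_bases. \<forall>b\<in>B. column_sum B f b = column_sum B g b"
  using eventually_column_sum_le[OF cohomologous_imp_class_le[OF assms]]
    eventually_column_sum_le[OF cohomologous_imp_class_le[OF cohomologous_sym[OF assms]]]
  by eventually_elim (auto intro: antisym)

lemma cohomologous_of_column_sum:
  assumes B: "clopen_base B" and lc: "locally_const X f" "locally_const X g"
    and eq: "\<And>b. b \<in> B \<Longrightarrow> column_sum B f b = column_sum B g b"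
  shows "cohomologous f g"
proof -
  define S where "S b n = (\<Sum>i<n. f (T (int i) b) - g (T (int i) b))" for b n
  define v where "v x = S (foot B x) (age B x)" for x
  have "locally_const X (\<lambda>x. S (foot B x) (age B x))"
    unfolding S_def
    by (rule locally_const_select[OF locally_const_age[OF B],
          where g="\<lambda>n x. \<Sum>i<n. f (T (int i) (foot B x)) - g (T (int i) (foot B x))"])
      (intro locally_const_foot[OF B] locally_const_sum locally_const_diff locally_const_T lc)
  then have lcv: "locally_const X v" by (simp add: v_def[abs_def])
  have step: "v (\<alpha> x) = v x + (f x - g x)" if x: "x \<in> X" for x
  proof -
    have "S (foot B x) (Suc (age B x)) = v x + (f x - g x)"
      using T_age_foot[OF x] by (simp add: S_def v_def)
    moreover have "v (\<alpha> x) = S (foot B x) (Suc (age B x))"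
    proof (cases "\<alpha> x \<in> B")
      case True
      then have "S (foot B x) (Suc (age B x)) = 0"
        using base_succ_iff[OF B x] eq[OF foot_in[OF B x]] by (simp add: S_def column_sum_def sum_subtractf)
      then show ?thesis using age_base[OF B True] by (simp add: v_def) (simp add: S_def)
    qed (simp add: v_def age_foot_succ[OF B x])
    ultimately show ?thesis by simp
  qed
  show ?thesis
  proof (rule cohomologousI[of "\<lambda>x. v (T 1 x)"])
    show "locally_const X (\<lambda>x. v (T 1 x))" by (rule locally_const_T[OF lcv])
    show "f x - g x = v (T 1 x) - v (T 1 (T (- 1) x))" if "x \<in> X" for x
      using step[OF that] T_1[OF that] T_minus(2)[OF that, of 1] by simp
  qed
qed

lemma class_le_of_column_sum:
  assumes B: "clopen_base B" and lc: "locally_const X f" "locally_const X g"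
    and le: "\<And>b. b \<in> B \<Longrightarrow> column_sum B f b \<le> column_sum B g b"
  shows "class_le f g"
proof -
  define d where "d b i = (if i = 0 then column_sum B g b - column_sum B f b else 0)" for b and i :: nat
  define h where "h x = f x + d (foot B x) (age B x)" for x
  have "locally_const X d"
    unfolding d_def[abs_def]
    by (rule locally_const_comp2[OF locally_const_column_sum[OF B lc(2)] locally_const_column_sum[OF B lc(1)],
          where h="\<lambda>s t i. if i = 0 then s - t else 0"])
  then have lch: "locally_const X h"
    unfolding h_def by (intro locally_const_add lc locally_const_column[OF B])
  have "column_sum B h b = column_sum B g b" if b: "b \<in> B" for b
  proof -
    have "column_sum B h b = column_sum B f b + (\<Sum>i<return_time B b. d b i)"
      using column_sum_column[OF B b, of d] by (simp add: h_def column_sum_def sum.distrib)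
    also have "(\<Sum>i<return_time B b. d b i) = column_sum B g b - column_sum B f b"
      using return_time_pos[of B b] by (simp add: d_def)
    finally show ?thesis by simp
  qed
  then have "cohomologous h g" by (rule cohomologous_of_column_sum[OF B lch lc(2)])
  moreover have "class_le f h"
    using le foot_in[OF B] by (intro class_le_pointwise) (simp add: h_def d_def)
  ultimately show ?thesis by (blast intro: class_le_cohomologous_trans)
qed

lemma class_le_mult_cancel:
  assumes "class_le (\<lambda>x. c * f x) (\<lambda>x. c * g x)" "0 < c" "locally_const X f" "locally_const X g"
  shows "class_le f g"
proof -
  obtain x where "x \<in> X" using nonempty by blast
  then obtain B where B: "clopen_base B"
    and le: "\<forall>b\<in>B. column_sum B (\<lambda>x. c * f x) b \<le> column_sum B (\<lambda>x. c * g x) b"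
    using small_baseE[OF eventually_column_sum_le[OF assms(1)]] by blast
  show ?thesis
    using le \<open>0 < c\<close> by (intro class_le_of_column_sum[OF B assms(3,4)])
      (simp add: column_sum_def flip: sum_distrib_left)
qed

lemma not_class_le_one_zero: "\<not> class_le (\<lambda>_. 1) (\<lambda>_. 0)"
proof
  assume le: "class_le (\<lambda>_. 1) (\<lambda>_. 0)"
  obtain x where x: "x \<in> X" using nonempty by blast
  obtain B where "clopen_base B" "x \<in> B" "\<forall>b\<in>B. column_sum B (\<lambda>_. 1) b \<le> column_sum B (\<lambda>_. 0) b"
    using small_baseE[OF eventually_column_sum_le[OF le] x] by blast
  then show False using return_time_pos[of B x] by (force simp: column_sum_def)
qed

lemma one_le_multiple_indicator:
  assumes "clopen_in X A" "A \<noteq> {}"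
  obtains n :: nat where "n > 0" "class_le (\<lambda>_. 1) (\<lambda>x. int n * indicator A x)"
proof -
  obtain M where M: "\<And>x. x \<in> X \<Longrightarrow> \<exists>i\<le>M. T (int i) x \<in> A" using hits_bounded[OF assms] by blast
  have "1 \<le> (\<Sum>i\<le>M. indicator A (T (int i) x) :: int)" if x: "x \<in> X" for x
  proof -
    obtain i where i: "i \<le> M" "T (int i) x \<in> A" using M x by blast
    then have "indicator A (T (int i) x) \<le> (\<Sum>i\<le>M. indicator A (T (int i) x) :: int)"
      by (intro member_le_sum) auto
    then show ?thesis using i(2) by simp
  qed
  then have "class_le (\<lambda>_. 1) (\<lambda>x. \<Sum>i\<le>M. indicator A (T (int i) x))" by (rule class_le_pointwise)
  also have "cohomologous \<dots> (\<lambda>x. \<Sum>i\<le>M. indicator A x)"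
    by (intro cohomologous_sum cohomologous_sym[OF cohomologous_shift] locally_const_indicator assms)
  finally show thesis using that[of "Suc M"] by simp
qed

lemma ex_nonneg_representative:
  assumes "class_le (\<lambda>_. 0) g" "locally_const X g"
  obtains h where "locally_const X h" "\<forall>x\<in>X. 0 \<le> h x" "cohomologous g h"
proof -
  obtain u where u: "locally_const X u" "\<forall>x\<in>X. u x - u (T (-1) x) \<le> g x"
    using assms(1) unfolding class_le_def by auto
  show thesis
  proof (rule that[of "\<lambda>x. g x - (u x - u (T (-1) x))"])
    show "locally_const X (\<lambda>x. g x - (u x - u (T (-1) x)))"
      by (intro locally_const_diff assms(2) u(1) locally_const_T)
    show "cohomologous g (\<lambda>x. g x - (u x - u (T (-1) x)))"
      by (rule cohomologousI[OF u(1)]) simp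
  qed (use u(2) in simp)
qed

lemma one_le_multiple:
  assumes g: "class_le (\<lambda>_. 0) g" "\<not> cohomologous g (\<lambda>_. 0)" "locally_const X g"
  obtains n :: nat where "n > 0" "class_le (\<lambda>_. 1) (\<lambda>x. int n * g x)"
proof -
  obtain h where lch: "locally_const X h" and pos: "\<forall>x\<in>X. 0 \<le> h x" and gh: "cohomologous g h"
    using ex_nonneg_representative[OF g(1,3)] by metis
  have "{x\<in>X. h x \<noteq> 0} \<noteq> {}"
  proof
    assume "{x\<in>X. h x \<noteq> 0} = {}"
    then have "cohomologous h (\<lambda>_. 0)" by (intro cohomologous_cong) blast
    then show False using gh g(2) cohomologous_trans by blast
  qed
  then obtain n where n: "n > 0" "class_le (\<lambda>_. 1) (\<lambda>x. int n * indicator {x\<in>X. h x \<noteq> 0} x)"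
    using one_le_multiple_indicator[OF clopen_in_level[OF lch, of "\<lambda>v. v \<noteq> 0"]] by metis
  note n(2)
  also have "class_le (\<lambda>x. int n * indicator {x\<in>X. h x \<noteq> 0} x) (\<lambda>x. int n * h x)"
  proof (intro class_le_mult class_le_pointwise)
    fix x assume "x \<in> X"
    then show "indicator {x\<in>X. h x \<noteq> 0} x \<le> h x" using pos[rule_format, of x] by (auto simp: indicator_def)
  qed simp
  also have "cohomologous (\<lambda>x. int n * h x) (\<lambda>x. int n * g x)"
    using cohomologous_mult[OF cohomologous_sym[OF gh]] .
  finally show thesis by (rule that[OF n(1)])
qed

lemma indicator_cohomologous_zero:
  assumes "clopen_in X A" "cohomologous (indicator A) (\<lambda>_. 0)"
  shows "A = {}"
proof (rule ccontr)
  assume "A \<noteq> {}"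
  then obtain n :: nat where "class_le (\<lambda>_. 1) (\<lambda>x. int n * indicator A x)"
    using one_le_multiple_indicator[OF assms(1)] by metis
  also have "cohomologous \<dots> (\<lambda>x. int n * 0)" using assms(2) by (rule cohomologous_mult)
  finally show False using not_class_le_one_zero by simp
qed

lemma eventually_multiple_indicator_le_one:
  "\<forall>\<^sub>F B in small_bases. class_le (\<lambda>x. int n * indicator B x) (\<lambda>_. 1)"
  using eventually_le_return_time[of n] eventually_small_bases_base
proof eventually_elim
  case (elim B)
  show ?case
  proof (rule class_le_of_column_sum[OF elim(2)])
    show "locally_const X (\<lambda>x. int n * indicator B x)"
      using locally_const_comp[OF locally_const_indicator[OF base_clopen[OF elim(2)]]] .
    fix b assume b: "b \<in> B"
    have "levels B B b = {0}"
      using b return_time_pos[of B b] not_in_before_return[of _ B b] by (force simp: levels_def)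
    then have "column_sum B (indicator B) b = 1" using column_sum_indicator[OF elim(2)] by simp
    moreover have "column_sum B (\<lambda>x. int n * indicator B x) b = int n * column_sum B (indicator B) b"
      by (simp only: column_sum_def sum_distrib_left)
    ultimately show "column_sum B (\<lambda>x. int n * indicator B x) b \<le> column_sum B (\<lambda>_. 1) b"
      using elim(1) b by (simp add: column_sum_def[of _ "\<lambda>_. 1"])
  qed simp
qed

section \<open>Realising classes by clopen sets\<close>

lemma ex_clopen_subset_of_class:
  assumes A: "clopen_in X A" and f: "locally_const X f"
    and le: "class_le (\<lambda>_. 0) f" "class_le f (indicator A)"
  shows "\<exists>C. clopen_in X C \<and> C \<subseteq> A \<and> cohomologous (indicator C) f"
proof -
  obtain x where x: "x \<in> X" using nonempty by blast
  obtain B where B: "clopen_base B"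
    and pos: "\<forall>b\<in>B. column_sum B (\<lambda>_. 0) b \<le> column_sum B f b"
    and le': "\<forall>b\<in>B. column_sum B f b \<le> column_sum B (indicator A) b"
    by (rule small_baseE[OF eventually_conj[OF eventually_column_sum_le[OF le(1)]
          eventually_column_sum_le[OF le(2)]] x]) blast
  define part where "part S n = (SOME S' :: nat set. S' \<subseteq> S \<and> card S' = n)" for S n
  define sel where "sel b = part (levels B A b) (nat (column_sum B f b))" for b
  have sel: "sel b \<subseteq> levels B A b" "int (card (sel b)) = column_sum B f b" if "b \<in> B" for b
  proof -
    have "0 \<le> column_sum B f b" using pos that by (simp add: column_sum_def)
    moreover have "column_sum B f b \<le> int (card (levels B A b))"
      using le' that column_sum_indicator[OF B] by simp
    ultimately have "\<exists>S. S \<subseteq> levels B A b \<and> card S = nat (column_sum B f b)"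
      using obtain_subset_with_card_n[of "nat (column_sum B f b)" "levels B A b"]
      by (metis nat_le_iff)
    from someI_ex[OF this] show "sel b \<subseteq> levels B A b" "int (card (sel b)) = column_sum B f b"
      unfolding sel_def part_def using \<open>0 \<le> column_sum B f b\<close> by simp_all
  qed
  have "locally_const X sel"
    unfolding sel_def[abs_def]
    by (rule locally_const_comp2[OF locally_const_levels[OF B A] locally_const_column_sum[OF B f],
          where h="\<lambda>S s. part S (nat s)"])
  then have lc: "locally_const X (\<lambda>x. age B x \<in> sel (foot B x))"
    by (rule locally_const_comp2[OF locally_const_age[OF B] locally_const_foot[OF B]])
  define C where "C = {x\<in>X. age B x \<in> sel (foot B x)}"
  have C: "clopen_in X C" unfolding C_def using clopen_in_level[OF lc, of "\<lambda>b. b"] .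
  have "x \<in> A" if "x \<in> C" for x
  proof -
    have "x \<in> X" "age B x \<in> levels B A (foot B x)" using that sel(1) foot_in[OF B] by (auto simp: C_def)
    then show ?thesis using T_age_foot[of x B] by (simp add: levels_def)
  qed
  moreover have "column_sum B (indicator C) b = column_sum B f b" if b: "b \<in> B" for b
  proof -
    have "levels B C b = sel b"
      using sel(1)[OF b] age_foot_level[OF B b] base_in[OF B b] by (auto simp: levels_def C_def)
    then show ?thesis using column_sum_indicator[OF B] sel(2)[OF b] by simp
  qed
  ultimately show ?thesis
    using cohomologous_of_column_sum[OF B locally_const_indicator[OF C] f] C by blast
qed

text \<open>The bijection between the levels of a column is chosen depending only on the two sets of levels,
  which makes it locally constant.\<close>

lemma ex_power_bij_of_cohomologous:
  assumes A: "clopen_in X A" and C: "clopen_in X C" and AC: "cohomologous (indicator A) (indicator C)"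
  shows "\<exists>k. locally_const X k \<and> bij_betw (\<lambda>x. T (k x) x) A C"
proof -
  obtain x where x: "x \<in> X" using nonempty by blast
  obtain B where B: "clopen_base B"
    and eq: "\<forall>b\<in>B. column_sum B (indicator A) b = column_sum B (indicator C) b"
    by (rule small_baseE[OF eventually_column_sum_eq[OF AC] x]) blast
  define m where "m S S' = (SOME h :: nat \<Rightarrow> nat. bij_betw h S S')" for S S'
  define \<psi> where "\<psi> b = m (levels B A b) (levels B C b)" for b
  have \<psi>: "bij_betw (\<psi> b) (levels B A b) (levels B C b)" if "b \<in> B" for b
  proof -
    have "card (levels B A b) = card (levels B C b)" using eq that column_sum_indicator[OF B] by simp
    then have "\<exists>h. bij_betw h (levels B A b) (levels B C b)"
      by (intro finite_same_card_bij) (simp_all add: levels_def)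
    then show ?thesis unfolding \<psi>_def m_def by (rule someI_ex)
  qed
  define k where "k x = int (\<psi> (foot B x) (age B x)) - int (age B x)" for x
  have "locally_const X \<psi>"
    unfolding \<psi>_def[abs_def]
    by (rule locally_const_comp2[OF locally_const_levels[OF B A] locally_const_levels[OF B C]])
  then have "locally_const X k"
    unfolding k_def
    by (rule locally_const_comp2[where h="\<lambda>i j. int i - int j",
          OF locally_const_column[OF B] locally_const_age[OF B]])
  moreover have "bij_betw (\<lambda>x. T (k x) x) A C"
  proof -
    have "bij_betw (\<lambda>(b, i). (b, \<psi> b i)) (SIGMA b:B. levels B A b) (SIGMA b:B. levels B C b)"
    proof (rule bij_betw_byWitness[where f'="\<lambda>(b, i). (b, inv_into (levels B A b) (\<psi> b) i)"])
    qed (use \<psi> in \<open>auto intro: bij_betw_inv_into_left bij_betw_inv_into_right bij_betw_apply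
        bij_betw_apply[OF bij_betw_inv_into]\<close>)
    then have "bij_betw ((\<lambda>(b, i). T (int i) b) \<circ> (\<lambda>(b, i). (b, \<psi> b i)) \<circ> (\<lambda>x. (foot B x, age B x))) A C"
      using bij_betw_levels(2)[OF B clopen_in_subset[OF A]] bij_betw_levels(1)[OF B clopen_in_subset[OF C]]
      by (blast intro: bij_betw_trans)
    moreover have "T (k x) x = T (int (\<psi> (foot B x) (age B x))) (foot B x)" if "x \<in> A" for x
      using T_add[of x "int (\<psi> (foot B x) (age B x))" "- int (age B x)"] clopen_in_subset[OF A] that
      by (auto simp: k_def foot_def)
    ultimately show ?thesis by (auto cong: bij_betw_cong)
  qed
  ultimately show ?thesis by blast
qed

lemma ex_labelled_power_bij:
  assumes A: "clopen_in X A" and C: "clopen_in X C" and lc: "locally_const X a" "locally_const X c"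
    and coh: "\<And>l. cohomologous (indicator {x\<in>A. a x = l}) (indicator {x\<in>C. c x = l})"
  obtains k where "locally_const X k" "bij_betw (\<lambda>x. T (k x) x) A C" "\<And>x. x \<in> A \<Longrightarrow> c (T (k x) x) = a x"
proof -
  have clopen: "clopen_in X {x\<in>D. f x = l}" if "clopen_in X D" "locally_const X f" for D l f
  proof -
    have "{x\<in>D. f x = l} = D \<inter> {x\<in>X. f x = l}" using clopen_in_subset[OF that(1)] by blast
    then show ?thesis using clopen_in_Int[OF that(1) clopen_in_level[OF that(2)]] by simp
  qed
  have "\<exists>k. locally_const X k \<and> bij_betw (\<lambda>x. T (k x) x) {x\<in>A. a x = l} {x\<in>C. c x = l}" for l
    using ex_power_bij_of_cohomologous[OF clopen[OF A lc(1)] clopen[OF C lc(2)] coh] .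
  then have "\<exists>k. \<forall>l. locally_const X (k l) \<and> bij_betw (\<lambda>x. T (k l x) x) {x\<in>A. a x = l} {x\<in>C. c x = l}"
    by (intro choice allI)
  then obtain k where k: "\<And>l. locally_const X (k l)"
    "\<And>l. bij_betw (\<lambda>x. T (k l x) x) {x\<in>A. a x = l} {x\<in>C. c x = l}" by blast
  have maps: "T (k (a x) x) x \<in> C \<and> c (T (k (a x) x) x) = a x" if "x \<in> A" for x
    using bij_betwE[OF k(2)[of "a x"]] that by blast
  have "bij_betw (\<lambda>x. T (k (a x) x) x) A C"
  proof (rule bij_betwI')
    fix x y assume xy: "x \<in> A" "y \<in> A"
    show "(T (k (a x) x) x = T (k (a y) y) y) = (x = y)"
    proof
      assume eq: "T (k (a x) x) x = T (k (a y) y) y"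
      then have "a x = a y" using maps xy by metis
      then show "x = y"
        using k(2)[of "a x"] eq xy unfolding bij_betw_def by (metis (mono_tags, lifting) inj_onD mem_Collect_eq)
    qed simp
  next
    fix z assume "z \<in> C"
    then have "z \<in> {x\<in>C. c x = c z}" by simp
    then obtain x where "x \<in> A" "a x = c z" "z = T (k (c z) x) x"
      using k(2)[of "c z"] unfolding bij_betw_def by blast
    then have "z = T (k (a x) x) x" by simp
    then show "\<exists>x\<in>A. z = T (k (a x) x) x" using \<open>x \<in> A\<close> by blast
  qed (use maps in blast)
  moreover have "locally_const X (\<lambda>x. k (a x) x)" by (rule locally_const_select[OF lc(1) k(1)])
  ultimately show thesis using that[of "\<lambda>x. k (a x) x"] maps by blast
qed

section \<open>Homeomorphisms that are locally powers\<close>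

lemma cohomologous_transport:
  assumes f: "locally_const X f" and k: "locally_const X k" and \<gamma>: "bij_betw \<gamma> X X"
    and g: "\<And>x. x \<in> X \<Longrightarrow> g (\<gamma> x) = f x" and fk: "\<And>x. x \<in> X \<Longrightarrow> f x \<noteq> 0 \<Longrightarrow> \<gamma> x = T (k x) x"
  shows "locally_const X g" "cohomologous f g"
proof -
  have fin: "finite (k ` X)" using locally_const_finite_image[OF compact_X k] .
  define h where "h n x = (if k x = n then f x else 0)" for n x
  have lch: "locally_const X (h n)" for n
    unfolding h_def[abs_def] by (rule locally_const_if[OF locally_const_comp[OF k] f]) simp
  have source: "(\<Sum>n\<in>k ` X. h n x) = f x" if "x \<in> X" for x
    using that fin by (simp add: h_def)
  have target: "(\<Sum>n\<in>k ` X. h n (T (- n) z)) = g z" if z: "z \<in> X" for z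
  proof -
    obtain x where x: "x \<in> X" "z = \<gamma> x" using \<gamma> z by (auto simp: bij_betw_def)
    have "h n (T (- n) z) = (if n = k x then f x else 0)" for n
    proof (cases "k (T (- n) z) = n \<and> f (T (- n) z) \<noteq> 0")
      case True
      then have "\<gamma> (T (- n) z) = \<gamma> x" using fk[of "T (- n) z"] z x(2) by simp
      then have "T (- n) z = x" using \<gamma> x(1) z by (metis T_in bij_betw_def inj_onD)
      then show ?thesis using True by (auto simp: h_def)
    next
      case False
      then have "h n (T (- n) z) = 0" by (auto simp: h_def)
      moreover have "f x = 0" if n: "n = k x"
      proof (rule ccontr)
        assume "f x \<noteq> 0"
        then have "T (- n) z = x" using fk[OF x(1)] x n by simp
        then show False using False n \<open>f x \<noteq> 0\<close> by simp
      qed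
      ultimately show ?thesis by simp
    qed
    then show ?thesis using fin x g by simp
  qed
  have "locally_const X (\<lambda>z. \<Sum>n\<in>k ` X. h n (T (- n) z))" by (intro locally_const_sum locally_const_T lch)
  then show "locally_const X g" by (rule locally_const_cong) (rule target)
  have "cohomologous f (\<lambda>x. \<Sum>n\<in>k ` X. h n x)" by (rule cohomologous_cong) (simp add: source)
  also have "cohomologous \<dots> (\<lambda>x. \<Sum>n\<in>k ` X. h n (T (- n) x))"
    by (intro cohomologous_sum cohomologous_shift lch)
  also have "cohomologous \<dots> g" by (rule cohomologous_cong) (rule target)
  finally show "cohomologous f g" .
qed

definition piecewise_power :: "('a \<Rightarrow> 'a) \<Rightarrow> bool" where
  "piecewise_power \<gamma> \<longleftrightarrow> bij_betw \<gamma> X X \<and> (\<exists>k. locally_const X k \<and> (\<forall>x\<in>X. \<gamma> x = T (k x) x))"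

lemma piecewise_power_id: "piecewise_power (\<lambda>x. x)"
  unfolding piecewise_power_def by (auto simp: bij_betw_def intro!: exI[of _ "\<lambda>_. 0"])

lemma locally_const_piecewise_power:
  assumes "piecewise_power \<gamma>" "locally_const X f"
  shows "locally_const X (\<lambda>x. f (\<gamma> x))"
proof -
  obtain k where k: "locally_const X k" "\<forall>x\<in>X. \<gamma> x = T (k x) x"
    using assms(1) by (auto simp: piecewise_power_def)
  show ?thesis
    by (rule locally_const_cong[OF locally_const_T_select[OF k(1) assms(2)]]) (simp add: k(2))
qed

lemma continuous_piecewise_power:
  assumes "piecewise_power \<gamma>"
  shows "continuous_on X \<gamma>"
  unfolding continuous_on_def
proof
  fix x assume x: "x \<in> X"
  obtain k where k: "locally_const X k" "\<forall>x\<in>X. \<gamma> x = T (k x) x"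
    using assms unfolding piecewise_power_def by blast
  have "(T (k x) \<longlongrightarrow> \<gamma> x) (at x within X)" using continuous_T[of "k x"] k(2) x by (simp add: continuous_on_def)
  moreover have "\<forall>\<^sub>F y in at x within X. T (k x) y = \<gamma> y"
    using locally_constD[OF k(1) x] eventually_at_within_mem by eventually_elim (simp add: k(2))
  ultimately show "(\<gamma> \<longlongrightarrow> \<gamma> x) (at x within X)" by (rule Lim_transform_eventually)
qed

lemma piecewise_power_comp:
  assumes "piecewise_power \<gamma>" "piecewise_power \<delta>"
  shows "piecewise_power (\<gamma> \<circ> \<delta>)"
proof -
  obtain k where k: "locally_const X k" "\<forall>x\<in>X. \<gamma> x = T (k x) x"
    using assms(1) by (auto simp: piecewise_power_def)
  obtain l where l: "locally_const X l" "\<forall>x\<in>X. \<delta> x = T (l x) x"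
    using assms(2) by (auto simp: piecewise_power_def)
  have "locally_const X (\<lambda>x. k (\<delta> x) + l x)"
    using locally_const_piecewise_power[OF assms(2) k(1)] l(1) by (rule locally_const_add)
  moreover have "(\<gamma> \<circ> \<delta>) x = T (k (\<delta> x) + l x) x" if "x \<in> X" for x
  proof -
    have "\<delta> x \<in> X" using l(2) that by simp
    then show ?thesis using k(2) l(2) T_add[OF that] that by simp
  qed
  moreover have "bij_betw (\<gamma> \<circ> \<delta>) X X"
    using assms unfolding piecewise_power_def by (blast intro: bij_betw_trans)
  ultimately show ?thesis unfolding piecewise_power_def by (intro conjI exI[of _ "\<lambda>x. k (\<delta> x) + l x"]) auto
qed

lemma piecewise_power_funpow: "piecewise_power \<gamma> \<Longrightarrow> piecewise_power (\<gamma> ^^ n)"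
  by (induction n) (auto simp: piecewise_power_comp piecewise_power_id id_def)

context
  fixes \<gamma> assumes \<gamma>: "piecewise_power \<gamma>"
begin

lemma piecewise_power_bij: "bij_betw \<gamma> X X" using \<gamma> by (simp add: piecewise_power_def)

lemma piecewise_power_in: "x \<in> X \<Longrightarrow> \<gamma> x \<in> X" using piecewise_power_bij by (auto simp: bij_betw_def)

lemma piecewise_power_inv_in: "x \<in> X \<Longrightarrow> inv_into X \<gamma> x \<in> X"
  using piecewise_power_bij by (auto simp: bij_betw_def intro: inv_into_into)

lemma piecewise_power_inv_cancel:
  "x \<in> X \<Longrightarrow> \<gamma> (inv_into X \<gamma> x) = x" "x \<in> X \<Longrightarrow> inv_into X \<gamma> (\<gamma> x) = x"
  using piecewise_power_bij by (auto simp: bij_betw_def f_inv_into_f)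

lemma piecewise_power_inv: "piecewise_power (inv_into X \<gamma>)"
proof -
  obtain k where k: "locally_const X k" "\<forall>x\<in>X. \<gamma> x = T (k x) x" using \<gamma> by (auto simp: piecewise_power_def)
  have "locally_const X (\<lambda>z. k (inv_into X \<gamma> z))"
    by (rule cohomologous_transport(1)[OF k(1) k(1) piecewise_power_bij])
      (simp add: piecewise_power_inv_cancel, use k(2) in blast)
  then have "locally_const X (\<lambda>z. - k (inv_into X \<gamma> z))" by (rule locally_const_uminus)
  moreover have "inv_into X \<gamma> z = T (- k (inv_into X \<gamma> z)) z" if "z \<in> X" for z
    using k(2) piecewise_power_inv_in[OF that] piecewise_power_inv_cancel(1)[OF that] by (metis T_minus(1))
  ultimately show ?thesis
    unfolding piecewise_power_def using bij_betw_inv_into[OF piecewise_power_bij] by blast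
qed

lemma cohomologous_piecewise_power_image:
  assumes A: "clopen_in X A"
  shows "cohomologous (indicator A) (indicator (\<gamma> ` A))"
proof -
  obtain k where k: "locally_const X k" "\<forall>x\<in>X. \<gamma> x = T (k x) x" using \<gamma> by (auto simp: piecewise_power_def)
  have image: "\<gamma> x \<in> \<gamma> ` A \<longleftrightarrow> x \<in> A" if "x \<in> X" for x
    using clopen_in_subset[OF A] piecewise_power_bij that by (meson bij_betw_def inj_on_image_mem_iff)
  show ?thesis
    by (rule cohomologous_transport(2)[OF locally_const_indicator[OF A] k(1) piecewise_power_bij])
      (simp add: indicator_def image, use k(2) in blast)
qed

lemma piecewise_power_glue:
  assumes A: "clopen_in X A" and k: "locally_const X k" "bij_betw (\<lambda>x. T (k x) x) A (\<gamma> ` A)"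
  shows "piecewise_power (\<lambda>x. if x \<in> A then T (k x) x else \<gamma> x)"
proof -
  obtain l where l: "locally_const X l" "\<forall>x\<in>X. \<gamma> x = T (l x) x" using \<gamma> by (auto simp: piecewise_power_def)
  have AX: "A \<subseteq> X" using clopen_in_subset[OF A] .
  have "\<gamma> ` (X - A) = X - \<gamma> ` A"
    using piecewise_power_bij AX by (auto simp: bij_betw_def inj_on_image_set_diff[of \<gamma> X])
  then have "bij_betw \<gamma> (X - A) (X - \<gamma> ` A)"
    using bij_betw_subset[OF piecewise_power_bij Diff_subset] by blast
  then have outside: "bij_betw (\<lambda>x. if x \<in> A then T (k x) x else \<gamma> x) (X - A) (X - \<gamma> ` A)"
    by (rule iffD1[OF bij_betw_cong, rotated]) simp
  have inside: "bij_betw (\<lambda>x. if x \<in> A then T (k x) x else \<gamma> x) A (\<gamma> ` A)"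
    using k(2) by (rule iffD1[OF bij_betw_cong, rotated]) simp
  have "A \<union> (X - A) = X" "\<gamma> ` A \<union> (X - \<gamma> ` A) = X" using AX piecewise_power_in by auto
  then have "bij_betw (\<lambda>x. if x \<in> A then T (k x) x else \<gamma> x) X X"
    using bij_betw_combine[OF inside outside Diff_disjoint] by simp
  moreover have "locally_const X (\<lambda>x. if x \<in> A then k x else l x)"
    using locally_const_mem[OF A] k(1) l(1) by (rule locally_const_if)
  ultimately show ?thesis
    unfolding piecewise_power_def using l(2)
    by (intro conjI exI[of _ "\<lambda>x. if x \<in> A then k x else l x"]) simp_all
qed

end

end

lemma count_list_distinct: "distinct xs \<Longrightarrow> count_list xs x = of_bool (x \<in> set xs)"
  by (induction xs) auto

context cantor_minimal begin

section \<open>Kakutani--Rokhlin partitions\<close>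

definition kakutani_rokhlin :: "'a set set \<Rightarrow> 'a set \<Rightarrow> bool" where
  "kakutani_rokhlin P U \<longleftrightarrow> clopen_partition X P \<and> clopen_base U \<and> (\<forall>C\<in>P. C \<subseteq> U \<or> C \<inter> U = {})
     \<and> (\<forall>C\<in>P. \<alpha> ` C \<in> P \<or> \<alpha> ` C \<subseteq> U) \<and> (\<forall>C\<in>P. C \<subseteq> U \<or> (\<exists>D\<in>P. C = \<alpha> ` D))"

lemma
  assumes "kakutani_rokhlin P U"
  shows kr_partition: "clopen_partition X P"
    and kr_base: "clopen_base U"
    and kr_meets_base: "C \<in> P \<Longrightarrow> y \<in> C \<Longrightarrow> y \<in> U \<Longrightarrow> C \<subseteq> U"
    and kr_image_in: "C \<in> P \<Longrightarrow> \<not> \<alpha> ` C \<subseteq> U \<Longrightarrow> \<alpha> ` C \<in> P"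
    and kr_pred: "C \<in> P \<Longrightarrow> \<not> C \<subseteq> U \<Longrightarrow> \<exists>D\<in>P. C = \<alpha> ` D"
  using assms unfolding kakutani_rokhlin_def by blast+

lemma kr_subset: "kakutani_rokhlin P U \<Longrightarrow> C \<in> P \<Longrightarrow> C \<subseteq> X"
  using clopen_partitionD(5)[OF kr_partition] .

lemma kr_nonempty: "kakutani_rokhlin P U \<Longrightarrow> C \<in> P \<Longrightarrow> C \<noteq> {}"
  using clopen_partitionD(3)[OF kr_partition] .

lemma kr_image_meets_base:
  assumes "kakutani_rokhlin P U" "C \<in> P" "y \<in> C" "\<alpha> y \<in> U"
  shows "\<alpha> ` C \<subseteq> U"
  using kr_image_in[OF assms(1,2)] kr_meets_base[OF assms(1), of "\<alpha> ` C"] assms(3,4) by blast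

lemma kr_induct [consumes 2, case_names base step]:
  assumes P: "kakutani_rokhlin P U" and "C \<in> P"
    and base: "\<And>C. C \<in> P \<Longrightarrow> C \<subseteq> U \<Longrightarrow> Q C"
    and step: "\<And>D. D \<in> P \<Longrightarrow> \<not> \<alpha> ` D \<subseteq> U \<Longrightarrow> Q D \<Longrightarrow> Q (\<alpha> ` D)"
  shows "Q C"
proof -
  have "Q C" if "C \<in> P" "y \<in> C" "age U y = n" for n y C
    using that
  proof (induction n arbitrary: y C)
    case 0
    then have "y \<in> U" using age_eq_0[OF kr_base[OF P]] kr_subset[OF P] by blast
    then show ?case using base kr_meets_base[OF P] 0 by blast
  next
    case (Suc n)
    show ?case
    proof (cases "C \<subseteq> U")
      case False
      then obtain D where D: "D \<in> P" "C = \<alpha> ` D" using kr_pred[OF P Suc.prems(1)] by blast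
      then obtain z where z: "z \<in> D" "y = \<alpha> z" using Suc.prems(2) by blast
      have "\<alpha> z \<notin> U" using False kr_meets_base[OF P Suc.prems(1)] Suc.prems(2) z by blast
      then have "age U z = n"
        using age_foot_succ(1)[OF kr_base[OF P]] kr_subset[OF P D(1)] z Suc.prems(3) by auto
      then show ?thesis using Suc.IH[OF D(1) z(1)] step[OF D(1)] False D(2) by simp
    qed (use base Suc.prems in blast)
  qed
  then show ?thesis using assms(2) kr_nonempty[OF P] by blast
qed

lemma kr_age_eq:
  assumes P: "kakutani_rokhlin P U" and C: "C \<in> P" "y \<in> C" "z \<in> C"
  shows "age U y = age U z"
proof -
  have "\<forall>y\<in>C. \<forall>z\<in>C. age U y = age U z"
    using P C(1)
  proof (induction rule: kr_induct)
    case (base C)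
    then have "age U y = 0" if "y \<in> C" for y using age_base(1)[OF kr_base[OF P]] that by blast
    then show ?case by simp
  next
    case (step D)
    have age_succ: "age U (\<alpha> y) = Suc (age U y)" if "y \<in> D" for y
    proof (rule age_foot_succ(1)[OF kr_base[OF P]])
      show "y \<in> X" using kr_subset[OF P step(1)] that by blast
      show "\<alpha> y \<notin> U" using kr_image_meets_base[OF P step(1) that] step(2) by blast
    qed
    show ?case
    proof (intro ballI)
      fix y z assume "y \<in> \<alpha> ` D" "z \<in> \<alpha> ` D"
      then obtain y' z' where yz: "y = \<alpha> y'" "z = \<alpha> z'" "y' \<in> D" "z' \<in> D" by blast
      moreover have "age U y' = age U z'" using step(3) yz(3,4) by blast
      ultimately show "age U y = age U z" using age_succ by simp
    qed
  qed
  then show ?thesis using C by blast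
qed

lemma kr_mono_base:
  assumes P: "kakutani_rokhlin P U" and P': "kakutani_rokhlin P' U'"
    and sub: "U' \<subseteq> U" and ref: "refines X P' P"
  shows "kakutani_rokhlin P' U"
  unfolding kakutani_rokhlin_def
proof (intro conjI ballI)
  fix C assume C: "C \<in> P'"
  obtain D where "D \<in> P" "C \<subseteq> D" using ref C by (auto simp: refines_def)
  then show "C \<subseteq> U \<or> C \<inter> U = {}" using kr_meets_base[OF P] by blast
  show "\<alpha> ` C \<in> P' \<or> \<alpha> ` C \<subseteq> U" using kr_image_in[OF P' C] sub by blast
  show "C \<subseteq> U \<or> (\<exists>D\<in>P'. C = \<alpha> ` D)" using kr_pred[OF P' C] sub by blast
qed (use kr_partition[OF P'] kr_base[OF P] in auto)

lemma kr_fibres: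
  assumes U: "clopen_base U" and address: "locally_const X address"
    and base: "\<And>y z. y \<in> X \<Longrightarrow> z \<in> X \<Longrightarrow> address y = address z \<Longrightarrow> y \<in> U \<longleftrightarrow> z \<in> U"
    and roof: "\<And>y z. y \<in> X \<Longrightarrow> z \<in> X \<Longrightarrow> address y = address z \<Longrightarrow> \<alpha> y \<in> U \<longleftrightarrow> \<alpha> z \<in> U"
    and step: "\<And>y z. y \<in> X \<Longrightarrow> z \<in> X \<Longrightarrow> \<alpha> y \<notin> U \<Longrightarrow> \<alpha> z \<notin> U \<Longrightarrow> address (\<alpha> y) = address (\<alpha> z) \<longleftrightarrow> address y = address z"
  shows "kakutani_rokhlin ((\<lambda>x. {y\<in>X. address y = address x}) ` X) U"
proof -
  define fibre where "fibre x = {y\<in>X. address y = address x}" for x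
  have image: "\<alpha> ` fibre z = fibre (\<alpha> z)" if z: "z \<in> X" "\<alpha> z \<notin> U" for z
  proof (intro equalityI subsetI)
    fix w assume "w \<in> \<alpha> ` fibre z"
    then obtain y where y: "w = \<alpha> y" "y \<in> X" "address y = address z" by (auto simp: fibre_def)
    then have "address w = address (\<alpha> z)" using roof[OF y(2) z(1)] step[OF y(2) z(1)] z(2) by simp
    then show "w \<in> fibre (\<alpha> z)" using y by (simp add: fibre_def)
  next
    fix w assume "w \<in> fibre (\<alpha> z)"
    then have w: "w \<in> X" "address w = address (\<alpha> z)" by (auto simp: fibre_def)
    then have "w \<notin> U" using base[OF w(1) _ w(2)] z by simp
    then have "address (T (-1) w) = address z" using step[of "T (-1) w" z] w z by simp
    then show "w \<in> \<alpha> ` fibre z" using w by (intro image_eqI[of _ _ "T (-1) w"]) (auto simp: fibre_def)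
  qed
  have "kakutani_rokhlin (fibre ` X) U"
    unfolding kakutani_rokhlin_def
  proof (intro conjI U ballI)
    show "clopen_partition X (fibre ` X)"
      unfolding fibre_def by (rule clopen_partition_fibres[OF compact_X address])
    fix C assume "C \<in> fibre ` X"
    then obtain z where z: "z \<in> X" "C = fibre z" by auto
    show "C \<subseteq> U \<or> C \<inter> U = {}" using base[OF _ z(1)] z(2) by (auto simp: fibre_def)
    show "\<alpha> ` C \<in> fibre ` X \<or> \<alpha> ` C \<subseteq> U"
    proof (cases "\<alpha> z \<in> U")
      case True
      then show ?thesis using roof[OF _ z(1)] z(2) by (auto simp: fibre_def)
    next
      case False
      then show ?thesis using image[OF z(1)] z by simp
    qed
    show "C \<subseteq> U \<or> (\<exists>D\<in>fibre ` X. C = \<alpha> ` D)"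
    proof (cases "z \<in> U")
      case True
      then show ?thesis using base[OF _ z(1)] z(2) by (auto simp: fibre_def)
    next
      case False
      then have "C = \<alpha> ` fibre (T (-1) z)" using image[of "T (-1) z"] z by simp
      then show ?thesis using T_in[OF z(1), of "-1"] by blast
    qed
  qed
  then show ?thesis by (simp add: fibre_def)
qed

lemma ex_kr_constant:
  assumes U: "clopen_base U" and l: "locally_const X l"
  shows "\<exists>P. kakutani_rokhlin P U \<and> (\<forall>C\<in>P. const_on l C)"
proof -
  define word where "word b = (return_time U b, restrict (\<lambda>i. l (T (int i) b)) {..<return_time U b})" for b
  define address where "address z = (age U z, word (foot U z))" for z
  have "locally_const X word"
    unfolding word_def[abs_def]
    by (rule locally_const_select[OF locally_const_return_time[OF U],
          where g="\<lambda>n b. (n, restrict (\<lambda>i. l (T (int i) b)) {..<n})"])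
      (intro locally_const_comp[where h="Pair _"] locally_const_restrict locally_const_T l finite_lessThan)
  then have lc: "locally_const X address"
    unfolding address_def[abs_def]
    by (intro locally_const_comp2[OF locally_const_age[OF U] locally_const_foot[OF U]])
  have base: "y \<in> U \<longleftrightarrow> z \<in> U" if "y \<in> X" "z \<in> X" "address y = address z" for y z
    using that age_eq_0[OF U, of y] age_eq_0[OF U, of z] by (simp add: address_def)
  have roof: "\<alpha> y \<in> U \<longleftrightarrow> \<alpha> z \<in> U" if "y \<in> X" "z \<in> X" "address y = address z" for y z
    using that base_succ_iff[OF U, of y] base_succ_iff[OF U, of z] by (simp add: address_def word_def)
  have step: "address (\<alpha> y) = address (\<alpha> z) \<longleftrightarrow> address y = address z" if "y \<in> X" "z \<in> X" "\<alpha> y \<notin> U" "\<alpha> z \<notin> U" for y z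
    using that by (simp add: address_def age_foot_succ[OF U])
  have label: "l z = snd (snd (address z)) (fst (address z))" if "z \<in> X" for z
    using age_less_return_time[OF U that] T_age_foot[OF that, of U] by (simp add: address_def word_def)
  have "\<forall>C\<in>(\<lambda>x. {y\<in>X. address y = address x}) ` X. const_on l C"
    by (auto simp: label)
  then show ?thesis using kr_fibres[OF U lc base roof step] by blast
qed

lemma ex_kr_refining:
  assumes U: "clopen_base U" and Q: "clopen_partition X Q" and e: "e > 0"
  shows "\<exists>P. kakutani_rokhlin P U \<and> refines X P Q \<and> (\<forall>C\<in>P. diam_less e C)"
proof -
  obtain f :: "'a \<Rightarrow> 'a set" where f: "locally_const X f"
    "\<And>x y. x \<in> X \<Longrightarrow> y \<in> X \<Longrightarrow> f x = f y \<Longrightarrow> dist x y < e"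
    by (rule cantor_set_fine_labelling[OF cantor e]) (rule that)
  have "locally_const X (\<lambda>x. {A\<in>Q. x \<in> A})"
    using clopen_partitionD(1,4)[OF Q] by (intro locally_const_Collect locally_const_mem)
  then have "locally_const X (\<lambda>x. (f x, {A\<in>Q. x \<in> A}))" by (rule locally_const_comp2[OF f(1)])
  moreover define label where "label x = (f x, {A\<in>Q. x \<in> A})" for x
  ultimately have "locally_const X label" by (simp add: label_def[abs_def])
  then obtain P where P: "kakutani_rokhlin P U" and const: "\<forall>C\<in>P. const_on label C"
    using ex_kr_constant[OF U] by blast
  have "dist x y < e" if C: "C \<in> P" "x \<in> C" "y \<in> C" for C x y
  proof (rule f(2))
    show "x \<in> X" "y \<in> X" using kr_subset[OF P C(1)] C(2,3) by blast+
    have "label x = label y" using const C by blast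
    then show "f x = f y" by (simp add: label_def)
  qed
  moreover have "\<exists>A\<in>Q. C \<subseteq> A" if C: "C \<in> P" for C
  proof -
    obtain x where x: "x \<in> C" using kr_nonempty[OF P C] by blast
    then obtain A where A: "A \<in> Q" "x \<in> A" using clopen_partitionD(2)[OF Q] kr_subset[OF P C] by blast
    have "A \<in> {A\<in>Q. y \<in> A}" if "y \<in> C" for y
    proof -
      have "label x = label y" using const C x that by blast
      then show ?thesis using A by (auto simp: label_def)
    qed
    then show ?thesis using A(1) by blast
  qed
  ultimately show ?thesis
    using P Q kr_partition[OF P] unfolding refines_def clopen_partition_def by blast
qed

section \<open>Tilings by towers\<close>

text \<open>A roof may return to any atom in the base, so the atoms in the base are identified.\<close>

definition collapse :: "'a set \<Rightarrow> 'a set \<Rightarrow> 'a set" where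
  "collapse U C = (if C \<subseteq> U then U else C)"

definition follows :: "'a set \<Rightarrow> 'a set \<Rightarrow> 'a set \<Rightarrow> bool" where
  "follows U C D \<longleftrightarrow> collapse U D = collapse U (\<alpha> ` C)"

lemma follows_iff: "follows U C D \<longleftrightarrow> (if \<alpha> ` C \<subseteq> U then D \<subseteq> U else D = \<alpha> ` C)"
  by (auto simp: follows_def collapse_def)

lemma ex_collapse_label:
  assumes P: "kakutani_rokhlin P U"
  obtains L where "\<And>C y. C \<in> P \<Longrightarrow> y \<in> C \<Longrightarrow> L y = collapse U C"
    "\<And>C y. C \<in> P \<Longrightarrow> y \<in> C \<Longrightarrow> L (\<alpha> y) = collapse U (\<alpha> ` C)"
proof
  define L where "L y = collapse U (THE C. C \<in> P \<and> y \<in> C)" for y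
  show L: "L y = collapse U C" if "C \<in> P" "y \<in> C" for C y
  proof -
    have "(THE C. C \<in> P \<and> y \<in> C) = C"
      using that clopen_partitionD(6)[OF kr_partition[OF P]] by (intro the_equality) auto
    then show ?thesis by (simp add: L_def)
  qed
  show "L (\<alpha> y) = collapse U (\<alpha> ` C)" if C: "C \<in> P" "y \<in> C" for C y
  proof (cases "\<alpha> ` C \<subseteq> U")
    case True
    have "\<alpha> y \<in> X" using kr_subset[OF P C(1)] C(2) by auto
    then obtain D where D: "D \<in> P" "\<alpha> y \<in> D" using clopen_partitionD(2)[OF kr_partition[OF P]] by blast
    then have "D \<subseteq> U" using kr_meets_base[OF P D] True C(2) by blast
    then show ?thesis using L[OF D] True by (simp add: collapse_def)
  next
    case False
    then show ?thesis using L kr_image_in[OF P C(1)] C(2) by blast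
  qed
qed

lemma T_image_T: "C \<subseteq> X \<Longrightarrow> T m ` (T n ` C) = T (m + n) ` C"
  unfolding image_image by (rule image_cong) (auto simp: T_add)

lemma kr_tower:
  assumes P: "kakutani_rokhlin P U" and C: "C \<in> P" "C \<subseteq> U" "y \<in> C"
  shows "j < return_time U y \<Longrightarrow> T (int j) ` C \<in> P"
    and "0 < j \<Longrightarrow> j < return_time U y \<Longrightarrow> T (int j) ` C \<inter> U = {}"
    and "\<alpha> ` (T (int (return_time U y - 1)) ` C) \<subseteq> U"
proof -
  note U = kr_base[OF P]
  have CX: "C \<subseteq> X" and yX: "y \<in> X" using kr_subset[OF P C(1)] C(3) by auto
  have Suc_image: "\<alpha> ` (T (int j) ` C) = T (int (Suc j)) ` C" for j
    using T_image_succ[OF CX, of "int j"] by (simp add: add.commute)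
  show inP: "T (int j) ` C \<in> P" if "j < return_time U y" for j
    using that
  proof (induction j)
    case (Suc j)
    have "T (int (Suc j)) y \<notin> U" using not_in_before_return[OF _ Suc.prems] by blast
    then have "\<not> \<alpha> ` (T (int j) ` C) \<subseteq> U" unfolding Suc_image using C(3) by blast
    moreover have "T (int j) ` C \<in> P" using Suc by simp
    ultimately show ?case using kr_image_in[OF P] Suc_image by metis
  qed (use C in simp)
  show "T (int j) ` C \<inter> U = {}" if "0 < j" "j < return_time U y" for j
    using kr_meets_base[OF P inP[OF that(2)]] not_in_before_return[OF that] C(3) by blast
  obtain n where n: "return_time U y = Suc n" using return_time_pos[of U y] gr0_implies_Suc by blast
  have "\<alpha> (T (int n) y) \<in> U" using T_return_in[OF U yX] T_Suc[OF yX] by (simp add: n)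
  then show "\<alpha> ` (T (int (return_time U y - 1)) ` C) \<subseteq> U"
    using kr_image_meets_base[OF P inP[of n], of "T (int n) y"] C(3) by (simp add: n)
qed

definition tower_of :: "'a set \<Rightarrow> 'a set \<Rightarrow> 'a set list" where
  "tower_of U C = map (\<lambda>j. T (int j) ` C) [0..<return_time U (SOME y. y \<in> C)]"

context
  fixes P U C assumes P: "kakutani_rokhlin P U" and C: "C \<in> P" "C \<subseteq> U"
begin

lemma some_in_base_atom: "(SOME y. y \<in> C) \<in> C"
  using kr_nonempty[OF P C(1)] by (simp add: some_in_eq)

lemma set_tower_of: "set (tower_of U C) \<subseteq> P"
  using kr_tower(1)[OF P C some_in_base_atom] by (auto simp: tower_of_def)

lemma tower_of_hd_last:
  "tower_of U C \<noteq> []" "hd (tower_of U C) = C" "\<alpha> ` last (tower_of U C) \<subseteq> U"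
proof -
  have pos: "return_time U (SOME y. y \<in> C) > 0" by (rule return_time_pos)
  then show "tower_of U C \<noteq> []" "hd (tower_of U C) = C" by (simp_all add: tower_of_def hd_map)
  show "\<alpha> ` last (tower_of U C) \<subseteq> U"
    using kr_tower(3)[OF P C some_in_base_atom] pos by (simp add: tower_of_def last_map)
qed

lemma distinct_tower_of: "distinct (tower_of U C)"
proof -
  note CX = kr_subset[OF P C(1)]
  have "T (int i) ` C \<noteq> T (int j) ` C" if ij: "i < j" "j < return_time U (SOME y. y \<in> C)" for i j
  proof
    assume "T (int i) ` C = T (int j) ` C"
    then have "T (- int i) ` T (int i) ` C = T (- int i) ` T (int j) ` C" by simp
    then have "C = T (int (j - i)) ` C" unfolding T_image_T[OF CX] using ij(1) by (simp add: of_nat_diff)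
    moreover have "T (int (j - i)) ` C \<inter> U = {}"
      using kr_tower(2)[OF P C some_in_base_atom, of "j - i"] ij by simp
    ultimately show False using some_in_base_atom C(2) by blast
  qed
  then have "inj_on (\<lambda>j. T (int j) ` C) {0..<return_time U (SOME y. y \<in> C)}"
    by (intro linorder_inj_onI') simp
  then show ?thesis by (simp add: tower_of_def distinct_map)
qed

lemma successively_tower_of: "successively (\<lambda>D E. \<not> \<alpha> ` D \<subseteq> U \<and> E = \<alpha> ` D) (tower_of U C)"
proof -
  have "\<alpha> ` T (int j) ` C = T (int (Suc j)) ` C" for j
    using T_image_succ[OF kr_subset[OF P C(1)], of "int j"] by (simp add: add.commute)
  moreover have "\<not> T (int (Suc j)) ` C \<subseteq> U" if "Suc j < return_time U (SOME y. y \<in> C)" for j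
    using kr_tower(2)[OF P C some_in_base_atom _ that] some_in_base_atom by blast
  ultimately show ?thesis by (simp add: successively_conv_nth tower_of_def)
qed

lemma tower_of_image_iff:
  assumes D: "D \<in> P" "\<not> \<alpha> ` D \<subseteq> U"
  shows "\<alpha> ` D \<in> set (tower_of U C) \<longleftrightarrow> D \<in> set (tower_of U C)"
proof -
  define tw where "tw = tower_of U C"
  have step: "tw ! Suc i = \<alpha> ` (tw ! i)" if "Suc i < length tw" for i
    using successively_tower_of that by (simp add: tw_def successively_conv_nth)
  have "\<alpha> ` D \<in> set tw \<longleftrightarrow> D \<in> set tw"
  proof
    assume "\<alpha> ` D \<in> set tw"
    then obtain j where j: "j < length tw" "tw ! j = \<alpha> ` D" by (auto simp: in_set_conv_nth)
    have "tw ! 0 = C" using tower_of_hd_last(1,2) by (simp add: tw_def hd_conv_nth)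
    then obtain i where i: "j = Suc i" using D(2) C(2) j(2) by (cases j) auto
    then have "tw ! i \<in> P" "\<alpha> ` (tw ! i) = \<alpha> ` D" using j step[of i] set_tower_of by (auto simp: tw_def)
    then have "tw ! i = D" using \<alpha>_image_eq_iff kr_subset[OF P] D(1) by blast
    then show "D \<in> set tw" using i j(1) nth_mem[of i tw] by simp
  next
    assume "D \<in> set tw"
    then obtain j where j: "j < length tw" "tw ! j = D" by (auto simp: in_set_conv_nth)
    have "j \<noteq> length tw - 1" using tower_of_hd_last(1,3) D(2) j(2) by (auto simp: tw_def last_conv_nth)
    then have "Suc j < length tw" using j(1) by simp
    then show "\<alpha> ` D \<in> set tw" using step[of j] j(2) nth_mem[of "Suc j" tw] by simp
  qed
  then show ?thesis by (simp add: tw_def)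
qed

lemma constant_on_tower_of:
  assumes m: "\<And>D. D \<in> P \<Longrightarrow> \<not> \<alpha> ` D \<subseteq> U \<Longrightarrow> m (\<alpha> ` D) = m D" and D: "D \<in> set (tower_of U C)"
  shows "m D = m C"
proof -
  define tw where "tw = tower_of U C"
  have "m (tw ! i) = m C" if "i < length tw" for i
    using that
  proof (induction i)
    case 0
    then show ?case using tower_of_hd_last(1,2) by (simp add: tw_def hd_conv_nth)
  next
    case (Suc i)
    then have "\<not> \<alpha> ` (tw ! i) \<subseteq> U" "tw ! Suc i = \<alpha> ` (tw ! i)" "tw ! i \<in> P"
      using successively_tower_of set_tower_of by (auto simp: successively_conv_nth tw_def)
    then show ?case using m Suc by simp
  qed
  then show ?thesis using D by (metis in_set_conv_nth tw_def)
qed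

end

definition tiling_word :: "'a set set \<Rightarrow> 'a set \<Rightarrow> ('a set \<Rightarrow> nat) \<Rightarrow> 'a set list \<Rightarrow> bool" where
  "tiling_word P U m cs \<longleftrightarrow> set cs \<subseteq> P \<and> (\<forall>C\<in>P. count_list cs C = m C) \<and> successively (follows U) cs
    \<and> (cs \<noteq> [] \<longrightarrow> hd cs \<subseteq> U \<and> \<alpha> ` last cs \<subseteq> U)"

lemma tiling_word_append_tower:
  assumes P: "kakutani_rokhlin P U" and C: "C \<in> P" "C \<subseteq> U" and cs: "tiling_word P U m cs"
  shows "tiling_word P U (\<lambda>D. of_bool (D \<in> set (tower_of U C)) + m D) (tower_of U C @ cs)"
proof -
  note ends = tower_of_hd_last[OF P C]
  have "successively (follows U) (tower_of U C)"
    using successively_tower_of[OF P C] by (rule successively_mono) (simp add: follows_def)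
  moreover have "follows U (last (tower_of U C)) (hd cs)" if "cs \<noteq> []"
    using ends(3) cs that by (simp add: follows_iff tiling_word_def)
  ultimately have "successively (follows U) (tower_of U C @ cs)"
    using cs by (auto simp: successively_append_iff tiling_word_def)
  moreover have "\<alpha> ` last (tower_of U C @ cs) \<subseteq> U"
    using ends(3) cs by (cases "cs = []") (simp_all add: tiling_word_def)
  ultimately show ?thesis
    using ends(1,2) set_tower_of[OF P C] C(2) cs count_list_distinct[OF distinct_tower_of[OF P C]]
    by (simp add: tiling_word_def)
qed

lemma ex_tiling_word:
  assumes P: "kakutani_rokhlin P U"
    and "\<And>C. C \<in> P \<Longrightarrow> \<not> \<alpha> ` C \<subseteq> U \<Longrightarrow> m (\<alpha> ` C) = m C"
  shows "\<exists>cs. tiling_word P U m cs"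
  using assms(2)
proof (induction "sum m P" arbitrary: m rule: less_induct)
  case less
  show ?case
  proof (cases "\<forall>C\<in>P. m C = 0")
    case True
    then show ?thesis by (intro exI[of _ "[]"]) (simp add: tiling_word_def)
  next
    case False
    then obtain D where "D \<in> P" "m D > 0" by auto
    with P have "\<exists>C\<in>P. C \<subseteq> U \<and> m C > 0"
      by (induction rule: kr_induct) (auto simp: less.prems)
    then obtain C where C: "C \<in> P" "C \<subseteq> U" "m C > 0" by blast
    define tw where "tw = tower_of U C"
    define m' where "m' D = m D - of_bool (D \<in> set tw)" for D
    have "m' (\<alpha> ` D) = m' D" if "D \<in> P" "\<not> \<alpha> ` D \<subseteq> U" for D
      using less.prems[OF that] tower_of_image_iff[OF P C(1,2) that] by (simp add: m'_def tw_def)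
    moreover have "sum m' P < sum m P"
    proof (rule sum_strict_mono_ex1[OF clopen_partitionD(1)[OF kr_partition[OF P]]])
      have "C \<in> set tw" using tower_of_hd_last(1,2)[OF P C(1,2)] hd_in_set unfolding tw_def by metis
      then show "\<exists>D\<in>P. m' D < m D" using C by (intro bexI[of _ C]) (simp_all add: m'_def)
    qed (simp add: m'_def)
    ultimately obtain cs where cs: "tiling_word P U m' cs" using less.hyps[of m'] by metis
    have "of_bool (D \<in> set tw) + m' D = m D" for D
      using constant_on_tower_of[OF P C(1,2), of m D] less.prems C(3) by (auto simp: m'_def tw_def)
    then have "tiling_word P U m (tw @ cs)"
      using tiling_word_append_tower[OF P C(1,2) cs] by (simp add: tw_def)
    then show ?thesis by blast
  qed
qed

section \<open>Order homomorphisms at the level of functions\<close>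

lemma mem_k0_class: "g \<in> k0_class X \<alpha> f \<longleftrightarrow> locally_const X g \<and> cohomologous g f"
  by (simp add: k0_class_def cont_int_iff cohomologous_def)

lemma k0_class_eq:
  assumes "locally_const X f"
  shows "k0_class X \<alpha> f = k0_class X \<alpha> g \<longleftrightarrow> cohomologous f g"
proof
  assume "k0_class X \<alpha> f = k0_class X \<alpha> g"
  then show "cohomologous f g" using assms mem_k0_class[of f f] mem_k0_class[of f g] by simp
next
  assume fg: "cohomologous f g"
  have "cohomologous h f \<longleftrightarrow> cohomologous h g" for h
    using fg cohomologous_sym cohomologous_trans by metis
  then show "k0_class X \<alpha> f = k0_class X \<alpha> g" by (simp add: set_eq_iff mem_k0_class)
qed

lemma k0_mult:
  assumes f: "locally_const X f" and g: "locally_const X g"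
  shows "mult (k0 X \<alpha>) (k0_class X \<alpha> f) (k0_class X \<alpha> g) = k0_class X \<alpha> (\<lambda>x. f x + g x)"
proof (intro equalityI subsetI)
  fix h assume "h \<in> mult (k0 X \<alpha>) (k0_class X \<alpha> f) (k0_class X \<alpha> g)"
  then obtain f' g' where "h = (\<lambda>x. f' x + g' x)" "f' \<in> k0_class X \<alpha> f" "g' \<in> k0_class X \<alpha> g"
    by (auto simp: k0_def)
  then show "h \<in> k0_class X \<alpha> (\<lambda>x. f x + g x)"
    by (auto simp: mem_k0_class intro: cohomologous_add)
next
  fix h assume "h \<in> k0_class X \<alpha> (\<lambda>x. f x + g x)"
  then have h: "locally_const X h" "cohomologous h (\<lambda>x. f x + g x)" by (auto simp: mem_k0_class)
  have "cohomologous (\<lambda>x. h x - f x) (\<lambda>x. f x + g x - f x)" by (intro cohomologous_diff h) simp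
  then have "(\<lambda>x. h x - f x) \<in> k0_class X \<alpha> g" using h(1) f by (auto simp: mem_k0_class)
  moreover have "f \<in> k0_class X \<alpha> f" using f by (simp add: mem_k0_class)
  moreover have "h = (\<lambda>x. f x + (h x - f x))" by auto
  ultimately show "h \<in> mult (k0 X \<alpha>) (k0_class X \<alpha> f) (k0_class X \<alpha> g)"
    unfolding k0_def monoid.simps by (intro CollectI exI[of _ f] exI[of _ "\<lambda>x. h x - f x"]) blast
qed

lemma carrier_k0: "A \<in> carrier (k0 X \<alpha>) \<longleftrightarrow> (\<exists>f. locally_const X f \<and> A = k0_class X \<alpha> f)"
  by (auto simp: k0_def cont_int_iff)

lemma k0_pos_iff:
  assumes f: "locally_const X f"
  shows "k0_class X \<alpha> f \<in> k0_pos X \<alpha> \<longleftrightarrow> class_le (\<lambda>_. 0) f"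
proof
  assume "k0_class X \<alpha> f \<in> k0_pos X \<alpha>"
  then obtain g where g: "\<forall>x\<in>X. 0 \<le> g x" "cohomologous f g"
    using k0_class_eq[OF f] by (auto simp: k0_pos_def)
  then have "class_le (\<lambda>_. 0) g" by (intro class_le_pointwise) blast
  then show "class_le (\<lambda>_. 0) f" using cohomologous_sym[OF g(2)] by (rule class_le_cohomologous_trans)
next
  assume "class_le (\<lambda>_. 0) f"
  then obtain h where "locally_const X h" "\<forall>x\<in>X. 0 \<le> h x" "cohomologous f h"
    using ex_nonneg_representative f by metis
  then show "k0_class X \<alpha> f \<in> k0_pos X \<alpha>"
    unfolding k0_pos_def cont_int_iff using k0_class_eq[OF f] by blast
qed

end

locale k0_morphism = X: cantor_minimal X \<alpha> + Y: cantor_minimal Y \<beta>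
  for X :: "'a::metric_space set" and \<alpha> and Y :: "'b::metric_space set" and \<beta> +
  fixes r :: "('b \<Rightarrow> int) \<Rightarrow> 'a \<Rightarrow> int"
  assumes r_locally_const: "locally_const Y g \<Longrightarrow> locally_const X (r g)"
    and r_add: "locally_const Y g \<Longrightarrow> locally_const Y h \<Longrightarrow>
      X.cohomologous (r (\<lambda>y. g y + h y)) (\<lambda>x. r g x + r h x)"
    and r_cohomologous: "locally_const Y g \<Longrightarrow> locally_const Y h \<Longrightarrow> Y.cohomologous g h \<Longrightarrow>
      X.cohomologous (r g) (r h)"
    and r_nonneg: "locally_const Y g \<Longrightarrow> \<forall>y\<in>Y. 0 \<le> g y \<Longrightarrow> X.class_le (\<lambda>_. 0) (r g)"
    and r_one: "X.cohomologous (r (\<lambda>_. 1)) (\<lambda>_. 1)"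
begin

lemma r_zero: "X.cohomologous (r (\<lambda>_. 0)) (\<lambda>_. 0)"
proof -
  have "X.cohomologous (r (\<lambda>_. 0)) (\<lambda>x. r (\<lambda>_. 0) x + r (\<lambda>_. 0) x)" using r_add[of "\<lambda>_. 0" "\<lambda>_. 0"] by simp
  then have "X.cohomologous (\<lambda>x. r (\<lambda>_. 0) x - r (\<lambda>_. 0) x) (\<lambda>x. r (\<lambda>_. 0) x + r (\<lambda>_. 0) x - r (\<lambda>_. 0) x)"
    by (intro X.cohomologous_diff) auto
  then show ?thesis using X.cohomologous_sym by simp
qed

lemma r_cong:
  assumes "locally_const Y g" "\<And>y. y \<in> Y \<Longrightarrow> g y = h y"
  shows "X.cohomologous (r g) (r h)"
  by (rule r_cohomologous[OF assms(1) locally_const_cong[OF assms] Y.cohomologous_cong[OF assms(2)]])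

lemma r_uminus:
  assumes g: "locally_const Y g"
  shows "X.cohomologous (r (\<lambda>y. - g y)) (\<lambda>x. - r g x)"
proof -
  have "X.cohomologous (\<lambda>x. r g x + r (\<lambda>y. - g y) x) (r (\<lambda>y. g y + - g y))"
    using X.cohomologous_sym[OF r_add[OF g locally_const_uminus[OF g]]] .
  also have "X.cohomologous \<dots> (\<lambda>_. 0)" using r_zero by simp
  finally have "X.cohomologous (\<lambda>x. r g x + r (\<lambda>y. - g y) x - r g x) (\<lambda>x. 0 - r g x)"
    by (intro X.cohomologous_diff) auto
  then show ?thesis by simp
qed

lemma r_diff:
  assumes g: "locally_const Y g" and h: "locally_const Y h"
  shows "X.cohomologous (r (\<lambda>y. g y - h y)) (\<lambda>x. r g x - r h x)"
proof -
  have "X.cohomologous (r (\<lambda>y. g y + - h y)) (\<lambda>x. r g x + r (\<lambda>y. - h y) x)"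
    by (rule r_add[OF g locally_const_uminus[OF h]])
  also have "X.cohomologous \<dots> (\<lambda>x. r g x + - r h x)" by (intro X.cohomologous_add r_uminus h) auto
  finally show ?thesis by simp
qed

lemma r_of_nat_mult:
  assumes g: "locally_const Y g"
  shows "X.cohomologous (r (\<lambda>y. int n * g y)) (\<lambda>x. int n * r g x)"
proof (induction n)
  case 0
  show ?case using r_zero by simp
next
  case (Suc n)
  have "locally_const Y (\<lambda>y. int n * g y)" using locally_const_comp[OF g] .
  then have "X.cohomologous (r (\<lambda>y. g y + int n * g y)) (\<lambda>x. r g x + r (\<lambda>y. int n * g y) x)" by (rule r_add[OF g])
  also have "X.cohomologous \<dots> (\<lambda>x. r g x + int n * r g x)" by (intro X.cohomologous_add Suc) auto
  finally show ?case by (simp add: distrib_right)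
qed

lemma r_mult:
  assumes g: "locally_const Y g"
  shows "X.cohomologous (r (\<lambda>y. c * g y)) (\<lambda>x. c * r g x)"
proof (cases "0 \<le> c")
  case True
  then show ?thesis using r_of_nat_mult[OF g, of "nat c"] by simp
next
  case False
  let ?n = "nat (- c)"
  have "locally_const Y (\<lambda>y. int ?n * g y)" using locally_const_comp[OF g] .
  then have "X.cohomologous (r (\<lambda>y. - (int ?n * g y))) (\<lambda>x. - r (\<lambda>y. int ?n * g y) x)" by (rule r_uminus)
  also have "X.cohomologous \<dots> (\<lambda>x. - (int ?n * r g x))" by (rule X.cohomologous_uminus[OF r_of_nat_mult[OF g]])
  finally show ?thesis using False by simp
qed

lemma r_sum:
  assumes "\<And>i. i \<in> I \<Longrightarrow> locally_const Y (g i)"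
  shows "X.cohomologous (r (\<lambda>y. \<Sum>i\<in>I. g i y)) (\<lambda>x. \<Sum>i\<in>I. r (g i) x)"
  using assms
proof (induction I rule: infinite_finite_induct)
  case (insert i I)
  have "X.cohomologous (r (\<lambda>y. g i y + (\<Sum>i\<in>I. g i y))) (\<lambda>x. r (g i) x + r (\<lambda>y. \<Sum>i\<in>I. g i y) x)"
    using insert by (intro r_add locally_const_sum) auto
  also have "X.cohomologous \<dots> (\<lambda>x. r (g i) x + (\<Sum>i\<in>I. r (g i) x))" using insert by (intro X.cohomologous_add) auto
  finally show ?case using insert by simp
qed (use r_zero in simp_all)

lemma r_class_le:
  assumes g: "locally_const Y g" and h: "locally_const Y h" and le: "Y.class_le g h"
  shows "X.class_le (r g) (r h)"
proof -
  have d: "locally_const Y (\<lambda>y. h y - g y)" using h g by (rule locally_const_diff)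
  have "Y.class_le (\<lambda>_. 0) (\<lambda>y. h y - g y)" using le by (simp add: Y.class_le_diff_iff)
  then obtain k where k: "locally_const Y k" "\<forall>y\<in>Y. 0 \<le> k y" "Y.cohomologous (\<lambda>y. h y - g y) k"
    using Y.ex_nonneg_representative d by metis
  have "X.class_le (\<lambda>_. 0) (r k)" using k by (intro r_nonneg)
  also have "X.cohomologous \<dots> (r (\<lambda>y. h y - g y))" by (intro r_cohomologous k d Y.cohomologous_sym)
  also have "X.cohomologous \<dots> (\<lambda>x. r h x - r g x)" by (rule r_diff[OF h g])
  finally show ?thesis by (simp add: X.class_le_diff_iff)
qed

lemma r_shift: "locally_const Y g \<Longrightarrow> X.cohomologous (r (\<lambda>y. g (Y.T n y))) (r g)"
  by (rule r_cohomologous[OF Y.locally_const_T _ Y.cohomologous_sym[OF Y.cohomologous_shift]])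

lemma r_indicator_T_image:
  assumes C: "clopen_in Y C"
  shows "X.cohomologous (r (indicator (Y.T n ` C))) (r (indicator C))"
proof -
  have "X.cohomologous (r (indicator (Y.T n ` C))) (r (\<lambda>y. indicator C (Y.T (- n) y)))"
    by (rule r_cong[OF locally_const_indicator[OF Y.clopen_in_T_image[OF C]]])
      (simp add: indicator_def Y.T_image_iff[OF clopen_in_subset[OF C]])
  also have "X.cohomologous \<dots> (r (indicator C))" by (rule r_shift[OF locally_const_indicator[OF C]])
  finally show ?thesis .
qed

lemma r_indicator_image: "clopen_in Y C \<Longrightarrow> X.cohomologous (r (indicator (\<beta> ` C))) (r (indicator C))"
  using r_indicator_T_image[of C 1] Y.T_1_image[OF clopen_in_subset] by simp

lemma r_indicator_Diff:
  assumes "clopen_in Y V" "clopen_in Y D" "D \<subseteq> V"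
  shows "X.cohomologous (r (indicator (V - D))) (\<lambda>x. r (indicator V) x - r (indicator D) x)"
proof -
  note lc = locally_const_indicator[OF assms(1)] locally_const_indicator[OF assms(2)]
  have "X.cohomologous (r (indicator (V - D))) (r (\<lambda>y. indicator V y - indicator D y))"
    using assms(3) by (intro r_cong locally_const_indicator clopen_in_Diff assms) (auto simp: indicator_def)
  also have "X.cohomologous \<dots> (\<lambda>x. r (indicator V) x - r (indicator D) x)" by (rule r_diff[OF lc])
  finally show ?thesis .
qed

lemma r_indicator_le: "clopen_in Y D \<Longrightarrow> clopen_in Y V \<Longrightarrow> D \<subseteq> V \<Longrightarrow> X.class_le (r (indicator D)) (r (indicator V))"
  by (intro r_class_le locally_const_indicator Y.class_le_pointwise) (auto simp: indicator_def)

lemma r_indicator_nonneg: "clopen_in Y C \<Longrightarrow> X.class_le (\<lambda>_. 0) (r (indicator C))"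
  by (intro r_nonneg locally_const_indicator) (simp_all add: indicator_def)

lemma r_indicator_not_le_zero:
  assumes C: "clopen_in Y C" "C \<noteq> {}"
  shows "\<not> X.class_le (r (indicator C)) (\<lambda>_. 0)"
proof
  assume zero: "X.class_le (r (indicator C)) (\<lambda>_. 0)"
  obtain n :: nat where n: "Y.class_le (\<lambda>_. 1) (\<lambda>y. int n * indicator C y)"
    using Y.one_le_multiple_indicator[OF C] by metis
  have "X.cohomologous (\<lambda>_. 1) (r (\<lambda>_. 1))" by (rule X.cohomologous_sym[OF r_one])
  also have "X.class_le \<dots> (r (\<lambda>y. int n * indicator C y))"
    using n by (intro r_class_le locally_const_const locally_const_mult locally_const_indicator C)
  also have "X.cohomologous \<dots> (\<lambda>x. int n * r (indicator C) x)"
    by (rule r_mult[OF locally_const_indicator[OF C(1)]])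
  also have "X.class_le \<dots> (\<lambda>x. int n * 0)" using zero by (rule X.class_le_mult) simp
  finally show False using X.not_class_le_one_zero by simp
qed

lemma r_indicator_nonzero:
  "clopen_in Y C \<Longrightarrow> C \<noteq> {} \<Longrightarrow> \<not> X.cohomologous (r (indicator C)) (\<lambda>_. 0)"
  using r_indicator_not_le_zero X.cohomologous_imp_class_le by blast

lemma eventually_multiple_indicator_le:
  assumes f: "X.class_le (\<lambda>_. 0) f" "\<not> X.cohomologous f (\<lambda>_. 0)" "locally_const X f"
  shows "\<forall>\<^sub>F B in Y.small_bases. X.class_le (\<lambda>x. int n * r (indicator B) x) f"
proof -
  obtain k :: nat where k: "k > 0" "X.class_le (\<lambda>_. 1) (\<lambda>x. int k * f x)"
    using X.one_le_multiple[OF f] by metis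
  show ?thesis
    using Y.eventually_multiple_indicator_le_one[of "k * n"] Y.eventually_small_bases_base
  proof eventually_elim
    case (elim B)
    have lc: "locally_const Y (indicator B :: 'b \<Rightarrow> int)"
      using locally_const_indicator[OF Y.base_clopen[OF elim(2)]] .
    have "X.cohomologous (\<lambda>x. int (k * n) * r (indicator B) x) (r (\<lambda>y. int (k * n) * indicator B y))"
      by (rule X.cohomologous_sym[OF r_mult[OF lc]])
    also have "X.class_le \<dots> (r (\<lambda>_. 1))"
      using elim(1) by (intro r_class_le locally_const_mult locally_const_const lc)
    also have "X.cohomologous \<dots> (\<lambda>_. 1)" by (rule r_one)
    also note k(2)
    finally have "X.class_le (\<lambda>x. int k * (int n * r (indicator B) x)) (\<lambda>x. int k * f x)" by (simp add: mult.assoc)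
    then show ?case
      by (rule X.class_le_mult_cancel) (use k(1) r_locally_const[OF lc] f(3) in auto)
  qed
qed

end

lemma (in cantor_minimal) k0_morphism_id: "k0_morphism X \<alpha> X \<alpha> (\<lambda>f. f)"
  by unfold_locales (auto intro: class_le_pointwise)

lemma k0_morphism_of_order_hom:
  assumes X: "cantor_minimal X \<alpha>" and Y: "cantor_minimal Y \<beta>" and \<rho>: "unital_order_hom Y \<beta> X \<alpha> \<rho>"
  shows "\<exists>r. k0_morphism X \<alpha> Y \<beta> r"
proof -
  interpret X: cantor_minimal X \<alpha> by (rule X)
  interpret Y: cantor_minimal Y \<beta> by (rule Y)
  have hom: "\<rho> \<in> hom (k0 Y \<beta>) (k0 X \<alpha>)" and pos: "\<rho> ` k0_pos Y \<beta> \<subseteq> k0_pos X \<alpha>"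
    and unit: "\<rho> (k0_unit Y \<beta>) = k0_unit X \<alpha>"
    using \<rho> by (auto simp: unital_order_hom_def)
  have carrier: "k0_class Y \<beta> g \<in> carrier (k0 Y \<beta>)" if "locally_const Y g" for g
    using that Y.carrier_k0 by blast
  have "\<exists>f. locally_const Y g \<longrightarrow> locally_const X f \<and> \<rho> (k0_class Y \<beta> g) = k0_class X \<alpha> f" for g
    using hom carrier[of g] X.carrier_k0 by (auto simp: hom_def)
  then obtain r where lc: "\<And>g. locally_const Y g \<Longrightarrow> locally_const X (r g)"
    and r: "\<And>g. locally_const Y g \<Longrightarrow> \<rho> (k0_class Y \<beta> g) = k0_class X \<alpha> (r g)" by metis
  have "k0_morphism X \<alpha> Y \<beta> r"
  proof (intro k0_morphism.intro X Y k0_morphism_axioms.intro lc)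
    fix g h :: "'b \<Rightarrow> int" assume g: "locally_const Y g" and h: "locally_const Y h"
    note gh = locally_const_add[OF g h]
    have "k0_class X \<alpha> (r (\<lambda>y. g y + h y)) = \<rho> (mult (k0 Y \<beta>) (k0_class Y \<beta> g) (k0_class Y \<beta> h))"
      using r[OF gh] Y.k0_mult[OF g h] by simp
    also have "\<dots> = mult (k0 X \<alpha>) (k0_class X \<alpha> (r g)) (k0_class X \<alpha> (r h))"
      using hom_mult[OF hom carrier[OF g] carrier[OF h]] r[OF g] r[OF h] by simp
    also have "\<dots> = k0_class X \<alpha> (\<lambda>x. r g x + r h x)" using X.k0_mult lc g h by simp
    finally show "X.cohomologous (r (\<lambda>y. g y + h y)) (\<lambda>x. r g x + r h x)"
      using X.k0_class_eq[OF lc[OF gh]] by simp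
    assume "Y.cohomologous g h"
    then show "X.cohomologous (r g) (r h)"
      using r[OF g] r[OF h] Y.k0_class_eq[OF g] X.k0_class_eq[OF lc[OF g]] by metis
  next
    fix g :: "'b \<Rightarrow> int" assume g: "locally_const Y g" "\<forall>y\<in>Y. 0 \<le> g y"
    then have "k0_class Y \<beta> g \<in> k0_pos Y \<beta>"
      using Y.k0_pos_iff[OF g(1)] by (simp add: Y.class_le_pointwise)
    then show "X.class_le (\<lambda>_. 0) (r g)"
      using pos r[OF g(1)] X.k0_pos_iff[OF lc[OF g(1)]] by (metis image_subset_iff)
  next
    show "X.cohomologous (r (\<lambda>_. 1)) (\<lambda>_. 1)"
      using r[of "\<lambda>_. 1"] unit X.k0_class_eq[OF lc, of "\<lambda>_. 1"] unfolding k0_unit_def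
      by (metis locally_const_const)
  qed
  then show ?thesis by blast
qed

lemma (in k0_morphism) ex_order_hom: "\<exists>\<rho>. unital_order_hom Y \<beta> X \<alpha> \<rho>"
proof -
  define \<rho> where "\<rho> A = k0_class X \<alpha> (r (SOME g. g \<in> A))" for A
  have \<rho>: "\<rho> (k0_class Y \<beta> g) = k0_class X \<alpha> (r g)" if g: "locally_const Y g" for g
  proof -
    have "\<exists>h. h \<in> k0_class Y \<beta> g" using g Y.mem_k0_class[of g g] by auto
    then have "(SOME h. h \<in> k0_class Y \<beta> g) \<in> k0_class Y \<beta> g" by (rule someI_ex)
    then have "locally_const Y (SOME h. h \<in> k0_class Y \<beta> g)" "Y.cohomologous (SOME h. h \<in> k0_class Y \<beta> g) g"
      by (auto simp: Y.mem_k0_class)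
    then show ?thesis
      unfolding \<rho>_def using g by (subst X.k0_class_eq) (auto intro: r_locally_const r_cohomologous)
  qed
  have "\<rho> \<in> hom (k0 Y \<beta>) (k0 X \<alpha>)"
  proof (rule homI)
    fix A assume "A \<in> carrier (k0 Y \<beta>)"
    then show "\<rho> A \<in> carrier (k0 X \<alpha>)" using \<rho> r_locally_const unfolding X.carrier_k0 Y.carrier_k0 by metis
    fix B assume "B \<in> carrier (k0 Y \<beta>)"
    with \<open>A \<in> carrier (k0 Y \<beta>)\<close> obtain g h where gh: "locally_const Y g" "locally_const Y h"
      and AB: "A = k0_class Y \<beta> g" "B = k0_class Y \<beta> h"
      unfolding Y.carrier_k0 by blast
    note sum = locally_const_add[OF gh]
    have "\<rho> (mult (k0 Y \<beta>) A B) = k0_class X \<alpha> (r (\<lambda>y. g y + h y))"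
      unfolding AB using Y.k0_mult[OF gh] \<rho>[OF sum] by simp
    also have "\<dots> = k0_class X \<alpha> (\<lambda>x. r g x + r h x)"
      using X.k0_class_eq[OF r_locally_const[OF sum]] r_add[OF gh] by blast
    also have "\<dots> = mult (k0 X \<alpha>) (\<rho> A) (\<rho> B)"
      unfolding AB using X.k0_mult r_locally_const gh \<rho> by simp
    finally show "\<rho> (mult (k0 Y \<beta>) A B) = mult (k0 X \<alpha>) (\<rho> A) (\<rho> B)" .
  qed
  moreover have "\<rho> ` k0_pos Y \<beta> \<subseteq> k0_pos X \<alpha>"
    using \<rho> r_nonneg X.k0_pos_iff r_locally_const unfolding k0_pos_def[of Y] cont_int_iff by auto
  moreover have "\<rho> (k0_unit Y \<beta>) = k0_unit X \<alpha>"
    unfolding k0_unit_def using \<rho>[of "\<lambda>_. 1"] X.k0_class_eq[OF r_locally_const, of "\<lambda>_. 1"] r_one by simp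
  ultimately show ?thesis by (auto simp: unital_order_hom_def)
qed

lemma k0_morphism_of_continuous_map:
  fixes X :: "'a::metric_space set" and Y :: "'b::metric_space set"
  assumes X: "cantor_minimal X \<alpha>" and Y: "cantor_minimal Y \<beta>"
    and F: "continuous_on X F" "F ` X \<subseteq> Y" and cob: "\<forall>g. cob Y \<beta> g \<longrightarrow> cob X \<alpha> (g \<circ> F)"
  shows "k0_morphism X \<alpha> Y \<beta> (\<lambda>g. g \<circ> F)"
proof -
  interpret X: cantor_minimal X \<alpha> by (rule X)
  interpret Y: cantor_minimal Y \<beta> by (rule Y)
  show ?thesis
  proof (intro k0_morphism.intro X Y k0_morphism_axioms.intro)
    show "locally_const X (g \<circ> F)" if "locally_const Y g" for g :: "'b \<Rightarrow> int"
      unfolding comp_def by (rule locally_const_compose[OF that F])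
    show "X.cohomologous (g \<circ> F) (h \<circ> F)" if "Y.cohomologous g h" for g h
      using that cob unfolding X.cohomologous_def Y.cohomologous_def by (auto simp: comp_def)
    show "X.class_le (\<lambda>_. 0) (g \<circ> F)" if "\<forall>y\<in>Y. 0 \<le> g y" for g
      using F that by (intro X.class_le_pointwise) auto
  qed (auto simp: comp_def)
qed

lemma cohomologous_of_near_conjugacy:
  fixes X :: "'a::metric_space set" and Y :: "'b::metric_space set"
  assumes X: "cantor_minimal X \<alpha>" and Y: "cantor_minimal Y \<beta>"
    and \<sigma>: "continuous_on X \<sigma>" "\<sigma> ` X \<subseteq> Y" and u: "locally_const Y u"
    and g: "\<And>y. y \<in> Y \<Longrightarrow> g y - h y = u y - u (hpow Y \<beta> (-1) y)"
    and near: "\<And>x. x \<in> X \<Longrightarrow> u (hpow Y \<beta> (-1) (\<sigma> (\<alpha> x))) = u (\<sigma> x)"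
  shows "cantor_minimal.cohomologous X \<alpha> (g \<circ> \<sigma>) (h \<circ> \<sigma>)"
proof -
  interpret X: cantor_minimal X \<alpha> by (rule X)
  interpret Y: cantor_minimal Y \<beta> by (rule Y)
  show ?thesis
  proof (rule X.cohomologousI)
    show "locally_const X (\<lambda>x. u (\<sigma> x))" by (rule locally_const_compose[OF u \<sigma>])
    fix x assume x: "x \<in> X"
    have "u (Y.T (-1) (\<sigma> x)) = u (\<sigma> (X.T (-1) x))" using near[of "X.T (-1) x"] x by simp
    then show "(g \<circ> \<sigma>) x - (h \<circ> \<sigma>) x = u (\<sigma> x) - u (\<sigma> (X.T (-1) x))"
      using g[of "\<sigma> x"] \<sigma>(2) x by auto
  qed
qed

lemma eventually_cohomologous_of_approximate_conjugacies:
  fixes X :: "'a::metric_space set" and Y :: "'b::metric_space set"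
  assumes X: "cantor_minimal X \<alpha>" and Y: "cantor_minimal Y \<beta>"
    and \<sigma>: "\<And>n. continuous_on X (\<sigma> n)" "\<And>n. \<sigma> n ` X = Y" "\<And>n. inj_on (\<sigma> n) X"
    and lim: "uniform_limit Y (\<lambda>n y. \<sigma> n (\<alpha> (inv_into X (\<sigma> n) y))) \<beta> sequentially"
    and gh: "cantor_minimal.cohomologous Y \<beta> g h"
  shows "\<forall>\<^sub>F n in sequentially. cantor_minimal.cohomologous X \<alpha> (g \<circ> \<sigma> n) (h \<circ> \<sigma> n)"
proof -
  interpret X: cantor_minimal X \<alpha> by (rule X)
  interpret Y: cantor_minimal Y \<beta> by (rule Y)
  obtain u where u: "locally_const Y u" "\<forall>y\<in>Y. g y - h y = u y - u (Y.T (-1) y)"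
    using gh unfolding Y.cohomologous_iff by blast
  obtain e where e: "e > 0" "\<forall>x\<in>Y. \<forall>y\<in>Y. dist x y < e \<longrightarrow> u (Y.T (-1) x) = u (Y.T (-1) y)"
    using locally_const_uniform[OF Y.compact_X Y.locally_const_T[OF u(1)]] by blast
  have "\<forall>\<^sub>F n in sequentially. \<forall>y\<in>Y. dist (\<sigma> n (\<alpha> (inv_into X (\<sigma> n) y))) (\<beta> y) < e"
    using lim e(1) unfolding uniform_limit_iff by blast
  then show ?thesis
  proof eventually_elim
    case (elim n)
    show ?case
    proof (rule cohomologous_of_near_conjugacy[OF X Y \<sigma>(1) _ u(1)])
      show "\<sigma> n ` X \<subseteq> Y" using \<sigma>(2) by blast
      show "g y - h y = u y - u (Y.T (-1) y)" if "y \<in> Y" for y using u(2) that by blast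
      fix x assume x: "x \<in> X"
      have Y: "\<sigma> n x \<in> Y" "\<sigma> n (\<alpha> x) \<in> Y" using \<sigma>(2) x X.\<alpha>_in by blast+
      then have "dist (\<sigma> n (\<alpha> x)) (\<beta> (\<sigma> n x)) < e" using elim \<sigma>(3) x by (metis inv_into_f_f)
      then have "u (Y.T (-1) (\<sigma> n (\<alpha> x))) = u (Y.T (-1) (\<beta> (\<sigma> n x)))" using e(2) Y Y.\<alpha>_in by blast
      then show "u (Y.T (-1) (\<sigma> n (\<alpha> x))) = u (\<sigma> n x)" using Y(1) by simp
    qed
  qed
qed

lemma k0_morphism_of_eventual_classes:
  fixes X :: "'a::metric_space set" and Y :: "'b::metric_space set"
  assumes X: "cantor_minimal X \<alpha>" and Y: "cantor_minimal Y \<beta>" and \<sigma>: "\<And>n. \<sigma> n ` X \<subseteq> Y"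
    and lc: "\<And>g. locally_const Y g \<Longrightarrow> locally_const X (r g)"
    and r: "\<And>g. locally_const Y g \<Longrightarrow>
      \<forall>\<^sub>F n in sequentially. cantor_minimal.cohomologous X \<alpha> (g \<circ> \<sigma> n) (r g)"
    and coh: "\<And>g h. cantor_minimal.cohomologous Y \<beta> g h \<Longrightarrow>
      \<forall>\<^sub>F n in sequentially. cantor_minimal.cohomologous X \<alpha> (g \<circ> \<sigma> n) (h \<circ> \<sigma> n)"
  shows "k0_morphism X \<alpha> Y \<beta> r"
proof -
  interpret X: cantor_minimal X \<alpha> by (rule X)
  interpret Y: cantor_minimal Y \<beta> by (rule Y)
  have limit: "X.cohomologous (r g) f"
    if "locally_const Y g" "\<forall>\<^sub>F n in sequentially. X.cohomologous (g \<circ> \<sigma> n) f" for g f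
  proof -
    have "\<exists>n. X.cohomologous (g \<circ> \<sigma> n) (r g) \<and> X.cohomologous (g \<circ> \<sigma> n) f"
      using eventually_conj[OF r[OF that(1)] that(2)] eventually_happens' trivial_limit_sequentially by blast
    then show ?thesis using X.cohomologous_sym X.cohomologous_trans by blast
  qed
  show ?thesis
  proof (intro k0_morphism.intro X Y k0_morphism_axioms.intro lc)
    fix g h :: "'b \<Rightarrow> int" assume g: "locally_const Y g" and h: "locally_const Y h"
    have "\<forall>\<^sub>F n in sequentially. X.cohomologous ((\<lambda>y. g y + h y) \<circ> \<sigma> n) (\<lambda>x. r g x + r h x)"
      using r[OF g] r[OF h] by eventually_elim (use X.cohomologous_add in \<open>force simp: comp_def\<close>)
    then show "X.cohomologous (r (\<lambda>y. g y + h y)) (\<lambda>x. r g x + r h x)" by (intro limit locally_const_add g h)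
    assume gh: "Y.cohomologous g h"
    have "\<forall>\<^sub>F n in sequentially. X.cohomologous (g \<circ> \<sigma> n) (r h)"
      using coh[OF gh] r[OF h] by eventually_elim (rule X.cohomologous_trans)
    then show "X.cohomologous (r g) (r h)" by (rule limit[OF g])
  next
    fix g :: "'b \<Rightarrow> int" assume g: "locally_const Y g" "\<forall>y\<in>Y. 0 \<le> g y"
    obtain n where n: "X.cohomologous (g \<circ> \<sigma> n) (r g)"
      using eventually_happens'[OF trivial_limit_sequentially r[OF g(1)]] by blast
    have "X.class_le (\<lambda>_. 0) (g \<circ> \<sigma> n)" using g(2) \<sigma>[of n] by (intro X.class_le_pointwise) auto
    then show "X.class_le (\<lambda>_. 0) (r g)" using n by (rule X.class_le_cohomologous_trans)
  next
    show "X.cohomologous (r (\<lambda>_. 1)) (\<lambda>_. 1)" by (rule limit) (simp_all add: comp_def)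
  qed
qed

lemma k0_morphism_of_approximate_conjugacies:
  fixes X :: "'a::metric_space set" and Y :: "'b::metric_space set"
  assumes X: "cantor_minimal X \<alpha>" and Y: "cantor_minimal Y \<beta>"
    and homeo: "\<forall>n. \<exists>\<tau>. homeomorphism X Y (\<sigma> n) \<tau>"
    and lim: "uniform_limit Y (\<lambda>n y. \<sigma> n (\<alpha> (inv_into X (\<sigma> n) y))) \<beta> sequentially"
    and stab: "\<forall>f. cont_int Y f \<longrightarrow> (\<exists>c N. \<forall>n\<ge>N. k0_class X \<alpha> (f \<circ> \<sigma> n) = c)"
  shows "\<exists>r. k0_morphism X \<alpha> Y \<beta> r"
proof -
  interpret X: cantor_minimal X \<alpha> by (rule X)
  have \<sigma>: "continuous_on X (\<sigma> n)" "\<sigma> n ` X = Y" "inj_on (\<sigma> n) X" for n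
    using homeo by (metis homeomorphism_def inj_on_inverseI)+
  have "\<exists>f. locally_const Y g \<longrightarrow>
      locally_const X f \<and> (\<forall>\<^sub>F n in sequentially. X.cohomologous (g \<circ> \<sigma> n) f)" for g
  proof (cases "locally_const Y g")
    case True
    have lc: "locally_const X (g \<circ> \<sigma> n)" for n
      unfolding comp_def by (rule locally_const_compose[OF True \<sigma>(1)]) (simp add: \<sigma>(2))
    obtain c N where "\<forall>n\<ge>N. k0_class X \<alpha> (g \<circ> \<sigma> n) = c" using stab True by (auto simp: cont_int_iff)
    then have "\<forall>n\<ge>N. X.cohomologous (g \<circ> \<sigma> n) (g \<circ> \<sigma> N)" using X.k0_class_eq[OF lc] by (metis order_refl)
    then show ?thesis using lc eventually_sequentially by blast
  qed simp
  then obtain r where r: "\<And>g. locally_const Y g \<Longrightarrow> locally_const X (r g)"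
    "\<And>g. locally_const Y g \<Longrightarrow> \<forall>\<^sub>F n in sequentially. X.cohomologous (g \<circ> \<sigma> n) (r g)" by metis
  have "k0_morphism X \<alpha> Y \<beta> r"
    using r eventually_cohomologous_of_approximate_conjugacies[OF X Y \<sigma> lim]
    by (intro k0_morphism_of_eventual_classes[OF X Y, of \<sigma>]) (simp_all add: \<sigma>(2))
  then show ?thesis by blast
qed

context cantor_minimal begin

lemma orbit_cocycle_eq: "x \<in> X \<Longrightarrow> g x = T n x \<Longrightarrow> orbit_cocycle X \<alpha> g x = n"
  unfolding orbit_cocycle_def by (rule the_equality) (auto dest: T_inj)

lemma
  assumes "\<gamma> \<in> full_group X \<alpha>"
  shows full_group_bij: "bij_betw \<gamma> X X"
    and full_group_eq_T: "x \<in> X \<Longrightarrow> \<gamma> x = T (orbit_cocycle X \<alpha> \<gamma> x) x"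
proof -
  obtain g where "homeomorphism X X \<gamma> g" using assms by (auto simp: full_group_def is_homeo_def)
  then show "bij_betw \<gamma> X X" by (auto simp: homeomorphism_def bij_betw_def intro!: inj_on_inverseI)
  show "\<gamma> x = T (orbit_cocycle X \<alpha> \<gamma> x) x" if x: "x \<in> X"
  proof -
    obtain n where "\<gamma> x = T n x" using assms x by (auto simp: full_group_def)
    then show ?thesis using orbit_cocycle_eq[OF x] by simp
  qed
qed

text \<open>A function that vanishes near the discontinuity of the cocycle is transported by finitely many
  powers of \<open>\<alpha>\<close>; subtracting its value there reduces the general case to this one.\<close>

lemma cohomologous_full_group:
  assumes \<gamma>: "\<gamma> \<in> full_group X \<alpha>"
    and cont: "\<forall>x\<in>X. x \<noteq> p \<longrightarrow> continuous (at x within X) (\<lambda>y. real_of_int (orbit_cocycle X \<alpha> \<gamma> y))"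
    and f: "locally_const X f" and h: "\<And>x. x \<in> X \<Longrightarrow> h (\<gamma> x) = f x"
  shows "cohomologous f h"
proof -
  define n where "n = orbit_cocycle X \<alpha> \<gamma>"
  have lc: "locally_const X (\<lambda>x. f x - f p)"
    by (rule locally_const_comp[where h="\<lambda>v. v - f p", OF f])
  define k where "k x = (if f x = f p then 0 else n x)" for x
  have "locally_const X k"
  proof (rule locally_constI)
    fix x assume x: "x \<in> X"
    have near: "\<forall>\<^sub>F y in at x within X. f y = f x" using locally_constD[OF f x] .
    show "\<forall>\<^sub>F y in at x within X. k y = k x"
    proof (cases "f x = f p")
      case True
      show ?thesis using near by eventually_elim (simp add: k_def True)
    next
      case False
      then have "x \<noteq> p" by blast
      then have "continuous (at x within X) (\<lambda>y. real_of_int (n y))" using cont x unfolding n_def by blast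
      then have "\<forall>\<^sub>F y in at x within X. n y = n x" by (simp add: continuous_within tendsto_of_int_iff)
      then show ?thesis using near by eventually_elim (simp add: k_def)
    qed
  qed
  then have "cohomologous (\<lambda>x. f x - f p) (\<lambda>x. h x - f p)"
    by (rule cohomologous_transport(2)[OF lc _ full_group_bij[OF \<gamma>]])
      (simp_all add: h k_def n_def full_group_eq_T[OF \<gamma>, symmetric])
  then have "cohomologous (\<lambda>x. f x - f p + f p) (\<lambda>x. h x - f p + f p)" by (intro cohomologous_add) simp_all
  then show ?thesis by simp
qed

end

lemma cob_of_factor:
  fixes X :: "'a::metric_space set" and Y :: "'b::metric_space set"
  assumes X: "cantor_minimal X \<alpha>" and Y: "cantor_minimal Y \<beta>"
    and F: "continuous_on X F" "F ` X \<subseteq> Y" and \<gamma>: "\<gamma> \<in> full_group X \<alpha>"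
    and cont: "\<forall>x\<in>X. x \<noteq> p \<longrightarrow> continuous (at x within X) (\<lambda>y. real_of_int (orbit_cocycle X \<alpha> \<gamma> y))"
    and eq: "\<forall>x\<in>X. \<beta> (F x) = F (\<gamma> x)" and g: "cob Y \<beta> g"
  shows "cob X \<alpha> (g \<circ> F)"
proof -
  interpret X: cantor_minimal X \<alpha> by (rule X)
  interpret Y: cantor_minimal Y \<beta> by (rule Y)
  obtain u where u: "locally_const Y u" "\<forall>y\<in>Y. g y = u y - u (Y.T (-1) y)"
    using g by (auto simp: Y.cob_iff)
  have FY: "F x \<in> Y" if "x \<in> X" for x using F(2) that by blast
  have "u (Y.T (-1) (F (\<gamma> x))) = u (F x)" if "x \<in> X" for x
    using eq Y.T_pred_\<alpha>[OF FY[OF that]] that by simp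
  then have "X.cohomologous (\<lambda>x. u (F x)) (\<lambda>x. u (Y.T (-1) (F x)))"
    by (intro X.cohomologous_full_group[OF \<gamma> cont locally_const_compose[OF u(1) F]])
  then have "X.cohomologous (\<lambda>x. u (F x) - u (Y.T (-1) (F x))) (\<lambda>x. u (Y.T (-1) (F x)) - u (Y.T (-1) (F x)))"
    by (rule X.cohomologous_diff) simp
  moreover have "X.cohomologous (g \<circ> F) (\<lambda>x. u (F x) - u (Y.T (-1) (F x)))"
    using u(2) FY by (intro X.cohomologous_cong) simp
  ultimately have "X.cohomologous (g \<circ> F) (\<lambda>_. 0)" using X.cohomologous_trans by fastforce
  then show ?thesis by (simp add: X.cohomologous_def comp_def)
qed

context cantor_minimal begin

section \<open>Clopen sets through prescribed points\<close>

lemma ex_small_clopen_nbhd_point: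
  assumes A: "clopen_in X A" and x: "x \<in> A - G" and G: "finite G"
    and f: "locally_const X f" "class_le (\<lambda>_. 0) f" "\<not> cohomologous f (\<lambda>_. 0)"
  shows "\<exists>B. clopen_in X B \<and> x \<in> B \<and> B \<subseteq> A - G \<and> class_le (\<lambda>y. int n * indicator B y) f"
proof -
  interpret id: k0_morphism X \<alpha> X \<alpha> "\<lambda>f. f" by (rule k0_morphism_id)
  have xX: "x \<in> X" and "x \<in> - G" using x clopen_in_subset[OF A] by auto
  then obtain S where S: "clopen_in X S" "x \<in> S" "S \<subseteq> - G"
    using cantor_set_clopen_nbhd[OF cantor xX open_Compl[OF finite_imp_closed[OF G]]] by blast
  have "\<forall>\<^sub>F B in small_bases. x \<in> B \<longrightarrow> B \<subseteq> A \<inter> S"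
    using eventually_small_bases_subset[OF clopen_in_Int[OF A S(1)]] x S(2) by blast
  then have small: "\<forall>\<^sub>F B in small_bases. (x \<in> B \<longrightarrow> B \<subseteq> A \<inter> S) \<and> class_le (\<lambda>y. int n * indicator B y) f"
    using id.eventually_multiple_indicator_le[OF f(2,3,1)] by (rule eventually_conj)
  obtain B where "clopen_base B" "x \<in> B" "(x \<in> B \<longrightarrow> B \<subseteq> A \<inter> S) \<and> class_le (\<lambda>y. int n * indicator B y) f"
    by (rule small_baseE[OF small xX])
  then show ?thesis using S(3) base_clopen by blast
qed

lemma ex_small_clopen_nbhd:
  assumes A: "clopen_in X A" and F: "finite F" "F \<subseteq> A" and G: "finite G" "F \<inter> G = {}"
    and f: "locally_const X f" "class_le (\<lambda>_. 0) f" "F \<noteq> {} \<Longrightarrow> \<not> cohomologous f (\<lambda>_. 0)"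
  shows "\<exists>N. clopen_in X N \<and> F \<subseteq> N \<and> N \<subseteq> A - G \<and> class_le (indicator N) f"
proof (cases "F = {}")
  case True
  have "(indicator {} :: 'a \<Rightarrow> int) = (\<lambda>_. 0)" by (simp add: fun_eq_iff)
  then have "class_le (indicator {}) f" using f(2) by simp
  then show ?thesis using True by (intro exI[of _ "{}"]) (simp add: clopen_in_def)
next
  case False
  define n where "n = card F"
  have "\<forall>x\<in>F. \<exists>B. clopen_in X B \<and> x \<in> B \<and> B \<subseteq> A - G \<and> class_le (\<lambda>y. int n * indicator B y) f"
  proof
    fix x assume "x \<in> F"
    then have "x \<in> A - G" using F(2) G(2) by blast
    then show "\<exists>B. clopen_in X B \<and> x \<in> B \<and> B \<subseteq> A - G \<and> class_le (\<lambda>y. int n * indicator B y) f"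
      by (rule ex_small_clopen_nbhd_point[OF A _ G(1) f(1,2) f(3)[OF False]])
  qed
  from bchoice[OF this] obtain B where B: "\<And>x. x \<in> F \<Longrightarrow> clopen_in X (B x)" "\<And>x. x \<in> F \<Longrightarrow> x \<in> B x"
    "\<And>x. x \<in> F \<Longrightarrow> B x \<subseteq> A - G" "\<And>x. x \<in> F \<Longrightarrow> class_le (\<lambda>y. int n * indicator (B x) y) f" by blast
  define N where "N = \<Union>(B ` F)"
  have N: "clopen_in X N" unfolding N_def using F(1) B(1) by (intro clopen_in_Union) auto
  have "class_le (\<lambda>y. int n * indicator N y) (\<lambda>y. \<Sum>x\<in>F. int n * indicator (B x) y)"
  proof (rule class_le_pointwise)
    fix y
    show "int n * indicator N y \<le> (\<Sum>x\<in>F. int n * indicator (B x) y)"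
    proof (cases "y \<in> N")
      case True
      then obtain x where x: "x \<in> F" "y \<in> B x" by (auto simp: N_def)
      then have "int n * indicator (B x) y \<le> (\<Sum>x\<in>F. int n * indicator (B x) y)"
        using F(1) by (intro member_le_sum) auto
      then show ?thesis using True x(2) by simp
    qed (simp add: sum_nonneg)
  qed
  also have "class_le \<dots> (\<lambda>y. \<Sum>x\<in>F. f y)" by (intro class_le_sum B(4))
  finally have "class_le (\<lambda>y. int n * indicator N y) (\<lambda>y. int n * f y)" by (simp add: n_def)
  then have "class_le (indicator N) f"
    using False F(1) locally_const_indicator[OF N] f(1)
    by (intro class_le_mult_cancel[of "int n" "indicator N"]) (simp_all add: n_def card_gt_0_iff)
  then show ?thesis using N B(2,3) by (intro exI[of _ N]) (auto simp: N_def)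
qed

lemma ex_clopen_subset_through:
  assumes A: "clopen_in X A" and f: "locally_const X f" "class_le (\<lambda>_. 0) f" "class_le f (indicator A)"
    and F: "finite F" "F \<subseteq> A" "F \<noteq> {} \<Longrightarrow> \<not> cohomologous f (\<lambda>_. 0)"
    and G: "finite G" "G \<subseteq> A" "G \<noteq> {} \<Longrightarrow> \<not> cohomologous f (indicator A)" and "F \<inter> G = {}"
  shows "\<exists>E. clopen_in X E \<and> E \<subseteq> A \<and> cohomologous (indicator E) f \<and> F \<subseteq> E \<and> E \<inter> G = {}"
proof -
  obtain N1 where N1: "clopen_in X N1" "F \<subseteq> N1" "N1 \<subseteq> A - G" "class_le (indicator N1) f"
    using ex_small_clopen_nbhd[OF A F(1,2) G(1) \<open>F \<inter> G = {}\<close> f(1,2) F(3)] by blast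
  define g where "g x = indicator A x - f x" for x
  have g: "locally_const X g" "class_le (\<lambda>_. 0) g"
    unfolding g_def using f A by (auto simp: class_le_diff_iff intro: locally_const_indicator)
  moreover have "\<not> cohomologous g (\<lambda>_. 0)" if "G \<noteq> {}"
    using G(3)[OF that] cohomologous_sym unfolding g_def cohomologous_diff_zero_iff by blast
  ultimately obtain N2 where N2: "clopen_in X N2" "G \<subseteq> N2" "N2 \<subseteq> A - N1 - {}" "class_le (indicator N2) g"
    using ex_small_clopen_nbhd[OF clopen_in_Diff[OF A N1(1)] G(1), of "{}" g] G(2) N1(3) by blast
  have clopen: "clopen_in X (A - N1 - N2)" by (intro clopen_in_Diff A N1 N2)
  have rest: "locally_const X (\<lambda>x. f x - indicator N1 x)"
    by (intro locally_const_diff f(1) locally_const_indicator N1(1))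
  have "class_le (\<lambda>_. 0) (\<lambda>x. g x - indicator N2 x)" using N2(4) by (simp add: class_le_diff_iff)
  also have "cohomologous \<dots> (\<lambda>x. indicator (A - N1 - N2) x - (f x - indicator N1 x))"
    using N1(3) N2(3) by (intro cohomologous_cong) (auto simp: g_def indicator_def)
  finally have "class_le (\<lambda>x. f x - indicator N1 x) (indicator (A - N1 - N2))"
    by (simp add: class_le_diff_iff)
  moreover have "class_le (\<lambda>_. 0) (\<lambda>x. f x - indicator N1 x)" using N1(4) by (simp add: class_le_diff_iff)
  ultimately obtain C where C: "clopen_in X C" "C \<subseteq> A - N1 - N2"
    "cohomologous (indicator C) (\<lambda>x. f x - indicator N1 x)"
    using ex_clopen_subset_of_class[OF clopen rest] by blast
  have "cohomologous (indicator (C \<union> N1)) (\<lambda>x. indicator C x + indicator N1 x)"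
    using C(2) by (intro cohomologous_cong) (auto simp: indicator_def)
  also have "cohomologous \<dots> (\<lambda>x. f x - indicator N1 x + indicator N1 x)"
    by (intro cohomologous_add C(3)) simp
  finally have "cohomologous (indicator (C \<union> N1)) f" by simp
  moreover have "clopen_in X (C \<union> N1)" using C(1) N1(1) by (auto simp: clopen_in_def)
  moreover have "C \<union> N1 \<subseteq> A" "F \<subseteq> C \<union> N1" "(C \<union> N1) \<inter> G = {}" using C(2) N1(2,3) N2(2) by auto
  ultimately show ?thesis by blast
qed

lemma ex_clopen_subset_of_half_class:
  assumes A: "clopen_in X A" and w: "locally_const X w" "class_le (\<lambda>_. 0) w" "\<not> class_le w (\<lambda>_. 0)"
    and double: "class_le (\<lambda>x. w x + w x) (indicator A)"
    and F: "finite F" "F \<subseteq> A" and G: "finite G" "G \<subseteq> A" and "F \<inter> G = {}"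
  shows "\<exists>E. clopen_in X E \<and> E \<subseteq> A \<and> cohomologous (indicator E) w \<and> F \<subseteq> E \<and> E \<inter> G = {}"
proof -
  have "class_le (\<lambda>x. 0 + w x) (\<lambda>x. w x + w x)" by (intro class_le_add w(2) class_le_pointwise) simp
  then have le: "class_le w (indicator A)" using double class_le_trans by simp
  have nonzero: "\<not> cohomologous w (\<lambda>_. 0)" using w(3) cohomologous_imp_class_le by blast
  have strict: "\<not> cohomologous w (indicator A)"
  proof
    assume "cohomologous w (indicator A)"
    then have "class_le (\<lambda>x. w x + w x) w"
      using double cohomologous_sym class_le_cohomologous_trans by blast
    then have "class_le (\<lambda>_. 0) (\<lambda>x. 0 - w x)" unfolding class_le_diff_iff[symmetric, of _ w] by simp
    then show False using w(3) unfolding class_le_diff_iff by simp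
  qed
  show ?thesis
    using ex_clopen_subset_through[OF A w(1,2) le F nonzero G strict \<open>F \<inter> G = {}\<close>] .
qed

end

context k0_morphism begin

section \<open>Lifts of partitions\<close>

definition lift_of :: "('a \<Rightarrow> 'b set) \<Rightarrow> 'b set set \<Rightarrow> bool" where
  "lift_of \<kappa> P \<longleftrightarrow> locally_const X \<kappa> \<and> \<kappa> ` X \<subseteq> P
     \<and> (\<forall>C\<in>P. X.cohomologous (indicator {x\<in>X. \<kappa> x = C}) (r (indicator C)))"

lemma
  assumes "lift_of \<kappa> P"
  shows lift_locally_const: "locally_const X \<kappa>"
    and lift_in: "x \<in> X \<Longrightarrow> \<kappa> x \<in> P"
    and lift_class: "C \<in> P \<Longrightarrow> X.cohomologous (indicator {x\<in>X. \<kappa> x = C}) (r (indicator C))"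
  using assms by (auto simp: lift_of_def)

lemma lift_onto:
  assumes \<kappa>: "lift_of \<kappa> P" and P: "clopen_partition Y P" and C: "C \<in> P"
  shows "\<exists>x\<in>X. \<kappa> x = C"
proof (rule ccontr)
  assume "\<not> (\<exists>x\<in>X. \<kappa> x = C)"
  then have empty: "{x\<in>X. \<kappa> x = C} = {}" by blast
  have "X.cohomologous (r (indicator C)) (indicator {})"
    using X.cohomologous_sym[OF lift_class[OF \<kappa> C]] unfolding empty .
  moreover have "X.cohomologous (indicator {}) (\<lambda>_. 0)" by (rule X.cohomologous_cong) simp
  ultimately show False
    using r_indicator_nonzero clopen_partitionD(3,4)[OF P C] X.cohomologous_trans by blast
qed

lemma lift_partition_map: "lift_of \<kappa> P \<Longrightarrow> clopen_partition Y P \<Longrightarrow> partition_map X Y \<kappa>"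
proof -
  assume \<kappa>: "lift_of \<kappa> P" and P: "clopen_partition Y P"
  have "\<kappa> ` X = P" using lift_in[OF \<kappa>] lift_onto[OF \<kappa> P] by blast
  then show ?thesis using P lift_locally_const[OF \<kappa>] by (simp add: partition_map_def)
qed

lemma cohomologous_comp_lift:
  assumes \<kappa>: "lift_of \<kappa> P" and P: "clopen_partition Y P" and f: "locally_const Y f"
    and const: "\<forall>C\<in>P. const_on f C" and s: "\<And>x. x \<in> X \<Longrightarrow> s x \<in> \<kappa> x"
  shows "X.cohomologous (f \<circ> s) (r f)"
proof -
  note fin = clopen_partitionD(1)[OF P]
  obtain c where c: "\<And>C. C \<in> P \<Longrightarrow> c C \<in> C" using clopen_partitionD(3)[OF P] by (metis ex_in_conv)
  have const_value: "f y = f (c C)" if "C \<in> P" "y \<in> C" for C y using const c that by blast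
  have lc: "locally_const Y (\<lambda>y. f (c C) * indicator C y)" if "C \<in> P" for C
    by (intro locally_const_mult locally_const_const locally_const_indicator clopen_partitionD(4)[OF P that])
  have "X.cohomologous (f \<circ> s) (\<lambda>x. \<Sum>C\<in>P. f (c C) * indicator {x\<in>X. \<kappa> x = C} x)"
  proof (rule X.cohomologous_cong)
    fix x assume x: "x \<in> X"
    have "(\<Sum>C\<in>P. f (c C) * indicator {x\<in>X. \<kappa> x = C} x) = (\<Sum>C\<in>P. if \<kappa> x = C then f (c C) else 0)"
      using x by (intro sum.cong) auto
    also have "\<dots> = f (s x)" using fin const_value[OF lift_in[OF \<kappa> x] s[OF x]] lift_in[OF \<kappa> x] by simp
    finally show "(f \<circ> s) x = (\<Sum>C\<in>P. f (c C) * indicator {x\<in>X. \<kappa> x = C} x)" by simp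
  qed
  also have "X.cohomologous \<dots> (\<lambda>x. \<Sum>C\<in>P. f (c C) * r (indicator C) x)"
    by (intro X.cohomologous_sum X.cohomologous_mult lift_class[OF \<kappa>])
  also have "X.cohomologous \<dots> (\<lambda>x. \<Sum>C\<in>P. r (\<lambda>y. f (c C) * indicator C y) x)"
    by (intro X.cohomologous_sum X.cohomologous_sym[OF r_mult] locally_const_indicator clopen_partitionD(4)[OF P])
  also have "X.cohomologous \<dots> (r (\<lambda>y. \<Sum>C\<in>P. f (c C) * indicator C y))"
    by (rule X.cohomologous_sym[OF r_sum]) (rule lc)
  also have "X.cohomologous \<dots> (r f)"
  proof (rule r_cong)
    show "locally_const Y (\<lambda>y. \<Sum>C\<in>P. f (c C) * indicator C y)" by (intro locally_const_sum lc)
    fix y assume "y \<in> Y"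
    then obtain C where C: "C \<in> P" "y \<in> C" using clopen_partitionD(2)[OF P] by blast
    have "(\<Sum>D\<in>P. f (c D) * indicator D y) = (\<Sum>D\<in>P. if C = D then f (c D) else 0)"
      using C clopen_partitionD(6)[OF P] by (intro sum.cong) (auto simp: indicator_def)
    then show "(\<Sum>C\<in>P. f (c C) * indicator C y) = f y" using fin C(1) const_value[OF C] by simp
  qed
  finally show ?thesis .
qed

lemma ex_clopen_subset_with_r_class:
  assumes A: "clopen_in X A" and V: "clopen_in Y V" and D: "clopen_in Y D" "D \<subseteq> V"
    and AV: "X.cohomologous (indicator A) (r (indicator V))"
    and F: "finite F" "F \<subseteq> A" "F \<noteq> {} \<Longrightarrow> D \<noteq> {}" and G: "finite G" "G \<subseteq> A" "G \<noteq> {} \<Longrightarrow> D \<noteq> V" "F \<inter> G = {}"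
  shows "\<exists>E. clopen_in X E \<and> E \<subseteq> A \<and> X.cohomologous (indicator E) (r (indicator D))
    \<and> X.cohomologous (indicator (A - E)) (r (indicator (V - D))) \<and> F \<subseteq> E \<and> E \<inter> G = {}"
proof -
  have diff: "X.cohomologous (\<lambda>x. indicator A x - r (indicator D) x) (r (indicator (V - D)))"
    by (rule X.cohomologous_trans[OF X.cohomologous_diff[OF AV X.cohomologous_refl]
          X.cohomologous_sym[OF r_indicator_Diff[OF V D]]])
  have "X.class_le (r (indicator D)) (r (indicator V))" using D V by (intro r_indicator_le)
  then have le: "X.class_le (r (indicator D)) (indicator A)"
    using X.cohomologous_sym[OF AV] by (rule X.class_le_cohomologous_trans)
  have "\<not> X.cohomologous (r (indicator D)) (indicator A)" if "G \<noteq> {}"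
  proof
    assume "X.cohomologous (r (indicator D)) (indicator A)"
    then have "X.cohomologous (\<lambda>x. indicator A x - r (indicator D) x) (\<lambda>_. 0)"
      by (simp add: X.cohomologous_diff_zero_iff X.cohomologous_sym)
    then have "X.cohomologous (r (indicator (V - D))) (\<lambda>_. 0)"
      using diff X.cohomologous_sym X.cohomologous_trans by blast
    then show False using r_indicator_nonzero clopen_in_Diff[OF V D(1)] G(3)[OF that] D(2) by blast
  qed
  then obtain E where E: "clopen_in X E" "E \<subseteq> A" "X.cohomologous (indicator E) (r (indicator D))"
    "F \<subseteq> E" "E \<inter> G = {}"
    using X.ex_clopen_subset_through[OF A r_locally_const[OF locally_const_indicator[OF D(1)]]
        r_indicator_nonneg[OF D(1)] le F(1,2) _ G(1,2) _ G(4)] r_indicator_nonzero[OF D(1)] F(3) by metis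
  have "X.cohomologous (indicator (A - E)) (\<lambda>x. indicator A x - indicator E x)"
    by (rule X.cohomologous_indicator_Diff[OF E(2)])
  also have "X.cohomologous \<dots> (\<lambda>x. indicator A x - r (indicator D) x)"
    by (intro X.cohomologous_diff E(3)) simp
  also note diff
  finally show ?thesis using E by blast
qed

lemma ex_clopen_subset_over:
  assumes D: "clopen_in Y D" "D \<noteq> {}" and V: "clopen_in Y V" "D \<inter> V = {}"
    and A: "clopen_in X A" "X.cohomologous (indicator A) (r (indicator (D \<union> V)))"
    and F: "finite F" "F \<subseteq> A" "\<forall>x\<in>F. s x \<in> D \<union> V"
  shows "\<exists>E. clopen_in X E \<and> E \<subseteq> A \<and> X.cohomologous (indicator E) (r (indicator D))
    \<and> X.cohomologous (indicator (A - E)) (r (indicator V)) \<and> (\<forall>x\<in>F. x \<in> E \<longleftrightarrow> s x \<in> D)"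
proof -
  define F1 where "F1 = {x\<in>F. s x \<in> D}"
  have DV: "clopen_in Y (D \<union> V)" using clopen_in_Union[of "{D, V}" Y] D(1) V(1) by auto
  have F1: "finite F1" "F1 \<subseteq> A" "finite (F - F1)" "F - F1 \<subseteq> A" "F1 \<inter> (F - F1) = {}"
    using F(1,2) by (auto simp: F1_def)
  have not_all: "D \<noteq> D \<union> V" if "F - F1 \<noteq> {}" using that F(3) V(2) by (auto simp: F1_def)
  obtain E where E: "clopen_in X E" "E \<subseteq> A" "X.cohomologous (indicator E) (r (indicator D))"
    "X.cohomologous (indicator (A - E)) (r (indicator (D \<union> V - D)))" "F1 \<subseteq> E" "E \<inter> (F - F1) = {}"
    using ex_clopen_subset_with_r_class[OF A(1) DV D(1) Un_upper1 A(2) F1(1,2) D(2) F1(3,4) not_all F1(5)]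
    by metis
  have "D \<union> V - D = V" using V(2) by blast
  moreover have "\<forall>x\<in>F. x \<in> E \<longleftrightarrow> s x \<in> D" using E(5,6) by (auto simp: F1_def)
  ultimately show ?thesis using E(1-4) by metis
qed

lemma ex_lift_on:
  assumes "finite \<D>" "\<And>D. D \<in> \<D> \<Longrightarrow> clopen_in Y D \<and> D \<noteq> {}" "disjoint \<D>"
    "clopen_in X A" "X.cohomologous (indicator A) (r (indicator (\<Union>\<D>)))"
    "finite F" "F \<subseteq> A" "\<forall>x\<in>F. s x \<in> \<Union>\<D>"
  shows "\<exists>\<kappa>. locally_const X \<kappa> \<and> (\<forall>x\<in>A. \<kappa> x \<in> \<D>) \<and> (\<forall>x\<in>F. s x \<in> \<kappa> x)
    \<and> (\<forall>D\<in>\<D>. X.cohomologous (indicator {x\<in>A. \<kappa> x = D}) (r (indicator D)))"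
  using assms
proof (induction \<D> arbitrary: A F rule: finite_induct)
  case empty
  have "(indicator {} :: 'b \<Rightarrow> int) = (\<lambda>_. 0)" by (simp add: fun_eq_iff)
  then have "X.cohomologous (indicator A) (r (\<lambda>_. 0))" using empty.prems(4) by simp
  then have "X.cohomologous (indicator A) (\<lambda>_. 0)" using r_zero by (rule X.cohomologous_trans)
  then have "A = {}" by (rule X.indicator_cohomologous_zero[OF empty.prems(3)])
  then show ?case using empty.prems(6) by (intro exI[of _ "\<lambda>_. {}"]) auto
next
  case (insert D \<D>)
  have D: "clopen_in Y D" "D \<noteq> {}" using insert.prems(1) by auto
  have V: "clopen_in Y (\<Union>\<D>)" using insert.prems(1) insert.hyps(1) by (intro clopen_in_Union) auto
  have disj: "D \<inter> \<Union>\<D> = {}" using insert.prems(2) insert.hyps(2) by (auto simp: disjoint_def)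
  have over: "X.cohomologous (indicator A) (r (indicator (D \<union> \<Union>\<D>)))" "\<forall>x\<in>F. s x \<in> D \<union> \<Union>\<D>"
    using insert.prems(4,7) by simp_all
  obtain E where E: "clopen_in X E" "E \<subseteq> A" "X.cohomologous (indicator E) (r (indicator D))"
    "X.cohomologous (indicator (A - E)) (r (indicator (\<Union>\<D>)))" "\<forall>x\<in>F. x \<in> E \<longleftrightarrow> s x \<in> D"
    using ex_clopen_subset_over[OF D V disj insert.prems(3) over(1) insert.prems(5,6) over(2)] by blast
  have "disjoint \<D>" using insert.prems(2) by (auto simp: disjoint_def)
  moreover have "F - E \<subseteq> A - E" "\<forall>x\<in>F - E. s x \<in> \<Union>\<D>" using insert.prems(6) over(2) E(5) by auto
  ultimately obtain \<kappa> where \<kappa>: "locally_const X \<kappa>" "\<forall>x\<in>A - E. \<kappa> x \<in> \<D>" "\<forall>x\<in>F - E. s x \<in> \<kappa> x"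
    "\<forall>C\<in>\<D>. X.cohomologous (indicator {x\<in>A - E. \<kappa> x = C}) (r (indicator C))"
    using insert.IH[of "A - E" "F - E"] insert.prems(1,5) clopen_in_Diff[OF insert.prems(3) E(1)] E(4) by auto
  define \<kappa>' where "\<kappa>' x = (if x \<in> E then D else \<kappa> x)" for x
  have "locally_const X \<kappa>'"
    unfolding \<kappa>'_def[abs_def] by (intro locally_const_if locally_const_mem E(1) \<kappa>(1) locally_const_const)
  moreover have "\<forall>x\<in>A. \<kappa>' x \<in> insert D \<D>" using \<kappa>(2) by (auto simp: \<kappa>'_def)
  moreover have "\<forall>x\<in>F. s x \<in> \<kappa>' x" using E(5) \<kappa>(3) by (auto simp: \<kappa>'_def)
  moreover have "{x\<in>A. \<kappa>' x = D} = E" using E(2) \<kappa>(2) insert.hyps(2) by (auto simp: \<kappa>'_def)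
  moreover have "{x\<in>A. \<kappa>' x = C} = {x\<in>A - E. \<kappa> x = C}" if "C \<in> \<D>" for C
    using that insert.hyps(2) by (auto simp: \<kappa>'_def)
  ultimately show ?case using E(3) \<kappa>(4) by (intro exI[of _ \<kappa>'] conjI ballI) auto
qed

lemma ex_lift_over_atom:
  assumes \<kappa>: "lift_of \<kappa> P" and Q: "clopen_partition Y Q" and ref: "refines Y Q P" and C: "C \<in> P"
    and F: "finite F" "F \<subseteq> X" and s: "\<And>x. x \<in> F \<Longrightarrow> s x \<in> \<kappa> x"
  shows "\<exists>\<mu>. locally_const X \<mu> \<and> (\<forall>x\<in>X. \<kappa> x = C \<longrightarrow> \<mu> x \<in> Q \<and> \<mu> x \<subseteq> C) \<and> (\<forall>x\<in>F. \<kappa> x = C \<longrightarrow> s x \<in> \<mu> x)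
    \<and> (\<forall>D\<in>Q. D \<subseteq> C \<longrightarrow> X.cohomologous (indicator {x\<in>X. \<kappa> x = C \<and> \<mu> x = D}) (r (indicator D)))"
proof -
  define \<D> where "\<D> = {D\<in>Q. D \<subseteq> C}"
  have "\<Union>\<D> = C" using refines_obtains_subset[OF ref C] partition_onD1 unfolding \<D>_def by metis
  then have class_C: "X.cohomologous (indicator {x\<in>X. \<kappa> x = C}) (r (indicator (\<Union>\<D>)))"
    and s\<D>: "\<forall>x\<in>{x\<in>F. \<kappa> x = C}. s x \<in> \<Union>\<D>"
    using lift_class[OF \<kappa> C] s by auto
  have "disjoint Q" using Q partition_onD2 by (auto simp: clopen_partition_def)
  then have \<D>: "finite \<D>" "\<And>D. D \<in> \<D> \<Longrightarrow> clopen_in Y D \<and> D \<noteq> {}" "disjoint \<D>"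
    using clopen_partitionD(1,3,4)[OF Q] by (auto simp: \<D>_def disjoint_def)
  have FC: "finite {x\<in>F. \<kappa> x = C}" "{x\<in>F. \<kappa> x = C} \<subseteq> {x\<in>X. \<kappa> x = C}" using F by auto
  obtain \<mu> where \<mu>: "locally_const X \<mu>" "\<forall>x\<in>{x\<in>X. \<kappa> x = C}. \<mu> x \<in> \<D>" "\<forall>x\<in>{x\<in>F. \<kappa> x = C}. s x \<in> \<mu> x"
    "\<forall>D\<in>\<D>. X.cohomologous (indicator {x\<in>{x\<in>X. \<kappa> x = C}. \<mu> x = D}) (r (indicator D))"
    using ex_lift_on[OF \<D> clopen_in_level[OF lift_locally_const[OF \<kappa>]] class_C FC s\<D>] by blast
  then show ?thesis unfolding \<D>_def by (intro exI[of _ \<mu>]) simp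
qed

lemma ex_lift_refining:
  assumes \<kappa>: "lift_of \<kappa> P" and P: "clopen_partition Y P" and Q: "clopen_partition Y Q"
    and ref: "refines Y Q P" and F: "finite F" "F \<subseteq> X" and s: "\<And>x. x \<in> F \<Longrightarrow> s x \<in> \<kappa> x"
  shows "\<exists>\<kappa>'. lift_of \<kappa>' Q \<and> (\<forall>x\<in>X. \<kappa>' x \<subseteq> \<kappa> x) \<and> (\<forall>x\<in>F. s x \<in> \<kappa>' x)"
proof -
  define lifts where "lifts C \<mu> \<longleftrightarrow> (\<forall>x\<in>X. \<kappa> x = C \<longrightarrow> \<mu> x \<in> Q \<and> \<mu> x \<subseteq> C) \<and> (\<forall>x\<in>F. \<kappa> x = C \<longrightarrow> s x \<in> \<mu> x)
    \<and> (\<forall>D\<in>Q. D \<subseteq> C \<longrightarrow> X.cohomologous (indicator {x\<in>X. \<kappa> x = C \<and> \<mu> x = D}) (r (indicator D)))" for C \<mu>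
  have "\<exists>\<mu>. locally_const X \<mu> \<and> (C \<in> P \<longrightarrow> lifts C \<mu>)" for C
    unfolding lifts_def using ex_lift_over_atom[OF \<kappa> Q ref _ F s, of C] locally_const_const
    by (cases "C \<in> P") blast+
  then obtain \<mu> where lc: "\<And>C. locally_const X (\<mu> C)" and "\<And>C. C \<in> P \<Longrightarrow> lifts C (\<mu> C)" by metis
  note \<mu> = this(2)[unfolded lifts_def]
  define \<kappa>' where "\<kappa>' x = \<mu> (\<kappa> x) x" for x
  have in_Q: "\<kappa>' x \<in> Q" "\<kappa>' x \<subseteq> \<kappa> x" if "x \<in> X" for x
    using \<mu>[OF lift_in[OF \<kappa> that]] that by (auto simp: \<kappa>'_def)
  have "locally_const X \<kappa>'"
    unfolding \<kappa>'_def[abs_def] by (rule locally_const_select[OF lift_locally_const[OF \<kappa>] lc])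
  moreover have "X.cohomologous (indicator {x\<in>X. \<kappa>' x = D}) (r (indicator D))" if D: "D \<in> Q" for D
  proof -
    obtain C where C: "C \<in> P" "D \<subseteq> C" using ref D by (auto simp: refines_def)
    obtain y where y: "y \<in> D" using clopen_partitionD(3)[OF Q D] by blast
    have "\<kappa> x = C" if "x \<in> X" "\<kappa>' x = D" for x
      using clopen_partitionD(6)[OF P lift_in[OF \<kappa> that(1)] C(1), of y] in_Q(2)[OF that(1)] that(2) C(2) y by blast
    then have "{x\<in>X. \<kappa>' x = D} = {x\<in>X. \<kappa> x = C \<and> \<mu> C x = D}" unfolding \<kappa>'_def by auto
    then show ?thesis using \<mu>[OF C(1)] D C(2) by simp
  qed
  ultimately have "lift_of \<kappa>' Q" using in_Q unfolding lift_of_def by blast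
  moreover have "s x \<in> \<kappa>' x" if "x \<in> F" for x
    using \<mu>[OF lift_in[OF \<kappa>]] F(2) that by (auto simp: \<kappa>'_def)
  ultimately show ?thesis using in_Q by blast
qed

lemma lift_of_split:
  assumes \<kappa>: "lift_of \<kappa> P" and P: "clopen_partition Y P" and C: "C \<in> P"
    and W: "clopen_in Y W" "W \<noteq> {}" "W \<subset> C"
    and H: "clopen_in X H" "H \<subseteq> {x\<in>X. \<kappa> x = C}" "X.cohomologous (indicator H) (r (indicator W))"
  shows "lift_of (\<lambda>x. if \<kappa> x = C then (if x \<in> H then W else C - W) else \<kappa> x)
    (insert W (insert (C - W) (P - {C})))" (is "lift_of ?\<kappa> ?P")
  unfolding lift_of_def
proof (intro conjI ballI)
  note lc = lift_locally_const[OF \<kappa>]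
  show "locally_const X ?\<kappa>"
    by (intro locally_const_if locally_const_mem H(1) locally_const_const lc
        locally_const_comp[where h="\<lambda>D. D = C", OF lc])
  show "?\<kappa> ` X \<subseteq> ?P" using lift_in[OF \<kappa>] by auto
  have disj: "D \<inter> C = {}" if "D \<in> P - {C}" for D using clopen_partitionD(6)[OF P _ C] that by blast
  fix D assume "D \<in> ?P"
  then consider (new) "D = W" | (rest) "D = C - W" | (old) "D \<in> P" "D \<noteq> C" "D \<noteq> W" "D \<noteq> C - W" by blast
  then show "X.cohomologous (indicator {x\<in>X. ?\<kappa> x = D}) (r (indicator D))"
  proof cases
    case new
    have "\<kappa> x \<noteq> W" if "x \<in> X" "\<kappa> x \<noteq> C" for x using disj[of "\<kappa> x"] lift_in[OF \<kappa>] that W(2,3) by auto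
    then have "{x\<in>X. ?\<kappa> x = D} = H" using new H(2) W by auto
    then show ?thesis using H(3) new by simp
  next
    case rest
    have "\<kappa> x \<noteq> C - W" if "x \<in> X" "\<kappa> x \<noteq> C" for x using disj[of "\<kappa> x"] lift_in[OF \<kappa>] that W(3) by auto
    then have "{x\<in>X. ?\<kappa> x = D} = {x\<in>X. \<kappa> x = C} - H" using rest W by auto
    then have "X.cohomologous (indicator {x\<in>X. ?\<kappa> x = D}) (\<lambda>x. indicator {x\<in>X. \<kappa> x = C} x - indicator H x)"
      using X.cohomologous_indicator_Diff[OF H(2)] by simp
    also have "X.cohomologous \<dots> (\<lambda>x. r (indicator C) x - r (indicator W) x)"
      by (intro X.cohomologous_diff lift_class[OF \<kappa> C] H(3))
    also have "X.cohomologous \<dots> (r (indicator (C - W)))"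
      using W by (intro X.cohomologous_sym[OF r_indicator_Diff] clopen_partitionD(4)[OF P C]) auto
    finally show ?thesis using rest by simp
  next
    case old
    then have "{x\<in>X. ?\<kappa> x = D} = {x\<in>X. \<kappa> x = D}" by auto
    then show ?thesis using lift_class[OF \<kappa>] old(1) by simp
  qed
qed

lemma ex_localized_lift:
  assumes \<kappa>: "lift_of \<kappa> P" and P: "clopen_partition Y P" and C: "C \<in> P"
    and W: "clopen_in Y W" "W \<subset> C" "v \<in> W"
    and G: "clopen_in X G" "G \<subseteq> {x\<in>X. \<kappa> x = C}" "X.class_le (\<lambda>x. int 2 * r (indicator W) x) (indicator G)"
    and F: "finite F" and s: "\<And>x. x \<in> F \<Longrightarrow> s x \<in> \<kappa> x" "\<And>x. x \<in> F \<Longrightarrow> if s x = v then x \<in> G else s x \<notin> W"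
  shows "\<exists>\<kappa>'. lift_of \<kappa>' (insert W (insert (C - W) (P - {C})))
    \<and> (\<forall>x\<in>X. \<kappa>' x \<subseteq> \<kappa> x) \<and> (\<forall>x\<in>X. \<kappa>' x = W \<longrightarrow> x \<in> G) \<and> (\<forall>x\<in>F. s x \<in> \<kappa>' x)"
proof -
  have ne: "W \<noteq> {}" using W(3) by blast
  define F1 where "F1 = {x\<in>F. s x = v}"
  define F2 where "F2 = {x\<in>F. s x \<noteq> v \<and> x \<in> G}"
  have F12: "finite F1" "F1 \<subseteq> G" "finite F2" "F2 \<subseteq> G" "F1 \<inter> F2 = {}"
    using F s(2) by (force simp: F1_def F2_def)+
  have double: "X.class_le (\<lambda>x. r (indicator W) x + r (indicator W) x) (indicator G)" using G(3) by simp
  obtain H where H: "clopen_in X H" "H \<subseteq> G" "X.cohomologous (indicator H) (r (indicator W))"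
    "F1 \<subseteq> H" "H \<inter> F2 = {}"
    using X.ex_clopen_subset_of_half_class[OF G(1) r_locally_const[OF locally_const_indicator[OF W(1)]]
        r_indicator_nonneg[OF W(1)] r_indicator_not_le_zero[OF W(1) ne] double F12] by metis
  define \<kappa>' where "\<kappa>' x = (if \<kappa> x = C then if x \<in> H then W else C - W else \<kappa> x)" for x
  have "lift_of \<kappa>' (insert W (insert (C - W) (P - {C})))"
    unfolding \<kappa>'_def[abs_def] using H(2) G(2) by (intro lift_of_split[OF \<kappa> P C W(1) ne W(2) H(1) _ H(3)]) blast
  moreover have "\<kappa>' x \<subseteq> \<kappa> x" for x using W(2) by (auto simp: \<kappa>'_def)
  moreover have "x \<in> G" if x: "x \<in> X" and W_eq: "\<kappa>' x = W" for x
  proof -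
    have "\<kappa> x \<noteq> C \<Longrightarrow> \<kappa> x = W" using W_eq by (simp add: \<kappa>'_def)
    then have "\<kappa> x = C" using clopen_partitionD(6)[OF P lift_in[OF \<kappa> x] C, of v] W(2,3) by blast
    then show ?thesis using W_eq H(2) W(3) by (auto simp: \<kappa>'_def split: if_splits)
  qed
  moreover have "s x \<in> \<kappa>' x" if x: "x \<in> F" for x
  proof (cases "s x = v")
    case True
    then have "x \<in> H" "\<kappa> x = C" using x H(2,4) G(2) by (auto simp: F1_def)
    then show ?thesis using W(3) True by (simp add: \<kappa>'_def)
  next
    case False
    then have "s x \<notin> W" using s(2)[OF x] by simp
    moreover have "x \<notin> H" using x False H(2,5) by (auto simp: F2_def)
    ultimately show ?thesis using s(1)[OF x] by (auto simp: \<kappa>'_def)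
  qed
  ultimately show ?thesis by (intro exI[of _ \<kappa>'] conjI ballI impI)
qed

lemma eventually_localized_lift:
  assumes \<kappa>: "lift_of \<kappa> P" and P: "clopen_partition Y P" and C: "C \<in> P" and v: "v \<in> C"
    and G: "clopen_in X G" "G \<noteq> {}" "G \<subseteq> {x\<in>X. \<kappa> x = C}"
    and F: "finite F" and s: "\<And>x. x \<in> F \<Longrightarrow> s x \<in> \<kappa> x" "\<And>x. x \<in> F \<Longrightarrow> s x = v \<Longrightarrow> x \<in> G"
  shows "\<forall>\<^sub>F W in Y.small_bases. v \<in> W \<longrightarrow> (\<exists>\<kappa>' P'. lift_of \<kappa>' P' \<and> clopen_partition Y P' \<and> refines Y P' P
    \<and> W \<in> P' \<and> (\<forall>x\<in>X. \<kappa>' x \<subseteq> \<kappa> x) \<and> (\<forall>x\<in>X. \<kappa>' x = W \<longrightarrow> x \<in> G) \<and> (\<forall>x\<in>F. s x \<in> \<kappa>' x))"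
proof -
  note clC = clopen_partitionD(4)[OF P C]
  obtain c where c: "c \<in> C" "c \<notin> {v}" using clopen_in_other_point[OF Y.cantor clC, of "{v}"] v by blast
  define E where "E = insert c (s ` F) - {v}"
  have "closed E" using F by (intro finite_imp_closed) (simp add: E_def)
  then have "open (- E)" by (rule open_Compl)
  moreover have "v \<in> - E" by (simp add: E_def)
  ultimately obtain S where S: "clopen_in Y S" "v \<in> S" "S \<subseteq> - E"
    using cantor_set_clopen_nbhd[OF Y.cantor] clopen_in_subset[OF clC] v by blast
  have "\<not> X.cohomologous (indicator G) (\<lambda>_. 0)" using X.indicator_cohomologous_zero[OF G(1)] G(2) by blast
  then have "\<forall>\<^sub>F W in Y.small_bases. X.class_le (\<lambda>x. int 2 * r (indicator W) x) (indicator G)"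
    by (intro eventually_multiple_indicator_le X.class_le_pointwise locally_const_indicator G(1)) simp_all
  then show ?thesis
    using Y.eventually_small_bases_subset[OF clopen_in_Int[OF clC S(1)] IntI[OF v S(2)]]
      Y.eventually_small_bases_base
  proof eventually_elim
    case (elim W)
    show ?case
    proof
      assume vW: "v \<in> W"
      then have sub: "W \<subseteq> C" "W \<inter> E = {}" using elim(2) S(3) by blast+
      have W: "clopen_in Y W" "W \<subset> C" using Y.base_clopen[OF elim(3)] vW sub c by (auto simp: E_def)
      have s': "if s x = v then x \<in> G else s x \<notin> W" if "x \<in> F" for x
        using sub(2) s(2) that by (auto simp: E_def)
      obtain \<kappa>' where "lift_of \<kappa>' (insert W (insert (C - W) (P - {C})))"
        "\<forall>x\<in>X. \<kappa>' x \<subseteq> \<kappa> x" "\<forall>x\<in>X. \<kappa>' x = W \<longrightarrow> x \<in> G" "\<forall>x\<in>F. s x \<in> \<kappa>' x"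
        using ex_localized_lift[OF \<kappa> P C W vW G(1,3) elim(1) F s(1) s'] by blast
      moreover have "W \<noteq> {}" using vW by blast
      ultimately show "\<exists>\<kappa>' P'. lift_of \<kappa>' P' \<and> clopen_partition Y P' \<and> refines Y P' P
          \<and> W \<in> P' \<and> (\<forall>x\<in>X. \<kappa>' x \<subseteq> \<kappa> x) \<and> (\<forall>x\<in>X. \<kappa>' x = W \<longrightarrow> x \<in> G) \<and> (\<forall>x\<in>F. s x \<in> \<kappa>' x)"
        using clopen_partition_split[OF P C W(1) _ W(2)] insertI1[of W "insert (C - W) (P - {C})"] by blast
    qed
  qed
qed

section \<open>Equivariant lifts and approximate conjugacies\<close>

definition column_count :: "'a set \<Rightarrow> 'a \<Rightarrow> 'b set \<Rightarrow> nat" where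
  "column_count B b C = nat (X.column_sum B (r (indicator C)) b)"

lemma sum_r_indicator:
  assumes P: "clopen_partition Y P"
  shows "X.cohomologous (\<lambda>x. \<Sum>C\<in>P. r (indicator C) x) (\<lambda>_. 1)"
proof -
  have lc: "locally_const Y (indicator C :: 'b \<Rightarrow> int)" if "C \<in> P" for C
    by (rule locally_const_indicator[OF clopen_partitionD(4)[OF P that]])
  have "X.cohomologous (\<lambda>x. \<Sum>C\<in>P. r (indicator C) x) (r (\<lambda>y. \<Sum>C\<in>P. indicator C y))"
    by (rule X.cohomologous_sym[OF r_sum]) (rule lc)
  also have "X.cohomologous \<dots> (r (\<lambda>_. 1))"
  proof (rule r_cong)
    show "locally_const Y (\<lambda>y. \<Sum>C\<in>P. indicator C y :: int)" by (intro locally_const_sum lc)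
    fix y assume "y \<in> Y"
    then obtain C where C: "C \<in> P" "y \<in> C" using clopen_partitionD(2)[OF P] by blast
    have "(\<Sum>D\<in>P. indicator D y) = (\<Sum>D\<in>P. if C = D then 1 else 0 :: int)"
      using C clopen_partitionD(6)[OF P] by (intro sum.cong) (auto simp: indicator_def)
    then show "(\<Sum>C\<in>P. indicator C y) = (1 :: int)" using clopen_partitionD(1)[OF P] C(1) by simp
  qed
  also note r_one
  finally show ?thesis .
qed

lemma eventually_column_count:
  assumes P: "Y.kakutani_rokhlin P U"
  shows "\<forall>\<^sub>F B in X.small_bases. \<forall>b\<in>B. (\<forall>C\<in>P. int (column_count B b C) = X.column_sum B (r (indicator C)) b)
    \<and> (\<forall>C\<in>P. \<not> \<beta> ` C \<subseteq> U \<longrightarrow> column_count B b (\<beta> ` C) = column_count B b C)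
    \<and> (\<Sum>C\<in>P. column_count B b C) = X.return_time B b"
proof -
  note part = Y.kr_partition[OF P]
  note fin = clopen_partitionD(1)[OF part] and clopen = clopen_partitionD(4)[OF part]
  have "\<forall>\<^sub>F B in X.small_bases. \<forall>b\<in>B. X.column_sum B (\<lambda>_. 0) b \<le> X.column_sum B (r (indicator C)) b"
    if "C \<in> P" for C
    by (rule X.eventually_column_sum_le[OF r_indicator_nonneg[OF clopen[OF that]]])
  then have "\<forall>\<^sub>F B in X.small_bases. \<forall>C\<in>P. \<forall>b\<in>B. 0 \<le> X.column_sum B (r (indicator C)) b"
    using fin by (simp add: eventually_ball_finite_distrib X.column_sum_def)
  moreover have "\<forall>\<^sub>F B in X.small_bases. \<forall>b\<in>B. X.column_sum B (r (indicator (\<beta> ` C))) b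
      = X.column_sum B (r (indicator C)) b" if "C \<in> P" for C
    by (rule X.eventually_column_sum_eq[OF r_indicator_image[OF clopen[OF that]]])
  then have "\<forall>\<^sub>F B in X.small_bases. \<forall>C\<in>P. \<forall>b\<in>B. X.column_sum B (r (indicator (\<beta> ` C))) b
      = X.column_sum B (r (indicator C)) b"
    using fin by (simp add: eventually_ball_finite_distrib)
  ultimately show ?thesis
    using X.eventually_column_sum_eq[OF sum_r_indicator[OF part]]
  proof eventually_elim
    case (elim B)
    have "(\<Sum>C\<in>P. column_count B b C) = X.return_time B b" if b: "b \<in> B" for b
    proof -
      have "int (\<Sum>C\<in>P. column_count B b C) = (\<Sum>C\<in>P. X.column_sum B (r (indicator C)) b)"
        using elim(1) b by (simp add: column_count_def)
      also have "\<dots> = X.column_sum B (\<lambda>x. \<Sum>C\<in>P. r (indicator C) x) b"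
        unfolding X.column_sum_def by (rule sum.swap)
      also have "\<dots> = int (X.return_time B b)" using elim(3) b by (simp add: X.column_sum_def)
      finally show ?thesis by (rule of_nat_eq_iff[THEN iffD1])
    qed
    moreover have "int (column_count B b C) = X.column_sum B (r (indicator C)) b" if "b \<in> B" "C \<in> P" for b C
      using elim(1) that by (simp add: column_count_def)
    moreover have "column_count B b (\<beta> ` C) = column_count B b C" if "b \<in> B" "C \<in> P" for b C
      using elim(2) that by (simp add: column_count_def)
    ultimately show ?case by blast
  qed
qed

lemma ex_column_words:
  assumes P: "Y.kakutani_rokhlin P U"
  shows "\<exists>B word. X.clopen_base B \<and> locally_const X word \<and> (\<forall>b\<in>B. length (word b) = X.return_time B b
    \<and> Y.tiling_word P U (column_count B b) (word b)
    \<and> (\<forall>C\<in>P. int (column_count B b C) = X.column_sum B (r (indicator C)) b))"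
proof -
  note fin = clopen_partitionD(1)[OF Y.kr_partition[OF P]]
  obtain x0 where x0: "x0 \<in> X" using X.nonempty by blast
  obtain B where B: "X.clopen_base B"
    and counts: "\<forall>b\<in>B. (\<forall>C\<in>P. int (column_count B b C) = X.column_sum B (r (indicator C)) b)
      \<and> (\<forall>C\<in>P. \<not> \<beta> ` C \<subseteq> U \<longrightarrow> column_count B b (\<beta> ` C) = column_count B b C)
      \<and> (\<Sum>C\<in>P. column_count B b C) = X.return_time B b"
    by (rule X.small_baseE[OF eventually_column_count[OF P] x0]) (rule that)
  define m where "m b = restrict (column_count B b) P" for b
  define word where "word b = (SOME cs. Y.tiling_word P U (m b) cs)" for b
  have "locally_const X (\<lambda>b. column_count B b C)" if "C \<in> P" for C
    unfolding column_count_def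
    by (intro locally_const_comp[where h=nat] X.locally_const_column_sum[OF B] r_locally_const
        locally_const_indicator clopen_partitionD(4)[OF Y.kr_partition[OF P] that])
  then have "locally_const X m"
    unfolding m_def[abs_def] by (rule locally_const_restrict[OF fin])
  then have lc: "locally_const X word" unfolding word_def[abs_def] by (rule locally_const_comp)
  have tiling: "Y.tiling_word P U (column_count B b) (word b)" if b: "b \<in> B" for b
  proof -
    have "Y.tiling_word P U (m b) (word b)"
      unfolding word_def
    proof (rule someI_ex, rule Y.ex_tiling_word[OF P])
      fix C assume "C \<in> P" "\<not> \<beta> ` C \<subseteq> U"
      then show "m b (\<beta> ` C) = m b C" using counts b Y.kr_image_in[OF P] by (simp add: m_def)
    qed
    then show ?thesis by (simp add: Y.tiling_word_def m_def)
  qed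
  have "length (word b) = X.return_time B b" if b: "b \<in> B" for b
  proof -
    have "length (word b) = (\<Sum>C\<in>P. count_list (word b) C)"
      using sum_count_set[of "word b" P] tiling[OF b] fin by (simp add: Y.tiling_word_def)
    also have "\<dots> = (\<Sum>C\<in>P. column_count B b C)"
      using tiling[OF b] by (intro sum.cong) (simp_all add: Y.tiling_word_def)
    finally show ?thesis using counts b by simp
  qed
  then show ?thesis using B lc tiling counts by blast
qed

context
  fixes B and word :: "'a \<Rightarrow> 'b set list"
  assumes B: "X.clopen_base B" and len: "b \<in> B \<Longrightarrow> length (word b) = X.return_time B b"
begin

lemma age_less_length: "x \<in> X \<Longrightarrow> X.age B x < length (word (X.foot B x))"
  using X.age_less_return_time[OF B] len[OF X.foot_in[OF B]] by simp

lemma lift_of_column_words: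
  assumes word: "locally_const X word" and P: "clopen_partition Y P"
    and words: "\<And>b. b \<in> B \<Longrightarrow> set (word b) \<subseteq> P"
    and count: "\<And>b C. b \<in> B \<Longrightarrow> C \<in> P \<Longrightarrow> int (count_list (word b) C) = X.column_sum B (r (indicator C)) b"
  shows "lift_of (\<lambda>x. word (X.foot B x) ! X.age B x) P" (is "lift_of ?\<kappa> P")
  unfolding lift_of_def
proof (intro conjI ballI)
  show lc: "locally_const X ?\<kappa>"
    by (rule X.locally_const_column[OF B]) (rule locally_const_comp[where h="(!)", OF word])
  show "?\<kappa> ` X \<subseteq> P"
    using nth_mem[OF age_less_length] words[OF X.foot_in[OF B]] by blast
  fix C assume C: "C \<in> P"
  show "X.cohomologous (indicator {x\<in>X. ?\<kappa> x = C}) (r (indicator C))"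
  proof (rule X.cohomologous_of_column_sum[OF B])
    show "locally_const X (indicator {x\<in>X. ?\<kappa> x = C} :: 'a \<Rightarrow> int)"
      by (rule locally_const_indicator[OF clopen_in_level[OF lc]])
    show "locally_const X (r (indicator C))"
      by (intro r_locally_const locally_const_indicator clopen_partitionD(4)[OF P C])
    fix b assume b: "b \<in> B"
    have "X.levels B {x\<in>X. ?\<kappa> x = C} b = {i. i < length (word b) \<and> C = word b ! i}"
      using X.age_foot_level[OF B b] X.base_in[OF B b] len[OF b] by (auto simp: X.levels_def)
    then have "card (X.levels B {x\<in>X. ?\<kappa> x = C} b) = count_list (word b) C"
      by (simp add: count_list_eq_length_filter length_filter_conv_card)
    then show "X.column_sum B (indicator {x\<in>X. ?\<kappa> x = C}) b = X.column_sum B (r (indicator C)) b"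
      using count[OF b C] by (simp add: X.column_sum_indicator[OF B])
  qed
qed

lemma follows_column_words:
  assumes tiling: "\<And>b. b \<in> B \<Longrightarrow> Y.tiling_word P U (m b) (word b)" and x: "x \<in> X"
  shows "Y.follows U (word (X.foot B x) ! X.age B x) (word (X.foot B (\<alpha> x)) ! X.age B (\<alpha> x))"
proof (cases "\<alpha> x \<in> B")
  case True
  have ne: "word (\<alpha> x) \<noteq> []" "word (X.foot B x) \<noteq> []"
    using len[OF True] age_less_length[OF x] X.return_time_pos[of B "\<alpha> x"] by auto
  have "Suc (X.age B x) = length (word (X.foot B x))"
    using X.base_succ_iff[OF B x] True len[OF X.foot_in[OF B x]] by simp
  then have "X.age B x = length (word (X.foot B x)) - 1" by simp
  then have "word (X.foot B x) ! X.age B x = last (word (X.foot B x))"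
    "word (X.foot B (\<alpha> x)) ! X.age B (\<alpha> x) = hd (word (\<alpha> x))"
    using ne X.age_base[OF B True] by (simp_all add: last_conv_nth hd_conv_nth)
  then show ?thesis
    using tiling[OF X.foot_in[OF B x]] tiling[OF True] ne by (simp add: Y.follows_iff Y.tiling_word_def)
next
  case False
  have "successively (Y.follows U) (word (X.foot B x))"
    using tiling[OF X.foot_in[OF B x]] by (simp add: Y.tiling_word_def)
  moreover have "Suc (X.age B x) < length (word (X.foot B x))"
    using age_less_length[OF X.\<alpha>_in[OF x]] X.age_foot_succ[OF B x False] by simp
  ultimately show ?thesis
    using X.age_foot_succ[OF B x False] by (simp add: successively_conv_nth)
qed

end

lemma ex_equivariant_lift:
  assumes P: "Y.kakutani_rokhlin P U"
  shows "\<exists>\<kappa>. lift_of \<kappa> P \<and> (\<forall>x\<in>X. Y.follows U (\<kappa> x) (\<kappa> (\<alpha> x)))"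
proof -
  obtain B word where B: "X.clopen_base B" and word: "locally_const X word"
    and words: "\<forall>b\<in>B. length (word b) = X.return_time B b
      \<and> Y.tiling_word P U (column_count B b) (word b)
      \<and> (\<forall>C\<in>P. int (column_count B b C) = X.column_sum B (r (indicator C)) b)"
    using ex_column_words[OF P] by blast
  have len: "length (word b) = X.return_time B b" and tiling: "Y.tiling_word P U (column_count B b) (word b)"
    if "b \<in> B" for b using words that by blast+
  have "set (word b) \<subseteq> P" if "b \<in> B" for b using tiling[OF that] by (simp add: Y.tiling_word_def)
  moreover have "int (count_list (word b) C) = X.column_sum B (r (indicator C)) b" if "b \<in> B" "C \<in> P" for b C
    using tiling words that by (simp add: Y.tiling_word_def)
  ultimately have "lift_of (\<lambda>x. word (X.foot B x) ! X.age B x) P"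
    by (intro lift_of_column_words[OF B len word Y.kr_partition[OF P]])
  then show ?thesis using follows_column_words[OF B len tiling] by blast
qed

lemma ex_approximate_conjugacy:
  assumes e: "e > 0"
  shows "\<exists>\<sigma> \<tau>. homeomorphism X Y \<sigma> \<tau> \<and> (\<forall>x\<in>X. dist (\<sigma> (\<alpha> x)) (\<beta> (\<sigma> x)) < e)
    \<and> (\<forall>f. locally_const Y f \<longrightarrow> (\<forall>y\<in>Y. \<forall>z\<in>Y. dist y z < e \<longrightarrow> f y = f z) \<longrightarrow> X.cohomologous (f \<circ> \<sigma>) (r f))"
proof -
  obtain y0 where y0: "y0 \<in> Y" using Y.nonempty by blast
  obtain U where U: "Y.clopen_base U" and small_U: "diam_less e U"
    by (rule Y.small_baseE[OF Y.eventually_small_bases_diameter[OF e] y0]) (rule that)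
  have "clopen_partition Y {Y}" using Y.nonempty by (intro clopen_partitionI) auto
  then obtain P where P: "Y.kakutani_rokhlin P U" and small: "\<forall>C\<in>P. diam_less e C"
    using Y.ex_kr_refining[OF U _ e] by blast
  obtain \<kappa> where \<kappa>: "lift_of \<kappa> P" and follows: "\<forall>x\<in>X. Y.follows U (\<kappa> x) (\<kappa> (\<alpha> x))"
    using ex_equivariant_lift[OF P] by blast
  note part = Y.kr_partition[OF P]
  obtain \<sigma> \<tau> where \<sigma>: "homeomorphism X Y \<sigma> \<tau>" "\<forall>x\<in>X. \<sigma> x \<in> \<kappa> x"
    using homeomorphism_of_partition_map[OF X.cantor Y.cantor lift_partition_map[OF \<kappa> part]] by blast
  have "dist (\<sigma> (\<alpha> x)) (\<beta> (\<sigma> x)) < e" if x: "x \<in> X" for x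
  proof -
    have \<sigma>x: "\<sigma> x \<in> \<kappa> x" "\<sigma> (\<alpha> x) \<in> \<kappa> (\<alpha> x)" using \<sigma>(2) x by auto
    have "Y.follows U (\<kappa> x) (\<kappa> (\<alpha> x))" using follows x by blast
    then consider (roof) "\<beta> ` \<kappa> x \<subseteq> U" "\<kappa> (\<alpha> x) \<subseteq> U" | (below) "\<kappa> (\<alpha> x) = \<beta> ` \<kappa> x"
      by (auto simp: Y.follows_iff split: if_splits)
    then show ?thesis
    proof cases
      case roof
      then show ?thesis using \<sigma>x small_U imageI[OF \<sigma>x(1), of \<beta>] by blast
    next
      case below
      then show ?thesis using \<sigma>x small lift_in[OF \<kappa> X.\<alpha>_in[OF x]] imageI[OF \<sigma>x(1), of \<beta>] by blast
    qed
  qed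
  moreover have "X.cohomologous (f \<circ> \<sigma>) (r f)"
    if f: "locally_const Y f" and const: "\<forall>y\<in>Y. \<forall>z\<in>Y. dist y z < e \<longrightarrow> f y = f z" for f
  proof (rule cohomologous_comp_lift[OF \<kappa> part f])
    show "\<forall>C\<in>P. const_on f C"
    proof (intro ballI)
      fix C y z assume "C \<in> P" "y \<in> C" "z \<in> C"
      then have "y \<in> Y" "z \<in> Y" "dist y z < e" using small clopen_partitionD(5)[OF part] by blast+
      then show "f y = f z" using const by blast
    qed
  qed (use \<sigma>(2) in blast)
  ultimately show ?thesis using \<sigma>(1) by blast
qed

lemma ex_approximate_conjugacies:
  "\<exists>\<sigma>. (\<forall>n. \<exists>\<tau>. homeomorphism X Y (\<sigma> n) \<tau>)
    \<and> uniform_limit Y (\<lambda>n y. \<sigma> n (\<alpha> (inv_into X (\<sigma> n) y))) \<beta> sequentially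
    \<and> (\<forall>f. cont_int Y f \<longrightarrow> (\<exists>c N. \<forall>n\<ge>N. k0_class X \<alpha> (f \<circ> \<sigma> n) = c))"
proof -
  define e where "e n = inverse (real (Suc n))" for n
  have e_pos: "e n > 0" for n by (simp add: e_def)
  have e_small: "\<forall>\<^sub>F n in sequentially. e n < d" if "d > 0" for d
    using order_tendstoD(2)[OF LIMSEQ_inverse_real_of_nat that] by (simp add: e_def)
  obtain \<sigma> where \<sigma>: "\<And>n. \<exists>\<tau>. homeomorphism X Y (\<sigma> n) \<tau>"
    and near: "\<And>n x. x \<in> X \<Longrightarrow> dist (\<sigma> n (\<alpha> x)) (\<beta> (\<sigma> n x)) < e n"
    and coh: "\<And>n f. locally_const Y f \<Longrightarrow> (\<forall>y\<in>Y. \<forall>z\<in>Y. dist y z < e n \<longrightarrow> f y = f z) \<Longrightarrow> X.cohomologous (f \<circ> \<sigma> n) (r f)"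
    using ex_approximate_conjugacy[OF e_pos] by metis
  have onto: "\<sigma> n ` X = Y" and cont: "continuous_on X (\<sigma> n)" for n
    using \<sigma>[of n] by (auto simp: homeomorphism_def)
  have lim: "uniform_limit Y (\<lambda>n y. \<sigma> n (\<alpha> (inv_into X (\<sigma> n) y))) \<beta> sequentially"
  proof (rule uniform_limitI)
    fix d :: real assume "d > 0"
    from e_small[OF this] show "\<forall>\<^sub>F n in sequentially. \<forall>y\<in>Y. dist (\<sigma> n (\<alpha> (inv_into X (\<sigma> n) y))) (\<beta> y) < d"
    proof eventually_elim
      case (elim n)
      have "dist (\<sigma> n (\<alpha> (inv_into X (\<sigma> n) y))) (\<beta> y) < d" if "y \<in> \<sigma> n ` X" for y
        using near[OF inv_into_into[OF that], of n] f_inv_into_f[OF that] elim by simp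
      then show ?case using onto[of n] by blast
    qed
  qed
  have "\<exists>c N. \<forall>n\<ge>N. k0_class X \<alpha> (f \<circ> \<sigma> n) = c" if "cont_int Y f" for f
  proof -
    have f: "locally_const Y f" using that by (simp add: cont_int_iff)
    obtain d where d: "d > 0" "\<forall>y\<in>Y. \<forall>z\<in>Y. dist y z < d \<longrightarrow> f y = f z"
      using locally_const_uniform[OF Y.compact_X f] by blast
    obtain N where N: "\<forall>n\<ge>N. e n < d" using e_small[OF d(1)] unfolding eventually_sequentially by blast
    have "k0_class X \<alpha> (f \<circ> \<sigma> n) = k0_class X \<alpha> (r f)" if "n \<ge> N" for n
    proof -
      have "\<forall>y\<in>Y. \<forall>z\<in>Y. dist y z < e n \<longrightarrow> f y = f z" using d(2) N that less_trans by metis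
      then have "X.cohomologous (f \<circ> \<sigma> n) (r f)" by (rule coh[OF f])
      moreover have "locally_const X (\<lambda>x. f (\<sigma> n x))"
        by (rule locally_const_compose[OF f cont]) (simp add: onto)
      ultimately show ?thesis using X.k0_class_eq[of "f \<circ> \<sigma> n" "r f"] by (simp add: comp_def)
    qed
    then show ?thesis by blast
  qed
  then show ?thesis using \<sigma> lim by blast
qed

section \<open>Lifts of towers\<close>

definition tower_lift :: "'b set set \<Rightarrow> 'b set \<Rightarrow> ('a \<Rightarrow> 'b set) \<Rightarrow> ('a \<Rightarrow> 'a) \<Rightarrow> bool" where
  "tower_lift P U \<kappa> \<gamma> \<longleftrightarrow> Y.kakutani_rokhlin P U \<and> lift_of \<kappa> P \<and> X.piecewise_power \<gamma>
     \<and> (\<forall>x\<in>X. Y.follows U (\<kappa> x) (\<kappa> (\<gamma> x)))"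

definition height :: "'b set \<Rightarrow> ('a \<Rightarrow> 'b set) \<Rightarrow> 'a \<Rightarrow> nat" where
  "height U \<kappa> x = Y.age U (SOME y. y \<in> \<kappa> x)"

definition tower_root :: "'b set \<Rightarrow> ('a \<Rightarrow> 'b set) \<Rightarrow> ('a \<Rightarrow> 'a) \<Rightarrow> 'a \<Rightarrow> 'a" where
  "tower_root U \<kappa> \<gamma> x = (inv_into X \<gamma> ^^ height U \<kappa> x) x"

text \<open>A lift refined over the base is carried up the towers along \<open>\<gamma>\<close>, so that it stays equivariant
  below the roof.\<close>

definition push :: "'b set \<Rightarrow> ('a \<Rightarrow> 'b set) \<Rightarrow> ('a \<Rightarrow> 'a) \<Rightarrow> ('a \<Rightarrow> 'b set) \<Rightarrow> 'a \<Rightarrow> 'b set" where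
  "push U \<kappa> \<gamma> \<kappa>0 x = Y.T (int (height U \<kappa> x)) ` \<kappa>0 (tower_root U \<kappa> \<gamma> x)"

lemma
  assumes "tower_lift P U \<kappa> \<gamma>"
  shows tower_kr: "Y.kakutani_rokhlin P U"
    and tower_lift_of: "lift_of \<kappa> P"
    and tower_power: "X.piecewise_power \<gamma>"
    and tower_follows: "x \<in> X \<Longrightarrow> Y.follows U (\<kappa> x) (\<kappa> (\<gamma> x))"
  using assms by (simp_all add: tower_lift_def)

context
  fixes P U \<kappa> \<gamma> assumes tower: "tower_lift P U \<kappa> \<gamma>"
begin

lemma tower_in: "x \<in> X \<Longrightarrow> \<kappa> x \<in> P"
  by (rule lift_in[OF tower_lift_of[OF tower]])

lemma tower_subset: "x \<in> X \<Longrightarrow> \<kappa> x \<subseteq> Y"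
  by (rule Y.kr_subset[OF tower_kr[OF tower] tower_in])

lemma tower_obtains_point:
  assumes "x \<in> X"
  obtains y where "y \<in> \<kappa> x" "y \<in> Y"
  using Y.kr_nonempty[OF tower_kr[OF tower] tower_in[OF assms]] tower_subset[OF assms] by blast

lemma tower_atom_eq: "x \<in> X \<Longrightarrow> C \<in> P \<Longrightarrow> y \<in> C \<Longrightarrow> y \<in> \<kappa> x \<Longrightarrow> \<kappa> x = C"
  using clopen_partitionD(6)[OF Y.kr_partition[OF tower_kr[OF tower]]] tower_in by blast

lemma tower_map_in: "x \<in> X \<Longrightarrow> \<gamma> x \<in> X" and tower_inv_in: "x \<in> X \<Longrightarrow> inv_into X \<gamma> x \<in> X"
  and tower_inv_cancel: "x \<in> X \<Longrightarrow> \<gamma> (inv_into X \<gamma> x) = x" "x \<in> X \<Longrightarrow> inv_into X \<gamma> (\<gamma> x) = x"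
  using X.piecewise_power_in X.piecewise_power_inv_in X.piecewise_power_inv_cancel tower_power[OF tower] by blast+

lemma tower_funpow_in: "x \<in> X \<Longrightarrow> (\<gamma> ^^ n) x \<in> X"
  by (induction n) (auto intro: tower_map_in)

lemma tower_succ: "x \<in> X \<Longrightarrow> \<not> \<beta> ` \<kappa> x \<subseteq> U \<Longrightarrow> \<kappa> (\<gamma> x) = \<beta> ` \<kappa> x"
  using tower_follows[OF tower] by (simp add: Y.follows_iff)

lemma tower_succ_base_iff: "x \<in> X \<Longrightarrow> \<kappa> (\<gamma> x) \<subseteq> U \<longleftrightarrow> \<beta> ` \<kappa> x \<subseteq> U"
  using tower_follows[OF tower, of x] by (auto simp: Y.follows_iff split: if_splits)

lemma tower_meets_base: "x \<in> X \<Longrightarrow> y \<in> \<kappa> x \<Longrightarrow> y \<in> U \<Longrightarrow> \<kappa> x \<subseteq> U"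
  by (rule Y.kr_meets_base[OF tower_kr[OF tower] tower_in])

lemma tower_meets_roof: "x \<in> X \<Longrightarrow> y \<in> \<kappa> x \<Longrightarrow> \<beta> y \<in> U \<Longrightarrow> \<beta> ` \<kappa> x \<subseteq> U"
  by (rule Y.kr_image_meets_base[OF tower_kr[OF tower] tower_in])

lemma height_eq:
  assumes "x \<in> X" "y \<in> \<kappa> x"
  shows "height U \<kappa> x = Y.age U y"
  unfolding height_def
  by (rule Y.kr_age_eq[OF tower_kr[OF tower] tower_in[OF assms(1)] someI[of "\<lambda>y. y \<in> \<kappa> x"]]) (rule assms(2))+

lemma height_root_base:
  assumes x: "x \<in> X" "\<kappa> x \<subseteq> U"
  shows "height U \<kappa> x = 0" "tower_root U \<kappa> \<gamma> x = x"
proof -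
  obtain y where y: "y \<in> \<kappa> x" by (rule tower_obtains_point[OF x(1)])
  then have "Y.age U y = 0" using Y.age_base(1)[OF Y.kr_base[OF tower_kr[OF tower]]] x(2) by blast
  then show "height U \<kappa> x = 0" using height_eq[OF x(1) y] by simp
  then show "tower_root U \<kappa> \<gamma> x = x" by (simp add: tower_root_def)
qed

lemma height_root_succ:
  assumes x: "x \<in> X" "\<not> \<beta> ` \<kappa> x \<subseteq> U"
  shows "height U \<kappa> (\<gamma> x) = Suc (height U \<kappa> x)" "tower_root U \<kappa> \<gamma> (\<gamma> x) = tower_root U \<kappa> \<gamma> x"
proof -
  obtain y where y: "y \<in> \<kappa> x" "y \<in> Y" by (rule tower_obtains_point[OF x(1)])
  have "\<beta> y \<in> \<kappa> (\<gamma> x)" using tower_succ[OF x] y(1) by blast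
  moreover have "\<beta> y \<notin> U" using tower_meets_roof[OF x(1) y(1)] x(2) by blast
  ultimately show h: "height U \<kappa> (\<gamma> x) = Suc (height U \<kappa> x)"
    using height_eq[OF tower_map_in[OF x(1)]] height_eq[OF x(1) y(1)]
      Y.age_foot_succ(1)[OF Y.kr_base[OF tower_kr[OF tower]] y(2)] by simp
  show "tower_root U \<kappa> \<gamma> (\<gamma> x) = tower_root U \<kappa> \<gamma> x"
    unfolding tower_root_def h using tower_inv_cancel(2)[OF x(1)] by (simp add: funpow_swap1)
qed

lemma tower_induct [consumes 1, case_names base step]:
  assumes "x \<in> X"
    and base: "\<And>x. x \<in> X \<Longrightarrow> \<kappa> x \<subseteq> U \<Longrightarrow> Q x"
    and step: "\<And>x. x \<in> X \<Longrightarrow> \<not> \<beta> ` \<kappa> x \<subseteq> U \<Longrightarrow> Q x \<Longrightarrow> Q (\<gamma> x)"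
  shows "Q x"
  using assms(1)
proof (induction "height U \<kappa> x" arbitrary: x)
  case 0
  obtain y where y: "y \<in> \<kappa> x" "y \<in> Y" by (rule tower_obtains_point[OF 0(2)])
  have "Y.age U y = 0" using height_eq[OF 0(2) y(1)] 0(1) by simp
  then have "y \<in> U" using Y.age_eq_0[OF Y.kr_base[OF tower_kr[OF tower]] y(2)] by simp
  then show ?case using base[OF 0(2)] tower_meets_base[OF 0(2) y(1)] by blast
next
  case (Suc n)
  define w where "w = inv_into X \<gamma> x"
  have w: "w \<in> X" "\<gamma> w = x" using tower_inv_in tower_inv_cancel(1) Suc.prems by (auto simp: w_def)
  have "\<not> \<kappa> x \<subseteq> U" using height_root_base(1)[OF Suc.prems] Suc.hyps(2) by auto
  then have "\<not> \<beta> ` \<kappa> w \<subseteq> U" using tower_succ_base_iff[OF w(1)] w(2) by simp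
  then show ?case using step[OF w(1)] Suc.hyps height_root_succ(1)[OF w(1)] w by simp
qed

lemma root_in: "x \<in> X \<Longrightarrow> tower_root U \<kappa> \<gamma> x \<in> X"
  by (induction rule: tower_induct) (simp_all add: height_root_base height_root_succ)

lemma funpow_root: "x \<in> X \<Longrightarrow> (\<gamma> ^^ height U \<kappa> x) (tower_root U \<kappa> \<gamma> x) = x"
  by (induction rule: tower_induct) (simp_all add: height_root_base height_root_succ)

lemma root_base: "x \<in> X \<Longrightarrow> \<kappa> (tower_root U \<kappa> \<gamma> x) \<subseteq> U"
  by (induction rule: tower_induct) (simp_all add: height_root_base height_root_succ)

lemma tower_eq_image_root: "x \<in> X \<Longrightarrow> \<kappa> x = Y.T (int (height U \<kappa> x)) ` \<kappa> (tower_root U \<kappa> \<gamma> x)"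
proof (induction rule: tower_induct)
  case (step x)
  have "\<kappa> (\<gamma> x) = \<beta> ` (Y.T (int (height U \<kappa> x)) ` \<kappa> (tower_root U \<kappa> \<gamma> x))"
    using tower_succ[OF step(1,2)] step(3) by simp
  also have "\<dots> = Y.T (int (height U \<kappa> x) + 1) ` \<kappa> (tower_root U \<kappa> \<gamma> x)"
    by (rule Y.T_image_succ[OF tower_subset[OF root_in[OF step(1)]]])
  finally show ?case using height_root_succ[OF step(1,2)] by (simp add: add.commute)
qed (simp add: height_root_base)

lemma foot_in_root:
  assumes "x \<in> X" "y \<in> \<kappa> x"
  shows "Y.foot U y \<in> \<kappa> (tower_root U \<kappa> \<gamma> x)"
proof -
  obtain w where w: "w \<in> \<kappa> (tower_root U \<kappa> \<gamma> x)" "y = Y.T (int (height U \<kappa> x)) w"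
    using tower_eq_image_root[OF assms(1)] assms(2) by blast
  then have "Y.T (- int (height U \<kappa> x)) y = w" using tower_subset[OF root_in[OF assms(1)]] by auto
  then have "Y.foot U y = w" using height_eq[OF assms] by (simp add: Y.foot_def)
  then show ?thesis using w(1) by simp
qed

lemma tower_ascend:
  assumes x: "x \<in> X" and y: "y \<in> \<kappa> x" and "\<And>j. 0 < j \<Longrightarrow> j \<le> n \<Longrightarrow> Y.T (int j) y \<notin> U"
  shows "Y.T (int n) y \<in> \<kappa> ((\<gamma> ^^ n) x)" "\<forall>j<n. \<not> \<beta> ` \<kappa> ((\<gamma> ^^ j) x) \<subseteq> U"
proof -
  have yY: "y \<in> Y" using tower_subset[OF x] y by blast
  have "Y.T (int n) y \<in> \<kappa> ((\<gamma> ^^ n) x) \<and> (\<forall>j<n. \<not> \<beta> ` \<kappa> ((\<gamma> ^^ j) x) \<subseteq> U)"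
    using assms(3)
  proof (induction n)
    case (Suc n)
    then have IH: "Y.T (int n) y \<in> \<kappa> ((\<gamma> ^^ n) x)" "\<forall>j<n. \<not> \<beta> ` \<kappa> ((\<gamma> ^^ j) x) \<subseteq> U" by simp_all
    have "\<beta> (Y.T (int n) y) \<notin> U" using Suc.prems[of "Suc n"] Y.T_Suc[OF yY] by simp
    then have roof: "\<not> \<beta> ` \<kappa> ((\<gamma> ^^ n) x) \<subseteq> U" using IH(1) by blast
    then have "Y.T (int (Suc n)) y \<in> \<kappa> ((\<gamma> ^^ Suc n) x)"
      using tower_succ[OF tower_funpow_in[OF x] roof] IH(1) Y.T_Suc[OF yY] by simp
    then show ?case using IH(2) roof less_Suc_eq by auto
  qed (use y in simp)
  then show "Y.T (int n) y \<in> \<kappa> ((\<gamma> ^^ n) x)" "\<forall>j<n. \<not> \<beta> ` \<kappa> ((\<gamma> ^^ j) x) \<subseteq> U" by simp_all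
qed

lemma no_roof_below_height:
  assumes z: "z \<in> X" and x: "x \<in> X" "\<kappa> x = \<kappa> (tower_root U \<kappa> \<gamma> z)" and j: "j < height U \<kappa> z"
  shows "\<not> \<beta> ` \<kappa> ((\<gamma> ^^ j) x) \<subseteq> U"
proof -
  obtain y where y: "y \<in> \<kappa> z" "y \<in> Y" by (rule tower_obtains_point[OF z])
  have "height U \<kappa> z < Y.return_time U (Y.foot U y)"
    using Y.age_less_return_time[OF Y.kr_base[OF tower_kr[OF tower]] y(2)] height_eq[OF z y(1)] by simp
  then have "Y.T (int i) (Y.foot U y) \<notin> U" if "0 < i" "i \<le> height U \<kappa> z" for i
    using Y.not_in_before_return[OF that(1)] that(2) by simp
  moreover have "Y.foot U y \<in> \<kappa> x" using foot_in_root[OF z y(1)] x(2) by simp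
  ultimately show ?thesis using tower_ascend(2)[OF x(1)] j by blast
qed

lemma locally_const_push:
  assumes "locally_const X \<kappa>0"
  shows "locally_const X (push U \<kappa> \<gamma> \<kappa>0)"
proof -
  have "locally_const X (\<lambda>x. Y.T (int h) ` \<kappa>0 ((inv_into X \<gamma> ^^ h) x))" for h
    by (rule locally_const_comp[OF X.locally_const_piecewise_power[OF
            X.piecewise_power_funpow[OF X.piecewise_power_inv[OF tower_power[OF tower]]] assms]])
  moreover have "locally_const X (height U \<kappa>)"
    unfolding height_def[abs_def] by (rule locally_const_comp[OF lift_locally_const[OF tower_lift_of[OF tower]]])
  ultimately show ?thesis
    unfolding push_def[abs_def] tower_root_def by (rule locally_const_select[rotated])
qed

lemma push_base: "x \<in> X \<Longrightarrow> \<kappa> x \<subseteq> U \<Longrightarrow> push U \<kappa> \<gamma> \<kappa>0 x = \<kappa>0 x"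
  by (simp add: push_def height_root_base)

context
  fixes \<kappa>0 P'
  assumes \<kappa>0: "lift_of \<kappa>0 P'" and P': "Y.kakutani_rokhlin P' U" and sub: "x \<in> X \<Longrightarrow> \<kappa>0 x \<subseteq> \<kappa> x"
begin

lemma push_succ:
  assumes "x \<in> X" "\<not> \<beta> ` \<kappa> x \<subseteq> U"
  shows "push U \<kappa> \<gamma> \<kappa>0 (\<gamma> x) = \<beta> ` push U \<kappa> \<gamma> \<kappa>0 x"
proof -
  have "\<kappa>0 (tower_root U \<kappa> \<gamma> x) \<subseteq> Y" using sub[OF root_in] tower_subset[OF root_in] assms(1) by blast
  then show ?thesis using height_root_succ[OF assms] by (simp add: push_def Y.T_image_succ add.commute)
qed

lemma push_subset: "x \<in> X \<Longrightarrow> push U \<kappa> \<gamma> \<kappa>0 x \<subseteq> \<kappa> x"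
  unfolding push_def using tower_eq_image_root[of x] sub[OF root_in] by blast

lemma push_in: "x \<in> X \<Longrightarrow> push U \<kappa> \<gamma> \<kappa>0 x \<in> P'"
proof (induction rule: tower_induct)
  case (base x)
  then show ?case using lift_in[OF \<kappa>0] by (simp add: push_base)
next
  case (step x)
  obtain y where y: "y \<in> push U \<kappa> \<gamma> \<kappa>0 x" using Y.kr_nonempty[OF P' step(3)] by blast
  then have "\<beta> y \<notin> U" using tower_meets_roof[OF step(1)] push_subset[OF step(1)] step(2) by blast
  then have "\<not> \<beta> ` push U \<kappa> \<gamma> \<kappa>0 x \<subseteq> U" using y by blast
  then show ?case using push_succ[OF step(1,2)] Y.kr_image_in[OF P' step(3)] by simp
qed

lemma push_level_base:
  assumes D: "D \<in> P'" "D \<subseteq> U"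
  shows "{x\<in>X. push U \<kappa> \<gamma> \<kappa>0 x = D} = {x\<in>X. \<kappa>0 x = D}"
proof -
  obtain y where y: "y \<in> D" using Y.kr_nonempty[OF P' D(1)] by blast
  have "push U \<kappa> \<gamma> \<kappa>0 x = D \<longleftrightarrow> \<kappa>0 x = D" if x: "x \<in> X" for x
  proof (cases "\<kappa> x \<subseteq> U")
    case True
    then show ?thesis using push_base[OF x] by simp
  next
    case False
    then have "y \<notin> \<kappa> x" using tower_meets_base[OF x] y D(2) by blast
    then show ?thesis using push_subset[OF x] sub[OF x] y by blast
  qed
  then show ?thesis by blast
qed

lemma push_level_step:
  assumes D: "D \<in> P'" "\<not> \<beta> ` D \<subseteq> U"
  shows "{x\<in>X. push U \<kappa> \<gamma> \<kappa>0 x = \<beta> ` D} = \<gamma> ` {x\<in>X. push U \<kappa> \<gamma> \<kappa>0 x = D}"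
proof -
  have roof: "\<not> \<beta> ` \<kappa> x \<subseteq> U" if "x \<in> X" "push U \<kappa> \<gamma> \<kappa>0 x = D" for x
    using push_subset[OF that(1)] that(2) D(2) by blast
  show ?thesis
  proof (intro equalityI subsetI)
    fix w assume "w \<in> {x\<in>X. push U \<kappa> \<gamma> \<kappa>0 x = \<beta> ` D}"
    then have w: "w \<in> X" "push U \<kappa> \<gamma> \<kappa>0 w = \<beta> ` D" by auto
    define x where "x = inv_into X \<gamma> w"
    have x: "x \<in> X" "\<gamma> x = w" using tower_inv_in tower_inv_cancel(1) w(1) by (auto simp: x_def)
    have "\<not> \<kappa> w \<subseteq> U" using push_subset[OF w(1)] w(2) D(2) by blast
    then have "\<not> \<beta> ` \<kappa> x \<subseteq> U" using tower_succ_base_iff[OF x(1)] x(2) by simp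
    then have "\<beta> ` push U \<kappa> \<gamma> \<kappa>0 x = \<beta> ` D" using push_succ[OF x(1)] x(2) w(2) by simp
    then have "push U \<kappa> \<gamma> \<kappa>0 x = D"
      using Y.\<alpha>_image_eq_iff Y.kr_subset[OF P' push_in[OF x(1)]] Y.kr_subset[OF P' D(1)] by blast
    then show "w \<in> \<gamma> ` {x\<in>X. push U \<kappa> \<gamma> \<kappa>0 x = D}" using x by blast
  next
    fix w assume "w \<in> \<gamma> ` {x\<in>X. push U \<kappa> \<gamma> \<kappa>0 x = D}"
    then obtain x where x: "x \<in> X" "push U \<kappa> \<gamma> \<kappa>0 x = D" "w = \<gamma> x" by blast
    then show "w \<in> {x\<in>X. push U \<kappa> \<gamma> \<kappa>0 x = \<beta> ` D}"
      using push_succ[OF x(1) roof[OF x(1,2)]] tower_map_in by simp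
  qed
qed

lemma lift_of_push: "lift_of (push U \<kappa> \<gamma> \<kappa>0) P'"
proof -
  note clopen = clopen_in_level[OF locally_const_push[OF lift_locally_const[OF \<kappa>0]]]
  have "X.cohomologous (indicator {x\<in>X. push U \<kappa> \<gamma> \<kappa>0 x = C}) (r (indicator C))" if "C \<in> P'" for C
    using P' that
  proof (induction rule: Y.kr_induct)
    case (base C)
    then show ?case using lift_class[OF \<kappa>0] push_level_base by simp
  next
    case (step D)
    have "X.cohomologous (indicator (\<gamma> ` {x\<in>X. push U \<kappa> \<gamma> \<kappa>0 x = D})) (indicator {x\<in>X. push U \<kappa> \<gamma> \<kappa>0 x = D})"
      by (rule X.cohomologous_sym[OF X.cohomologous_piecewise_power_image[OF tower_power[OF tower] clopen]])
    also note step(3)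
    also have "X.cohomologous (r (indicator D)) (r (indicator (\<beta> ` D)))"
      by (rule X.cohomologous_sym[OF r_indicator_image[OF clopen_partitionD(4)[OF Y.kr_partition[OF P'] step(1)]]])
    finally show ?case using push_level_step[OF step(1,2)] by simp
  qed
  then show ?thesis
    unfolding lift_of_def using locally_const_push[OF lift_locally_const[OF \<kappa>0]] push_in by blast
qed

end

lemma image_roof: "\<gamma> ` {x\<in>X. \<beta> ` \<kappa> x \<subseteq> U} = {x\<in>X. \<kappa> x \<subseteq> U}"
proof (intro equalityI subsetI)
  fix x assume "x \<in> {x\<in>X. \<kappa> x \<subseteq> U}"
  then have "inv_into X \<gamma> x \<in> {x\<in>X. \<beta> ` \<kappa> x \<subseteq> U}" "x = \<gamma> (inv_into X \<gamma> x)"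
    using tower_inv_in tower_inv_cancel(1)[of x] tower_succ_base_iff[of "inv_into X \<gamma> x"] by auto
  then show "x \<in> \<gamma> ` {x\<in>X. \<beta> ` \<kappa> x \<subseteq> U}" by blast
qed (use tower_map_in tower_succ_base_iff in auto)

lemma cohomologous_roof_base:
  assumes \<kappa>': "lift_of \<kappa>' P'" and P': "Y.kakutani_rokhlin P' U" "Y.kakutani_rokhlin P' U'"
    and sub: "\<And>x. x \<in> X \<Longrightarrow> \<kappa>' x \<subseteq> \<kappa> x"
  shows "X.cohomologous (indicator {x\<in>X. \<beta> ` \<kappa> x \<subseteq> U \<and> Y.collapse U' (\<beta> ` \<kappa>' x) = l})
    (indicator {x\<in>X. \<kappa> x \<subseteq> U \<and> Y.collapse U' (\<kappa>' x) = l})" (is "X.cohomologous ?roof ?base")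
proof -
  note part = Y.kr_partition[OF P'(1)]
  obtain L where L: "\<And>C y. C \<in> P' \<Longrightarrow> y \<in> C \<Longrightarrow> L y = Y.collapse U' C"
    "\<And>C y. C \<in> P' \<Longrightarrow> y \<in> C \<Longrightarrow> L (\<beta> y) = Y.collapse U' (\<beta> ` C)"
    by (rule Y.ex_collapse_label[OF P'(2)]) (rule that)
  define f :: "'b \<Rightarrow> int" where "f y = of_bool (y \<in> U \<and> L y = l)" for y
  have f: "f y = of_bool (C \<subseteq> U \<and> Y.collapse U' C = l)"
    and f\<beta>: "f (\<beta> y) = of_bool (\<beta> ` C \<subseteq> U \<and> Y.collapse U' (\<beta> ` C) = l)" if "C \<in> P'" "y \<in> C" for C y
    using Y.kr_meets_base[OF P'(1) that] Y.kr_image_meets_base[OF P'(1) that] that L[OF that]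
    by (auto simp: f_def)
  have const: "\<forall>C\<in>P'. const_on f C" and const\<beta>: "\<forall>C\<in>P'. \<forall>y\<in>C. \<forall>z\<in>C. f (\<beta> y) = f (\<beta> z)"
    by (intro ballI, simp only: f f\<beta>)+
  note lc = locally_const_partition[OF part const] and lc\<beta> = locally_const_partition[OF part const\<beta>]
  define s where "s x = (SOME y. y \<in> \<kappa>' x)" for x
  have s: "s x \<in> \<kappa>' x" if "x \<in> X" for x
    unfolding s_def using clopen_partitionD(3)[OF part lift_in[OF \<kappa>' that]] by (simp add: some_in_eq)
  have base_iff: "\<kappa> x \<subseteq> U \<longleftrightarrow> \<kappa>' x \<subseteq> U" and roof_iff: "\<beta> ` \<kappa> x \<subseteq> U \<longleftrightarrow> \<beta> ` \<kappa>' x \<subseteq> U" if x: "x \<in> X" for x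
    using sub[OF x] s[OF x] tower_meets_base[OF x, of "s x"] tower_meets_roof[OF x, of "s x"] by blast+
  have "X.cohomologous ?roof ((\<lambda>y. f (\<beta> y)) \<circ> s)"
    using f\<beta>[OF lift_in[OF \<kappa>'] s] roof_iff by (intro X.cohomologous_cong) (simp add: indicator_def)
  also have "X.cohomologous \<dots> (r (\<lambda>y. f (\<beta> y)))" by (rule cohomologous_comp_lift[OF \<kappa>' part lc\<beta> const\<beta> s])
  also have "X.cohomologous \<dots> (r (\<lambda>y. f (Y.T 1 y)))" by (rule r_cong[OF lc\<beta>]) (simp add: Y.T_1)
  also have "X.cohomologous \<dots> (r f)" by (rule r_shift[OF lc])
  also have "X.cohomologous \<dots> (f \<circ> s)"
    by (rule X.cohomologous_sym[OF cohomologous_comp_lift[OF \<kappa>' part lc const s]])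
  also have "X.cohomologous \<dots> ?base"
    using f[OF lift_in[OF \<kappa>'] s] base_iff by (intro X.cohomologous_cong) (simp add: indicator_def)
  finally show ?thesis .
qed

lemma ex_glued_map:
  assumes \<kappa>': "lift_of \<kappa>' P'" and P': "Y.kakutani_rokhlin P' U" "Y.kakutani_rokhlin P' U'"
    and sub: "\<And>x. x \<in> X \<Longrightarrow> \<kappa>' x \<subseteq> \<kappa> x"
    and succ: "\<And>x. x \<in> X \<Longrightarrow> \<not> \<beta> ` \<kappa> x \<subseteq> U \<Longrightarrow> \<kappa>' (\<gamma> x) = \<beta> ` \<kappa>' x"
  shows "\<exists>\<gamma>'. tower_lift P' U' \<kappa>' \<gamma>' \<and> (\<forall>x\<in>X. \<not> \<beta> ` \<kappa> x \<subseteq> U \<longrightarrow> \<gamma>' x = \<gamma> x)"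
proof -
  define base where "base = {x\<in>X. \<kappa> x \<subseteq> U}"
  define roof where "roof = {x\<in>X. \<beta> ` \<kappa> x \<subseteq> U}"
  define a where "a x = Y.collapse U' (\<beta> ` \<kappa>' x)" for x
  define c where "c x = Y.collapse U' (\<kappa>' x)" for x
  have clopen: "clopen_in X base" "clopen_in X roof"
    unfolding base_def roof_def by (rule clopen_in_level[OF lift_locally_const[OF tower_lift_of[OF tower]]])+
  have lc: "locally_const X a" "locally_const X c"
    unfolding a_def[abs_def] c_def[abs_def] by (rule locally_const_comp[OF lift_locally_const[OF \<kappa>']])+
  have "X.cohomologous (indicator {x\<in>roof. a x = l}) (indicator {x\<in>base. c x = l})" for l
    using cohomologous_roof_base[OF \<kappa>' P' sub, of l] by (simp add: roof_def base_def a_def c_def)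
  then obtain k where k: "locally_const X k" "bij_betw (\<lambda>x. X.T (k x) x) roof base"
    "\<And>x. x \<in> roof \<Longrightarrow> c (X.T (k x) x) = a x"
    using X.ex_labelled_power_bij[OF clopen(2,1) lc] by metis
  define \<gamma>' where "\<gamma>' x = (if x \<in> roof then X.T (k x) x else \<gamma> x)" for x
  have "\<gamma> ` roof = base" unfolding roof_def base_def by (rule image_roof)
  then have "X.piecewise_power \<gamma>'"
    unfolding \<gamma>'_def[abs_def] using k(1,2)
    by (intro X.piecewise_power_glue[OF tower_power[OF tower] clopen(2)]) simp_all
  moreover have "Y.follows U' (\<kappa>' x) (\<kappa>' (\<gamma>' x))" if x: "x \<in> X" for x
  proof (cases "x \<in> roof")
    case True
    then show ?thesis using k(3)[OF True] by (simp add: \<gamma>'_def Y.follows_def a_def c_def)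
  next
    case False
    then show ?thesis using succ[OF x] x by (simp add: \<gamma>'_def roof_def Y.follows_def)
  qed
  ultimately have "tower_lift P' U' \<kappa>' \<gamma>'" using \<kappa>' P'(2) by (simp add: tower_lift_def)
  then show ?thesis by (intro exI[of _ \<gamma>']) (simp add: \<gamma>'_def roof_def)
qed

end

definition extends ::
  "'b set \<Rightarrow> ('a \<Rightarrow> 'b set) \<Rightarrow> ('a \<Rightarrow> 'a) \<Rightarrow> 'b set \<Rightarrow> ('a \<Rightarrow> 'b set) \<Rightarrow> ('a \<Rightarrow> 'a) \<Rightarrow> bool" where
  "extends U \<kappa> \<gamma> U' \<kappa>' \<gamma>' \<longleftrightarrow> U' \<subseteq> U \<and> (\<forall>x\<in>X. \<kappa>' x \<subseteq> \<kappa> x) \<and> (\<forall>x\<in>X. \<not> \<beta> ` \<kappa> x \<subseteq> U \<longrightarrow> \<gamma>' x = \<gamma> x)"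

context
  fixes P U \<kappa> \<gamma> P' U' \<kappa>' \<gamma>'
  assumes tower: "tower_lift P U \<kappa> \<gamma>" and tower': "tower_lift P' U' \<kappa>' \<gamma>'"
    and ext: "extends U \<kappa> \<gamma> U' \<kappa>' \<gamma>'"
begin

lemma extends_subset: "U' \<subseteq> U" "x \<in> X \<Longrightarrow> \<kappa>' x \<subseteq> \<kappa> x" "x \<in> X \<Longrightarrow> \<not> \<beta> ` \<kappa> x \<subseteq> U \<Longrightarrow> \<gamma>' x = \<gamma> x"
  using ext by (auto simp: extends_def)

lemma extends_base:
  assumes x: "x \<in> X" and base: "\<kappa>' x \<subseteq> U'"
  shows "\<kappa> x \<subseteq> U"
proof -
  obtain y where y: "y \<in> \<kappa>' x" by (rule tower_obtains_point[OF tower' x])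
  then have "y \<in> \<kappa> x" "y \<in> U" using extends_subset(1,2) x base by blast+
  then show ?thesis by (rule tower_meets_base[OF tower x])
qed

lemma extends_roof:
  assumes x: "x \<in> X" and roof: "\<beta> ` \<kappa>' x \<subseteq> U'"
  shows "\<beta> ` \<kappa> x \<subseteq> U"
proof -
  obtain y where y: "y \<in> \<kappa>' x" by (rule tower_obtains_point[OF tower' x])
  then have "y \<in> \<kappa> x" "\<beta> y \<in> U" using extends_subset(1,2) x roof by blast+
  then show ?thesis by (rule tower_meets_roof[OF tower x])
qed

lemma extends_trans:
  assumes ext': "extends U' \<kappa>' \<gamma>' U'' \<kappa>'' \<gamma>''"
  shows "extends U \<kappa> \<gamma> U'' \<kappa>'' \<gamma>''"
  unfolding extends_def
proof (intro conjI ballI impI)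
  show "U'' \<subseteq> U" using extends_subset(1) ext' by (auto simp: extends_def)
  fix x assume x: "x \<in> X"
  show "\<kappa>'' x \<subseteq> \<kappa> x" using extends_subset(2)[OF x] ext' x by (auto simp: extends_def)
  assume "\<not> \<beta> ` \<kappa> x \<subseteq> U"
  then show "\<gamma>'' x = \<gamma> x" using extends_subset(3)[OF x] extends_roof[OF x] ext' x by (auto simp: extends_def)
qed

lemma extends_image_root: "x \<in> X \<Longrightarrow> \<kappa>' x = Y.T (int (height U \<kappa> x)) ` \<kappa>' (tower_root U \<kappa> \<gamma> x)"
proof (induction rule: tower_induct[OF tower, consumes 1, case_names base step])
  case (step x)
  have "\<gamma>' x = \<gamma> x" "\<not> \<beta> ` \<kappa>' x \<subseteq> U'" using extends_subset(3) extends_roof step(1,2) by blast+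
  then have "\<kappa>' (\<gamma> x) = \<beta> ` (Y.T (int (height U \<kappa> x)) ` \<kappa>' (tower_root U \<kappa> \<gamma> x))"
    using tower_succ[OF tower' step(1)] step(3) by simp
  also have "\<dots> = Y.T (int (height U \<kappa> x) + 1) ` \<kappa>' (tower_root U \<kappa> \<gamma> x)"
    by (rule Y.T_image_succ[OF tower_subset[OF tower' root_in[OF tower step(1)]]])
  finally show ?case using height_root_succ[OF tower step(1,2)] by (simp add: add.commute)
qed (simp add: height_root_base[OF tower])

end

lemma funpow_eq_off_roof:
  assumes "tower_lift P U \<kappa> \<gamma>" "\<forall>x\<in>X. \<not> \<beta> ` \<kappa> x \<subseteq> U \<longrightarrow> g x = \<gamma> x"
    and "x \<in> X" "\<forall>j<n. \<not> \<beta> ` \<kappa> ((\<gamma> ^^ j) x) \<subseteq> U"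
  shows "(g ^^ n) x = (\<gamma> ^^ n) x"
  using assms(4) by (induction n) (use assms(1-3) tower_funpow_in in auto)

lemma tower_lift_refine:
  assumes tower: "tower_lift P U \<kappa> \<gamma>" and P0: "clopen_partition Y P0" "refines Y P0 P"
    and \<kappa>0: "lift_of \<kappa>0 P0" "\<forall>x\<in>X. \<kappa>0 x \<subseteq> \<kappa> x" and U': "Y.clopen_base U'" "U' \<subseteq> U"
    and F: "finite F" "F \<subseteq> X" and s: "\<forall>x\<in>F. s x \<in> \<kappa>0 x \<and> \<kappa> x \<subseteq> U" and e: "e > 0"
  shows "\<exists>P' \<kappa>' \<gamma>'. tower_lift P' U' \<kappa>' \<gamma>' \<and> extends U \<kappa> \<gamma> U' \<kappa>' \<gamma>'
    \<and> (\<forall>C\<in>P'. diam_less e C) \<and> (\<forall>x\<in>X. \<kappa> x \<subseteq> U \<longrightarrow> \<kappa>' x \<subseteq> \<kappa>0 x) \<and> (\<forall>x\<in>F. s x \<in> \<kappa>' x)"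
proof -
  obtain P' where P': "Y.kakutani_rokhlin P' U'" and refP0: "refines Y P' P0"
    and small: "\<forall>C\<in>P'. diam_less e C"
    using Y.ex_kr_refining[OF U'(1) P0(1) e] by blast
  have P'U: "Y.kakutani_rokhlin P' U"
    by (rule Y.kr_mono_base[OF tower_kr[OF tower] P' U'(2) refines_trans[OF refP0 P0(2)]])
  have "\<And>x. x \<in> F \<Longrightarrow> s x \<in> \<kappa>0 x" using s by blast
  then obtain \<kappa>1 where \<kappa>1: "lift_of \<kappa>1 P'" "\<forall>x\<in>X. \<kappa>1 x \<subseteq> \<kappa>0 x" "\<forall>x\<in>F. s x \<in> \<kappa>1 x"
    using ex_lift_refining[OF \<kappa>0(1) P0(1) Y.kr_partition[OF P'] refP0 F] by metis
  have sub: "\<kappa>1 x \<subseteq> \<kappa> x" if "x \<in> X" for x using \<kappa>0(2) \<kappa>1(2) that by blast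
  define \<kappa>' where "\<kappa>' = push U \<kappa> \<gamma> \<kappa>1"
  have base: "\<kappa>' x = \<kappa>1 x" if "x \<in> X" "\<kappa> x \<subseteq> U" for x
    unfolding \<kappa>'_def by (rule push_base[OF tower that])
  have \<kappa>': "lift_of \<kappa>' P'" "\<And>x. x \<in> X \<Longrightarrow> \<kappa>' x \<subseteq> \<kappa> x"
    "\<And>x. x \<in> X \<Longrightarrow> \<not> \<beta> ` \<kappa> x \<subseteq> U \<Longrightarrow> \<kappa>' (\<gamma> x) = \<beta> ` \<kappa>' x"
    unfolding \<kappa>'_def
    using lift_of_push[OF tower \<kappa>1(1) P'U sub] push_subset[OF tower \<kappa>1(1) P'U sub]
      push_succ[OF tower \<kappa>1(1) P'U sub] by blast+
  obtain \<gamma>' where \<gamma>': "tower_lift P' U' \<kappa>' \<gamma>'" "\<forall>x\<in>X. \<not> \<beta> ` \<kappa> x \<subseteq> U \<longrightarrow> \<gamma>' x = \<gamma> x"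
    using ex_glued_map[OF tower \<kappa>'(1) P'U P' \<kappa>'(2,3)] by blast
  have "extends U \<kappa> \<gamma> U' \<kappa>' \<gamma>'" using U'(2) \<kappa>'(2) \<gamma>'(2) by (simp add: extends_def)
  moreover have "\<forall>x\<in>X. \<kappa> x \<subseteq> U \<longrightarrow> \<kappa>' x \<subseteq> \<kappa>0 x" using base \<kappa>1(2) by simp
  moreover have "\<forall>x\<in>F. s x \<in> \<kappa>' x" using base \<kappa>1(3) s F(2) by auto
  ultimately show ?thesis using \<gamma>'(1) small by blast
qed

end

section \<open>Stages\<close>

locale pointed_k0_morphism = k0_morphism X \<alpha> Y \<beta> r
  for X :: "'a::metric_space set" and \<alpha> and Y :: "'b::metric_space set" and \<beta> r +
  fixes q p :: 'a and y0 :: 'b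
  assumes q: "q \<in> X" and p: "p \<in> X" and y0: "y0 \<in> Y"
begin

text \<open>In the limit \<open>q\<close> and \<open>p\<close> become the only points over \<open>y0\<close> and over its predecessor. The last
  clause keeps the labels prescribed at \<open>q\<close> and at the root of \<open>p\<close> independent of each other.\<close>

definition stage :: "'b set set \<Rightarrow> 'b set \<Rightarrow> ('a \<Rightarrow> 'b set) \<Rightarrow> ('a \<Rightarrow> 'a) \<Rightarrow> bool" where
  "stage P U \<kappa> \<gamma> \<longleftrightarrow> tower_lift P U \<kappa> \<gamma> \<and> y0 \<in> U \<and> y0 \<in> \<kappa> q \<and> Y.T (-1) y0 \<in> \<kappa> p \<and> tower_root U \<kappa> \<gamma> p \<noteq> q"

lemma
  assumes "stage P U \<kappa> \<gamma>"
  shows stage_tower: "tower_lift P U \<kappa> \<gamma>"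
    and stage_base: "Y.clopen_base U"
    and stage_y0: "y0 \<in> U" "y0 \<in> \<kappa> q" "Y.T (-1) y0 \<in> \<kappa> p"
    and stage_root: "tower_root U \<kappa> \<gamma> p \<noteq> q"
  using assms Y.kr_base[OF tower_kr] by (auto simp: stage_def)

lemma stage_base_q: "stage P U \<kappa> \<gamma> \<Longrightarrow> \<kappa> q \<subseteq> U"
  using tower_meets_base[OF stage_tower q] stage_y0 by blast

lemma stage_roof_p:
  assumes st: "stage P U \<kappa> \<gamma>"
  shows "\<beta> ` \<kappa> p \<subseteq> U"
  using tower_meets_roof[OF stage_tower[OF st] p stage_y0(3)[OF st]] stage_y0(1)[OF st] y0 by simp

lemma foot_pred: "Y.foot U (Y.T (-1) y0) = Y.T (- 1 - int (Y.age U (Y.T (-1) y0))) y0"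
  using Y.T_add[OF y0, of "- int (Y.age U (Y.T (-1) y0))" "-1"] by (simp add: Y.foot_def add.commute)

lemma foot_pred_neq: "Y.foot U (Y.T (-1) y0) \<noteq> y0"
proof
  assume "Y.foot U (Y.T (-1) y0) = y0"
  then have "Y.T (- 1 - int (Y.age U (Y.T (-1) y0))) y0 = Y.T 0 y0" by (simp add: foot_pred)
  from Y.T_inj[OF y0 this] show False by simp
qed

lemma stage_trivial:
  assumes "p \<noteq> q"
  shows "stage {Y} Y (\<lambda>_. Y) (\<lambda>x. x)"
proof -
  have part: "clopen_partition Y {Y}" using Y.nonempty by (intro clopen_partitionI) auto
  have base: "Y.clopen_base Y" using Y.nonempty by (simp add: Y.clopen_base_def)
  have kr: "Y.kakutani_rokhlin {Y} Y"
    using part base Y.\<alpha>_in by (auto simp: Y.kakutani_rokhlin_def)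
  have "X.cohomologous (indicator X) (\<lambda>_. 1)" by (rule X.cohomologous_cong) simp
  also have "X.cohomologous \<dots> (r (\<lambda>_. 1))" by (rule X.cohomologous_sym[OF r_one])
  also have "X.cohomologous \<dots> (r (indicator Y))" by (rule r_cong) simp_all
  finally have lift: "lift_of (\<lambda>_. Y) {Y}" by (auto simp: lift_of_def)
  have "tower_lift {Y} Y (\<lambda>_. Y) (\<lambda>x. x)"
    using kr lift X.piecewise_power_id Y.\<alpha>_in by (auto simp: tower_lift_def Y.follows_iff)
  moreover from this have "tower_root Y (\<lambda>_. Y) (\<lambda>x. x) p = p" by (rule height_root_base(2)[OF _ p]) simp
  ultimately show ?thesis using assms y0 by (simp add: stage_def)
qed

lemma stage_refine:
  assumes st: "stage P U \<kappa> \<gamma>" and P0: "clopen_partition Y P0" "refines Y P0 P"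
    and \<kappa>0: "lift_of \<kappa>0 P0" "\<forall>x\<in>X. \<kappa>0 x \<subseteq> \<kappa> x" and U': "Y.clopen_base U'" "U' \<subseteq> U" "y0 \<in> U'"
    and points: "y0 \<in> \<kappa>0 q" "Y.foot U (Y.T (-1) y0) \<in> \<kappa>0 (tower_root U \<kappa> \<gamma> p)" and e: "e > 0"
  shows "\<exists>P' \<kappa>' \<gamma>'. stage P' U' \<kappa>' \<gamma>' \<and> extends U \<kappa> \<gamma> U' \<kappa>' \<gamma>'
    \<and> (\<forall>C\<in>P'. diam_less e C) \<and> (\<forall>x\<in>X. \<kappa> x \<subseteq> U \<longrightarrow> \<kappa>' x \<subseteq> \<kappa>0 x)"
proof -
  note tower = stage_tower[OF st]
  define p1 where "p1 = tower_root U \<kappa> \<gamma> p"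
  define w where "w = Y.T (-1) y0"
  define d where "d = min e (dist y0 (Y.foot U' w))"
  have d: "d > 0" using e foot_pred_neq[of U'] by (simp add: d_def w_def)
  have p1: "p1 \<in> X" "\<kappa> p1 \<subseteq> U" "p1 \<noteq> q"
    unfolding p1_def using root_in[OF tower p] root_base[OF tower p] stage_root[OF st] by auto
  define s where "s x = (if x = q then y0 else Y.foot U w)" for x
  have F: "finite {q, p1}" "{q, p1} \<subseteq> X" using q p1(1) by auto
  have "\<forall>x\<in>{q, p1}. s x \<in> \<kappa>0 x \<and> \<kappa> x \<subseteq> U"
    using points stage_base_q[OF st] p1 by (auto simp: s_def w_def p1_def)
  then obtain P' \<kappa>' \<gamma>' where tower': "tower_lift P' U' \<kappa>' \<gamma>'" and ext: "extends U \<kappa> \<gamma> U' \<kappa>' \<gamma>'"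
    and small: "\<forall>C\<in>P'. diam_less d C" and sub: "\<forall>x\<in>X. \<kappa> x \<subseteq> U \<longrightarrow> \<kappa>' x \<subseteq> \<kappa>0 x"
    and s: "\<forall>x\<in>{q, p1}. s x \<in> \<kappa>' x"
    using tower_lift_refine[OF tower P0 \<kappa>0 U'(1,2) F _ d] by blast
  have in_q: "y0 \<in> \<kappa>' q" and "Y.foot U w \<in> \<kappa>' p1" using s p1(3) by (auto simp: s_def)
  then have "Y.T (int (height U \<kappa> p)) (Y.foot U w) \<in> \<kappa>' p"
    unfolding extends_image_root[OF tower tower' ext p] p1_def by blast
  moreover have "height U \<kappa> p = Y.age U w"
    unfolding w_def by (rule height_eq[OF tower p stage_y0(3)[OF st]])
  ultimately have in_p: "w \<in> \<kappa>' p" using Y.T_age_foot[of w U] y0 by (simp add: w_def)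
  have "tower_root U' \<kappa>' \<gamma>' p \<noteq> q"
  proof
    assume "tower_root U' \<kappa>' \<gamma>' p = q"
    then have "Y.foot U' w \<in> \<kappa>' q" using foot_in_root[OF tower' p in_p] by simp
    then have "dist y0 (Y.foot U' w) < d" using small tower_in[OF tower' q] in_q by blast
    then show False by (simp add: d_def)
  qed
  then have "stage P' U' \<kappa>' \<gamma>'" using tower' U'(3) in_q in_p by (simp add: stage_def w_def)
  moreover have "\<forall>C\<in>P'. diam_less e C" using small by (simp add: d_def)
  ultimately show ?thesis using ext sub by blast
qed

text \<open>Since the new base is a small neighbourhood of \<open>y0\<close>, it suffices to localise the lift over one of
  its translates: every new tower passes through it.\<close>

lemma eventually_localized_stage_lift:
  assumes st: "stage P U \<kappa> \<gamma>" and z: "z \<in> X" and i: "Y.T i y0 \<in> \<kappa> (tower_root U \<kappa> \<gamma> z)"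
    and compat: "i = 0 \<longrightarrow> tower_root U \<kappa> \<gamma> z = q"
      "Y.T i y0 = Y.foot U (Y.T (-1) y0) \<longrightarrow> tower_root U \<kappa> \<gamma> z = tower_root U \<kappa> \<gamma> p"
    and e: "e > 0"
  shows "\<forall>\<^sub>F W in Y.small_bases. Y.T i y0 \<in> W \<longrightarrow> (\<exists>\<kappa>0 P0. lift_of \<kappa>0 P0 \<and> clopen_partition Y P0 \<and> refines Y P0 P
    \<and> W \<in> P0 \<and> (\<forall>x\<in>X. \<kappa>0 x \<subseteq> \<kappa> x) \<and> (\<forall>x\<in>X. \<kappa>0 x = W \<longrightarrow> dist z ((\<gamma> ^^ height U \<kappa> z) x) < e)
    \<and> y0 \<in> \<kappa>0 q \<and> Y.foot U (Y.T (-1) y0) \<in> \<kappa>0 (tower_root U \<kappa> \<gamma> p))"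
proof -
  note tower = stage_tower[OF st]
  note part = Y.kr_partition[OF tower_kr[OF tower]]
  define z1 where "z1 = tower_root U \<kappa> \<gamma> z"
  define p1 where "p1 = tower_root U \<kappa> \<gamma> p"
  define h where "h = height U \<kappa> z"
  have z1: "z1 \<in> X" "(\<gamma> ^^ h) z1 = z"
    unfolding z1_def h_def using root_in[OF tower z] funpow_root[OF tower z] by auto
  have p1: "p1 \<in> X" "p1 \<noteq> q" unfolding p1_def using root_in[OF tower p] stage_root[OF st] by auto
  obtain S where S: "clopen_in X S" "z \<in> S" "S \<subseteq> ball z e"
    by (rule cantor_set_clopen_nbhd[OF X.cantor z open_ball[of z e]]) (use e in auto)
  define G where "G = {x\<in>X. \<kappa> x = \<kappa> z1 \<and> (\<gamma> ^^ h) x \<in> S}"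
  have "locally_const X (\<lambda>x. (\<kappa> x, (\<gamma> ^^ h) x \<in> S))"
    by (rule locally_const_comp2[OF lift_locally_const[OF tower_lift_of[OF tower]]
          X.locally_const_piecewise_power[OF X.piecewise_power_funpow[OF tower_power[OF tower]]
            locally_const_mem[OF S(1)]]])
  then have "clopen_in X {x\<in>X. case (\<kappa> x, (\<gamma> ^^ h) x \<in> S) of (C, b) \<Rightarrow> C = \<kappa> z1 \<and> b}" by (rule clopen_in_level)
  then have G: "clopen_in X G" "G \<subseteq> {x\<in>X. \<kappa> x = \<kappa> z1}" "z1 \<in> G" using z1 S(2) by (auto simp: G_def)
  define s where "s x = (if x = q then y0 else Y.foot U (Y.T (-1) y0))" for x
  have s: "s x \<in> \<kappa> x" if "x \<in> {q, p1}" for x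
    using that stage_y0[OF st] p1(2) foot_in_root[OF tower p stage_y0(3)[OF st]] by (auto simp: s_def p1_def)
  have "x = z1" if "x \<in> {q, p1}" "s x = Y.T i y0" for x
  proof (cases "x = q")
    case True
    then have "Y.T i y0 = Y.T 0 y0" using that(2) by (simp add: s_def)
    then show ?thesis using Y.T_inj[OF y0] compat(1) True by (simp add: z1_def)
  qed (use that compat(2) in \<open>simp add: s_def z1_def p1_def\<close>)
  then have sG: "x \<in> G" if "x \<in> {q, p1}" "s x = Y.T i y0" for x using that G(3) by blast
  have "\<forall>\<^sub>F W in Y.small_bases. Y.T i y0 \<in> W \<longrightarrow> (\<exists>\<kappa>0 P0. lift_of \<kappa>0 P0 \<and> clopen_partition Y P0 \<and> refines Y P0 P
    \<and> W \<in> P0 \<and> (\<forall>x\<in>X. \<kappa>0 x \<subseteq> \<kappa> x) \<and> (\<forall>x\<in>X. \<kappa>0 x = W \<longrightarrow> x \<in> G) \<and> (\<forall>x\<in>{q, p1}. s x \<in> \<kappa>0 x))"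
    using i G by (intro eventually_localized_lift[OF tower_lift_of[OF tower] part tower_in[OF tower z1(1)]] s sG)
      (auto simp: z1_def)
  moreover have "dist z ((\<gamma> ^^ height U \<kappa> z) x) < e" if "x \<in> G" for x
    using that S(3) by (auto simp: G_def h_def)
  moreover have "y0 \<in> \<kappa>0 q \<and> Y.foot U (Y.T (-1) y0) \<in> \<kappa>0 (tower_root U \<kappa> \<gamma> p)"
    if "\<forall>x\<in>{q, p1}. s x \<in> \<kappa>0 x" for \<kappa>0 using that p1(2) by (simp add: s_def p1_def)
  ultimately show ?thesis by (elim eventually_mono) meson
qed

lemma stage_refine_near:
  assumes st: "stage P U \<kappa> \<gamma>" and U': "Y.clopen_base U'" "U' \<subseteq> U" "y0 \<in> U'" and e: "e > 0"
    and P0: "clopen_partition Y P0" "refines Y P0 P" "Y.T i ` U' \<in> P0" and \<kappa>0: "lift_of \<kappa>0 P0" "\<forall>x\<in>X. \<kappa>0 x \<subseteq> \<kappa> x"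
    and points: "y0 \<in> \<kappa>0 q" "Y.foot U (Y.T (-1) y0) \<in> \<kappa>0 (tower_root U \<kappa> \<gamma> p)"
    and z1: "z1 \<in> X" "\<kappa> z1 \<subseteq> U" "Y.T i y0 \<in> \<kappa> z1" and near: "\<forall>x\<in>X. \<kappa>0 x = Y.T i ` U' \<longrightarrow> near x"
  shows "\<exists>P' \<kappa>' \<gamma>'. stage P' U' \<kappa>' \<gamma>' \<and> extends U \<kappa> \<gamma> U' \<kappa>' \<gamma>' \<and> (\<forall>C\<in>P'. diam_less e C)
    \<and> (\<forall>x\<in>X. \<forall>y\<in>U'. Y.T i y \<in> \<kappa>' x \<longrightarrow> \<kappa> x = \<kappa> z1 \<and> near x)"
proof -
  note tower = stage_tower[OF st]
  obtain P' \<kappa>' \<gamma>' where st': "stage P' U' \<kappa>' \<gamma>'" and ext: "extends U \<kappa> \<gamma> U' \<kappa>' \<gamma>'"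
    and small: "\<forall>C\<in>P'. diam_less e C" and sub: "\<forall>x\<in>X. \<kappa> x \<subseteq> U \<longrightarrow> \<kappa>' x \<subseteq> \<kappa>0 x"
    using stage_refine[OF st P0(1,2) \<kappa>0 U' points e] by blast
  have "\<kappa> x = \<kappa> z1 \<and> near x" if x: "x \<in> X" and y: "y \<in> U'" "Y.T i y \<in> \<kappa>' x" for x y
  proof -
    obtain C where C: "C \<in> P" "Y.T i ` U' \<subseteq> C" using P0(2,3) by (auto simp: refines_def)
    then have "\<kappa> z1 = C" using tower_atom_eq[OF tower z1(1) C(1)] U'(3) z1(3) by blast
    moreover have "Y.T i y \<in> \<kappa> x" using extends_subset(2)[OF tower stage_tower[OF st'] ext x] y(2) by blast
    ultimately have eq: "\<kappa> x = \<kappa> z1" using tower_atom_eq[OF tower x C(1)] C(2) y(1) by blast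
    then have "Y.T i y \<in> \<kappa>0 x" using sub x z1(2) y(2) by auto
    then have "\<kappa>0 x = Y.T i ` U'" using clopen_partitionD(6)[OF P0(1) lift_in[OF \<kappa>0(1) x] P0(3)] y(1) by blast
    then show ?thesis using eq near x by blast
  qed
  then show ?thesis using st' ext small by blast
qed

lemma eventually_stage:
  assumes st: "stage P U \<kappa> \<gamma>" and z: "z \<in> X" and i: "Y.T i y0 \<in> \<kappa> (tower_root U \<kappa> \<gamma> z)"
    and compat: "i = 0 \<longrightarrow> tower_root U \<kappa> \<gamma> z = q"
      "Y.T i y0 = Y.foot U (Y.T (-1) y0) \<longrightarrow> tower_root U \<kappa> \<gamma> z = tower_root U \<kappa> \<gamma> p"
    and e: "e > 0"
  shows "\<forall>\<^sub>F U' in Y.small_bases. y0 \<in> U' \<longrightarrow> (\<exists>P' \<kappa>' \<gamma>'. stage P' U' \<kappa>' \<gamma>' \<and> extends U \<kappa> \<gamma> U' \<kappa>' \<gamma>'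
    \<and> (\<forall>C\<in>P'. diam_less e C)
    \<and> (\<forall>x\<in>X. \<forall>y\<in>U'. Y.T i y \<in> \<kappa>' x \<longrightarrow>
        \<kappa> x = \<kappa> (tower_root U \<kappa> \<gamma> z) \<and> dist z ((\<gamma> ^^ height U \<kappa> z) x) < e))"
  using Y.eventually_small_bases_T_image[OF eventually_localized_stage_lift[OF assms], of i]
    Y.eventually_small_bases_subset[OF Y.base_clopen[OF stage_base[OF st]] stage_y0(1)[OF st]]
    Y.eventually_small_bases_base
proof eventually_elim
  case (elim U')
  note tower = stage_tower[OF st]
  show ?case
  proof
    assume y0U': "y0 \<in> U'"
    then have "U' \<subseteq> U" "Y.T i y0 \<in> Y.T i ` U'" using elim(2) by blast+
    then obtain \<kappa>0 P0 where \<kappa>0: "lift_of \<kappa>0 P0" "\<forall>x\<in>X. \<kappa>0 x \<subseteq> \<kappa> x"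
      and P0: "clopen_partition Y P0" "refines Y P0 P" "Y.T i ` U' \<in> P0"
      and near: "\<forall>x\<in>X. \<kappa>0 x = Y.T i ` U' \<longrightarrow> dist z ((\<gamma> ^^ height U \<kappa> z) x) < e"
      and points: "y0 \<in> \<kappa>0 q" "Y.foot U (Y.T (-1) y0) \<in> \<kappa>0 (tower_root U \<kappa> \<gamma> p)"
      using elim(1) by blast
    show "\<exists>P' \<kappa>' \<gamma>'. stage P' U' \<kappa>' \<gamma>' \<and> extends U \<kappa> \<gamma> U' \<kappa>' \<gamma>' \<and> (\<forall>C\<in>P'. diam_less e C)
        \<and> (\<forall>x\<in>X. \<forall>y\<in>U'. Y.T i y \<in> \<kappa>' x \<longrightarrow> \<kappa> x = \<kappa> (tower_root U \<kappa> \<gamma> z) \<and> dist z ((\<gamma> ^^ height U \<kappa> z) x) < e)"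
      by (rule stage_refine_near[OF st elim(3) \<open>U' \<subseteq> U\<close> y0U' e P0 \<kappa>0 points
            root_in[OF tower z] root_base[OF tower z] i near])
  qed
qed

lemma ex_stage_near:
  assumes st: "stage P U \<kappa> \<gamma>" and z: "z \<in> X" and i: "Y.T i y0 \<in> \<kappa> (tower_root U \<kappa> \<gamma> z)"
    and compat: "i = 0 \<longrightarrow> tower_root U \<kappa> \<gamma> z = q"
      "Y.T i y0 = Y.foot U (Y.T (-1) y0) \<longrightarrow> tower_root U \<kappa> \<gamma> z = tower_root U \<kappa> \<gamma> p"
    and e: "e > 0" and Q: "\<forall>\<^sub>F U' in Y.small_bases. y0 \<in> U' \<longrightarrow> Q U'"
  obtains P' U' \<kappa>' \<gamma>' where "stage P' U' \<kappa>' \<gamma>'" "extends U \<kappa> \<gamma> U' \<kappa>' \<gamma>'" "Q U'"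
    "\<forall>C\<in>P'. diam_less e C"
    "\<forall>x\<in>X. \<forall>y\<in>U'. Y.T i y \<in> \<kappa>' x \<longrightarrow>
        \<kappa> x = \<kappa> (tower_root U \<kappa> \<gamma> z) \<and> dist z ((\<gamma> ^^ height U \<kappa> z) x) < e"
proof -
  define refinable where "refinable U' \<longleftrightarrow> (\<exists>P' \<kappa>' \<gamma>'. stage P' U' \<kappa>' \<gamma>' \<and> extends U \<kappa> \<gamma> U' \<kappa>' \<gamma>'
    \<and> (\<forall>C\<in>P'. diam_less e C)
    \<and> (\<forall>x\<in>X. \<forall>y\<in>U'. Y.T i y \<in> \<kappa>' x \<longrightarrow>
        \<kappa> x = \<kappa> (tower_root U \<kappa> \<gamma> z) \<and> dist z ((\<gamma> ^^ height U \<kappa> z) x) < e))" for U'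
  have "\<forall>\<^sub>F U' in Y.small_bases. y0 \<in> U' \<longrightarrow> refinable U'"
    unfolding refinable_def by (rule eventually_stage[OF st z i compat e])
  with Q have small: "\<forall>\<^sub>F U' in Y.small_bases. (y0 \<in> U' \<longrightarrow> Q U') \<and> (y0 \<in> U' \<longrightarrow> refinable U')"
    by (rule eventually_conj)
  obtain U' where "Q U'" "refinable U'" by (rule Y.small_baseE[OF small y0]) (use that in blast)
  then obtain P' \<kappa>' \<gamma>' where "stage P' U' \<kappa>' \<gamma>'" "extends U \<kappa> \<gamma> U' \<kappa>' \<gamma>'" "\<forall>C\<in>P'. diam_less e C"
    "\<forall>x\<in>X. \<forall>y\<in>U'. Y.T i y \<in> \<kappa>' x \<longrightarrow>
        \<kappa> x = \<kappa> (tower_root U \<kappa> \<gamma> z) \<and> dist z ((\<gamma> ^^ height U \<kappa> z) x) < e"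
    unfolding refinable_def by (elim exE conjE)
  then show thesis using \<open>Q U'\<close> by (intro that[of P' U' \<kappa>' \<gamma>'])
qed

lemma ex_stage_shrinking_base:
  assumes st: "stage P U \<kappa> \<gamma>" and e: "e > 0"
  shows "\<exists>P' U' \<kappa>' \<gamma>'. stage P' U' \<kappa>' \<gamma>' \<and> extends U \<kappa> \<gamma> U' \<kappa>' \<gamma>' \<and> (\<forall>x\<in>X. \<kappa>' x \<subseteq> U' \<longrightarrow> dist q x < e)"
proof -
  note root_q = height_root_base[OF stage_tower[OF st] q stage_base_q[OF st]]
  have start: "Y.T 0 y0 \<in> \<kappa> (tower_root U \<kappa> \<gamma> q)" using root_q stage_y0[OF st] by simp
  have compat: "0 = (0::int) \<longrightarrow> tower_root U \<kappa> \<gamma> q = q"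
    "Y.T 0 y0 = Y.foot U (Y.T (-1) y0) \<longrightarrow> tower_root U \<kappa> \<gamma> q = tower_root U \<kappa> \<gamma> p"
    using root_q(2) foot_pred_neq[of U] by simp_all
  have any_base: "\<forall>\<^sub>F U' in Y.small_bases. y0 \<in> U' \<longrightarrow> True" by simp
  obtain P' U' \<kappa>' \<gamma>' where st': "stage P' U' \<kappa>' \<gamma>'" and ext: "extends U \<kappa> \<gamma> U' \<kappa>' \<gamma>'"
    and near: "\<forall>x\<in>X. \<forall>y\<in>U'. Y.T 0 y \<in> \<kappa>' x \<longrightarrow>
      \<kappa> x = \<kappa> (tower_root U \<kappa> \<gamma> q) \<and> dist q ((\<gamma> ^^ height U \<kappa> q) x) < e"
    by (rule ex_stage_near[OF st q start compat e any_base]) (rule that)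
  have "dist q x < e" if x: "x \<in> X" "\<kappa>' x \<subseteq> U'" for x
  proof -
    obtain y where "y \<in> \<kappa>' x" by (rule tower_obtains_point[OF stage_tower[OF st'] x(1)])
    then have "dist q ((\<gamma> ^^ height U \<kappa> q) x) < e" using near x by auto
    then show ?thesis using root_q(1) by simp
  qed
  then show ?thesis using st' ext by blast
qed

lemma ex_stage_shrinking_roof:
  assumes st: "stage P U \<kappa> \<gamma>" and e: "e > 0"
  shows "\<exists>P' U' \<kappa>' \<gamma>'. stage P' U' \<kappa>' \<gamma>' \<and> extends U \<kappa> \<gamma> U' \<kappa>' \<gamma>' \<and> (\<forall>x\<in>X. \<beta> ` \<kappa>' x \<subseteq> U' \<longrightarrow> dist p x < e)"
proof -
  note tower = stage_tower[OF st]
  note clopen_p = clopen_partitionD(4)[OF Y.kr_partition[OF tower_kr[OF tower]] tower_in[OF tower p]]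
  define i where "i = - 1 - int (height U \<kappa> p)"
  have foot: "Y.T i y0 = Y.foot U (Y.T (-1) y0)"
    unfolding i_def height_eq[OF tower p stage_y0(3)[OF st]] by (rule foot_pred[symmetric])
  have i: "Y.T i y0 \<in> \<kappa> (tower_root U \<kappa> \<gamma> p)"
    unfolding foot by (rule foot_in_root[OF tower p stage_y0(3)[OF st]])
  have compat: "i = 0 \<longrightarrow> tower_root U \<kappa> \<gamma> p = q"
    "Y.T i y0 = Y.foot U (Y.T (-1) y0) \<longrightarrow> tower_root U \<kappa> \<gamma> p = tower_root U \<kappa> \<gamma> p"
    by (simp_all add: i_def)
  have "y0 \<in> Y.T 1 ` \<kappa> p"
    using Y.T_image_iff[OF tower_subset[OF tower p] y0] stage_y0(3)[OF st] by simp
  then have near_roof: "\<forall>\<^sub>F U' in Y.small_bases. y0 \<in> U' \<longrightarrow> U' \<subseteq> Y.T 1 ` \<kappa> p"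
    by (rule Y.eventually_small_bases_subset[OF Y.clopen_in_T_image[OF clopen_p]])
  obtain P' U' \<kappa>' \<gamma>' where st': "stage P' U' \<kappa>' \<gamma>'" and ext: "extends U \<kappa> \<gamma> U' \<kappa>' \<gamma>'"
    and sub: "U' \<subseteq> Y.T 1 ` \<kappa> p" and near: "\<forall>x\<in>X. \<forall>y\<in>U'. Y.T i y \<in> \<kappa>' x \<longrightarrow>
      \<kappa> x = \<kappa> (tower_root U \<kappa> \<gamma> p) \<and> dist p ((\<gamma> ^^ height U \<kappa> p) x) < e"
    by (rule ex_stage_near[OF st p i compat e near_roof]) (rule that)
  note tower' = stage_tower[OF st']
  have "dist p x < e" if x: "x \<in> X" "\<beta> ` \<kappa>' x \<subseteq> U'" for x
  proof -
    obtain y where y: "y \<in> \<kappa>' x" "y \<in> Y" by (rule tower_obtains_point[OF tower' x(1)])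
    then have \<beta>y: "\<beta> y \<in> U'" using x(2) by blast
    then have "y \<in> \<kappa> p" using sub Y.T_image_iff[OF tower_subset[OF tower p], of "\<beta> y" 1] y(2) by auto
    moreover have "y \<in> \<kappa> x" using extends_subset(2)[OF tower tower' ext x(1)] y(1) by blast
    ultimately have h: "height U \<kappa> x = height U \<kappa> p"
      using height_eq[OF tower p] height_eq[OF tower x(1)] by simp
    obtain u where u: "u \<in> \<kappa>' (tower_root U \<kappa> \<gamma> x)" "y = Y.T (int (height U \<kappa> p)) u"
      using extends_image_root[OF tower tower' ext x(1)] y(1) h by auto
    have "u \<in> Y" using tower_subset[OF tower' root_in[OF tower x(1)]] u(1) by blast
    then have "Y.T i (\<beta> y) = u" using u(2) y(2) by (simp add: i_def Y.T_\<alpha>)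
    then have "Y.T i (\<beta> y) \<in> \<kappa>' (tower_root U \<kappa> \<gamma> x)" using u(1) by simp
    then have "dist p ((\<gamma> ^^ height U \<kappa> p) (tower_root U \<kappa> \<gamma> x)) < e"
      using near root_in[OF tower x(1)] \<beta>y by blast
    then show ?thesis using funpow_root[OF tower x(1)] h by simp
  qed
  then show ?thesis using st' ext by blast
qed

lemma ex_stage_visiting:
  assumes st: "stage P U \<kappa> \<gamma>" and z: "z \<in> X" and e: "e > 0"
  shows "\<exists>P' U' \<kappa>' \<gamma>'. stage P' U' \<kappa>' \<gamma>' \<and> extends U \<kappa> \<gamma> U' \<kappa>' \<gamma>' \<and> (\<forall>C\<in>P'. diam_less e C)
    \<and> (\<forall>x\<in>X. \<kappa>' x \<subseteq> U' \<longrightarrow> (\<exists>n. (\<forall>j<n. \<not> \<beta> ` \<kappa>' ((\<gamma>' ^^ j) x) \<subseteq> U') \<and> dist z ((\<gamma>' ^^ n) x) < e))"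
proof -
  note tower = stage_tower[OF st]
  define h where "h = height U \<kappa> z"
  define z1 where "z1 = tower_root U \<kappa> \<gamma> z"
  have "clopen_in Y (\<kappa> z1)" "\<kappa> z1 \<noteq> {}"
    using clopen_partitionD(3,4)[OF Y.kr_partition[OF tower_kr[OF tower]] tower_in[OF tower root_in[OF tower z]]]
    by (auto simp: z1_def)
  then obtain i where "Y.T (int i) (Y.T 1 y0) \<in> \<kappa> z1" using Y.hits_forward[of "\<kappa> z1" "Y.T 1 y0"] y0 by auto
  moreover define n where "n = Suc i"
  ultimately have n: "Y.T (int n) y0 \<in> \<kappa> (tower_root U \<kappa> \<gamma> z)" "n > 0"
    using Y.T_add[OF y0, of "int i" 1] by (simp_all add: z1_def add.commute)
  have "int n \<noteq> - 1 - int (Y.age U (Y.T (-1) y0))" by simp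
  then have "Y.T (int n) y0 \<noteq> Y.foot U (Y.T (-1) y0)" using Y.T_inj[OF y0] unfolding foot_pred by metis
  then have compat: "int n = 0 \<longrightarrow> tower_root U \<kappa> \<gamma> z = q"
    "Y.T (int n) y0 = Y.foot U (Y.T (-1) y0) \<longrightarrow> tower_root U \<kappa> \<gamma> z = tower_root U \<kappa> \<gamma> p"
    using n(2) by simp_all
  have late_return: "\<forall>\<^sub>F U' in Y.small_bases. y0 \<in> U' \<longrightarrow> (\<forall>b\<in>U'. Suc (h + n) \<le> Y.return_time U' b)"
    using Y.eventually_le_return_time[of "Suc (h + n)"] by eventually_elim blast
  obtain P' U' \<kappa>' \<gamma>' where st': "stage P' U' \<kappa>' \<gamma>'" and ext: "extends U \<kappa> \<gamma> U' \<kappa>' \<gamma>'"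
    and return: "\<forall>b\<in>U'. Suc (h + n) \<le> Y.return_time U' b" and small: "\<forall>C\<in>P'. diam_less e C"
    and near: "\<forall>x\<in>X. \<forall>y\<in>U'. Y.T (int n) y \<in> \<kappa>' x \<longrightarrow>
      \<kappa> x = \<kappa> (tower_root U \<kappa> \<gamma> z) \<and> dist z ((\<gamma> ^^ height U \<kappa> z) x) < e"
    by (rule ex_stage_near[OF st z n(1) compat e late_return]) (rule that)
  note tower' = stage_tower[OF st']
  have "(\<forall>j<h + n. \<not> \<beta> ` \<kappa>' ((\<gamma>' ^^ j) x) \<subseteq> U') \<and> dist z ((\<gamma>' ^^ (h + n)) x) < e"
    if x: "x \<in> X" and base: "\<kappa>' x \<subseteq> U'" for x
  proof -
    obtain u where u: "u \<in> \<kappa>' x" by (rule tower_obtains_point[OF tower' x])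
    then have "Suc (h + n) \<le> Y.return_time U' u" using return base by blast
    then have no_return: "Y.T (int j) u \<notin> U'" if "0 < j" "j \<le> h + n" for j
      using Y.not_in_before_return[of j U' u] that by simp
    define w where "w = (\<gamma>' ^^ n) x"
    have "Y.T (int n) u \<in> \<kappa>' w" unfolding w_def using no_return by (intro tower_ascend(1)[OF tower' x u]) simp
    moreover have "w \<in> X" unfolding w_def by (rule tower_funpow_in[OF tower' x])
    ultimately have w: "w \<in> X" "\<kappa> w = \<kappa> (tower_root U \<kappa> \<gamma> z)" "dist z ((\<gamma> ^^ h) w) < e"
      using near u base unfolding h_def by blast+
    have "(\<gamma>' ^^ h) w = (\<gamma> ^^ h) w"
      using extends_subset(3)[OF tower tower' ext] no_roof_below_height[OF tower z w(1,2)]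
      by (intro funpow_eq_off_roof[OF tower _ w(1)]) (auto simp: h_def)
    then show ?thesis using w(3) tower_ascend(2)[OF tower' x u no_return] by (simp add: w_def funpow_add)
  qed
  then show ?thesis using st' ext small by blast
qed

definition refined_at :: "'a \<Rightarrow> real \<Rightarrow> 'b set set \<Rightarrow> 'b set \<Rightarrow> ('a \<Rightarrow> 'b set) \<Rightarrow> ('a \<Rightarrow> 'a) \<Rightarrow> bool" where
  "refined_at z e P U \<kappa> \<gamma> \<longleftrightarrow> (\<forall>C\<in>P. diam_less e C)
     \<and> (\<forall>x\<in>X. \<kappa> x \<subseteq> U \<longrightarrow> dist q x < e \<and> (\<exists>n. (\<forall>j<n. \<not> \<beta> ` \<kappa> ((\<gamma> ^^ j) x) \<subseteq> U) \<and> dist z ((\<gamma> ^^ n) x) < e))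
     \<and> (\<forall>x\<in>X. \<beta> ` \<kappa> x \<subseteq> U \<longrightarrow> dist p x < e)"

lemma ex_refined_stage:
  assumes st: "stage P U \<kappa> \<gamma>" and z: "z \<in> X" and e: "e > 0"
  shows "\<exists>P' U' \<kappa>' \<gamma>'. stage P' U' \<kappa>' \<gamma>' \<and> extends U \<kappa> \<gamma> U' \<kappa>' \<gamma>' \<and> refined_at z e P' U' \<kappa>' \<gamma>'"
proof -
  obtain P1 U1 \<kappa>1 \<gamma>1 where st1: "stage P1 U1 \<kappa>1 \<gamma>1" and ext1: "extends U \<kappa> \<gamma> U1 \<kappa>1 \<gamma>1"
    and base: "\<forall>x\<in>X. \<kappa>1 x \<subseteq> U1 \<longrightarrow> dist q x < e" using ex_stage_shrinking_base[OF st e] by blast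
  obtain P2 U2 \<kappa>2 \<gamma>2 where st2: "stage P2 U2 \<kappa>2 \<gamma>2" and ext2: "extends U1 \<kappa>1 \<gamma>1 U2 \<kappa>2 \<gamma>2"
    and roof: "\<forall>x\<in>X. \<beta> ` \<kappa>2 x \<subseteq> U2 \<longrightarrow> dist p x < e" using ex_stage_shrinking_roof[OF st1 e] by blast
  obtain P3 U3 \<kappa>3 \<gamma>3 where st3: "stage P3 U3 \<kappa>3 \<gamma>3" and ext3: "extends U2 \<kappa>2 \<gamma>2 U3 \<kappa>3 \<gamma>3"
    and small: "\<forall>C\<in>P3. diam_less e C"
    and visit: "\<forall>x\<in>X. \<kappa>3 x \<subseteq> U3 \<longrightarrow> (\<exists>n. (\<forall>j<n. \<not> \<beta> ` \<kappa>3 ((\<gamma>3 ^^ j) x) \<subseteq> U3) \<and> dist z ((\<gamma>3 ^^ n) x) < e)"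
    using ex_stage_visiting[OF st2 z e] by (elim exE conjE)
  note towers = stage_tower[OF st] stage_tower[OF st1] stage_tower[OF st2] stage_tower[OF st3]
  have ext13: "extends U1 \<kappa>1 \<gamma>1 U3 \<kappa>3 \<gamma>3" by (rule extends_trans[OF towers(2,3) ext2 ext3])
  have "dist q x < e" if "x \<in> X" "\<kappa>3 x \<subseteq> U3" for x
    using base extends_base[OF towers(2,4) ext13 that] that(1) by blast
  moreover have "dist p x < e" if "x \<in> X" "\<beta> ` \<kappa>3 x \<subseteq> U3" for x
    using roof extends_roof[OF towers(3,4) ext3 that] that(1) by blast
  ultimately have "refined_at z e P3 U3 \<kappa>3 \<gamma>3" using small visit by (simp add: refined_at_def)
  moreover have "extends U \<kappa> \<gamma> U3 \<kappa>3 \<gamma>3" by (rule extends_trans[OF towers(1,2) ext1 ext13])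
  ultimately show ?thesis using st3 by blast
qed

end

section \<open>The limit of the stages\<close>

lemma compact_dense_sequence:
  fixes X :: "'a::metric_space set"
  assumes "compact X" "X \<noteq> {}"
  shows "\<exists>z :: nat \<Rightarrow> 'a. range z \<subseteq> X \<and> (\<forall>x\<in>X. \<forall>d>0. \<exists>n. dist (z n) x < d \<and> inverse (real (Suc n)) < d)"
proof -
  have "\<exists>K. finite K \<and> K \<subseteq> X \<and> X \<subseteq> (\<Union>k\<in>K. ball k (inverse (real (Suc m))))" for m
    using seq_compact_imp_totally_bounded[OF compact_imp_seq_compact[OF assms(1)]] by simp
  then obtain K where K: "\<And>m. finite (K m)" "\<And>m. K m \<subseteq> X" "\<And>m. X \<subseteq> (\<Union>k\<in>K m. ball k (inverse (real (Suc m))))"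
    by metis
  define D where "D = (\<Union>m. K m)"
  have D: "countable D" "D \<noteq> {}"
    unfolding D_def using K(1,3) assms(2) by (blast intro: countable_UN countable_finite, fastforce)
  define z where "z n = from_nat_into D (fst (prod_decode n))" for n
  have "range z \<subseteq> X" using from_nat_into[OF D(2)] K(2) unfolding z_def D_def by blast
  moreover have "\<exists>n. dist (z n) x < d \<and> inverse (real (Suc n)) < d" if x: "x \<in> X" and d: "d > 0" for x d
  proof -
    obtain m where m: "inverse (real (Suc m)) < d" using reals_Archimedean[OF d] by blast
    obtain k where k: "k \<in> K m" "dist k x < inverse (real (Suc m))" using K(3)[of m] x by auto
    then obtain j where j: "from_nat_into D j = k" using from_nat_into_surj[OF D(1)] by (auto simp: D_def)
    define n where "n = prod_encode (j, m)"
    have "inverse (real (Suc n)) \<le> inverse (real (Suc m))"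
      using le_prod_encode_2[of m j] by (simp add: n_def)
    also note m
    finally have "inverse (real (Suc n)) < d" .
    moreover have "dist (z n) x < d" using k(2) m j by (simp add: z_def n_def)
    ultimately show ?thesis by blast
  qed
  ultimately show ?thesis by blast
qed

locale stage_sequence = pointed_k0_morphism X \<alpha> Y \<beta> r q p y0
  for X :: "'a::metric_space set" and \<alpha> and Y :: "'b::metric_space set" and \<beta> r q p y0 +
  fixes P :: "nat \<Rightarrow> 'b set set" and U :: "nat \<Rightarrow> 'b set" and \<kappa> :: "nat \<Rightarrow> 'a \<Rightarrow> 'b set" and \<gamma> :: "nat \<Rightarrow> 'a \<Rightarrow> 'a"
    and z :: "nat \<Rightarrow> 'a" and e :: "nat \<Rightarrow> real" and F :: "'a \<Rightarrow> 'b"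
  assumes q_eq: "q = \<alpha> p"
    and stages: "stage (P n) (U n) (\<kappa> n) (\<gamma> n)"
    and extends_Suc: "extends (U n) (\<kappa> n) (\<gamma> n) (U (Suc n)) (\<kappa> (Suc n)) (\<gamma> (Suc n))"
    and refined: "refined_at (z n) (e n) (P n) (U n) (\<kappa> n) (\<gamma> n)"
    and dense: "x \<in> X \<Longrightarrow> d > 0 \<Longrightarrow> \<exists>n. dist (z n) x < d \<and> e n < d"
    and F_in_\<kappa>: "x \<in> X \<Longrightarrow> F x \<in> \<kappa> n x"
begin

lemmas towers = stage_tower[OF stages]

lemma e_small: "d > 0 \<Longrightarrow> \<exists>n. e n < d"
  using dense[OF q] by blast

lemma extends_le: "m \<le> n \<Longrightarrow> extends (U m) (\<kappa> m) (\<gamma> m) (U n) (\<kappa> n) (\<gamma> n)"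
proof (induction n rule: dec_induct)
  case base
  show ?case by (simp add: extends_def)
next
  case (step n)
  show ?case by (rule extends_trans[OF towers towers step(3) extends_Suc])
qed

lemma base_near: "x \<in> X \<Longrightarrow> \<kappa> n x \<subseteq> U n \<Longrightarrow> dist q x < e n"
  and roof_near: "x \<in> X \<Longrightarrow> \<beta> ` \<kappa> n x \<subseteq> U n \<Longrightarrow> dist p x < e n"
  and visits: "x \<in> X \<Longrightarrow> \<kappa> n x \<subseteq> U n \<Longrightarrow>
    \<exists>m. (\<forall>j<m. \<not> \<beta> ` \<kappa> n ((\<gamma> n ^^ j) x) \<subseteq> U n) \<and> dist (z n) ((\<gamma> n ^^ m) x) < e n"
  and atoms_small: "x \<in> X \<Longrightarrow> y \<in> \<kappa> n x \<Longrightarrow> y' \<in> \<kappa> n x \<Longrightarrow> dist y y' < e n"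
  using refined[of n] tower_in[OF towers[of n]] unfolding refined_at_def by blast+

lemma roof_le: "m \<le> n \<Longrightarrow> x \<in> X \<Longrightarrow> \<beta> ` \<kappa> n x \<subseteq> U n \<Longrightarrow> \<beta> ` \<kappa> m x \<subseteq> U m"
  by (rule extends_roof[OF towers towers extends_le])

lemma ex_off_base:
  assumes "x \<in> X" "x \<noteq> q"
  shows "\<exists>n. \<not> \<kappa> n x \<subseteq> U n"
proof -
  obtain n where "e n < dist q x" using e_small[of "dist q x"] assms(2) by auto
  then show ?thesis using base_near[OF assms(1)] less_asym by blast
qed

lemma ex_off_roof:
  assumes "x \<in> X" "x \<noteq> p"
  shows "\<exists>n. \<not> \<beta> ` \<kappa> n x \<subseteq> U n"
proof -
  obtain n where "e n < dist p x" using e_small[of "dist p x"] assms(2) by auto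
  then show ?thesis using roof_near[OF assms(1)] less_asym by blast
qed

lemma F_in: "x \<in> X \<Longrightarrow> F x \<in> Y"
  using F_in_\<kappa>[of x 0] tower_subset[OF towers[of 0]] by blast

lemma F_eq:
  assumes x: "x \<in> X" and y: "\<And>n. y \<in> \<kappa> n x"
  shows "F x = y"
proof (rule ccontr)
  assume "F x \<noteq> y"
  then obtain n where "e n < dist (F x) y" using e_small[of "dist (F x) y"] by auto
  then show False using atoms_small[OF x F_in_\<kappa>[OF x] y, of n] by simp
qed

lemma F_q: "F q = y0"
  by (rule F_eq[OF q stage_y0(2)[OF stages]])

lemma F_p: "F p = Y.T (-1) y0"
  by (rule F_eq[OF p stage_y0(3)[OF stages]])

definition limit_map :: "'a \<Rightarrow> 'a" where
  "limit_map x = (if x = p then q else \<gamma> (LEAST n. \<not> \<beta> ` \<kappa> n x \<subseteq> U n) x)"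

lemma limit_map_p: "limit_map p = q"
  by (simp add: limit_map_def)

lemma limit_map_eq:
  assumes x: "x \<in> X" and roof: "\<not> \<beta> ` \<kappa> n x \<subseteq> U n"
  shows "limit_map x = \<gamma> n x"
proof -
  define N where "N = (LEAST n. \<not> \<beta> ` \<kappa> n x \<subseteq> U n)"
  have "x \<noteq> p" using roof stage_roof_p[OF stages] by blast
  then have "limit_map x = \<gamma> N x" by (simp add: limit_map_def N_def)
  moreover have "N \<le> n" unfolding N_def by (rule Least_le[of "\<lambda>n. \<not> \<beta> ` \<kappa> n x \<subseteq> U n", OF roof])
  moreover have "\<not> \<beta> ` \<kappa> N x \<subseteq> U N" unfolding N_def by (rule LeastI[of "\<lambda>n. \<not> \<beta> ` \<kappa> n x \<subseteq> U n", OF roof])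
  ultimately show ?thesis using extends_subset(3)[OF towers towers extends_le x] by metis
qed

lemma limit_map_in: "x \<in> X \<Longrightarrow> limit_map x \<in> X"
  using tower_map_in[OF towers] q by (simp add: limit_map_def)

lemma F_limit_map:
  assumes x: "x \<in> X"
  shows "F (limit_map x) = \<beta> (F x)"
proof (cases "x = p")
  case True
  then show ?thesis using F_q F_p y0 by (simp add: limit_map_p)
next
  case False
  then obtain N where N: "\<not> \<beta> ` \<kappa> N x \<subseteq> U N" using ex_off_roof[OF x] by blast
  show ?thesis
  proof (rule F_eq[OF limit_map_in[OF x]])
    fix n
    define m where "m = max N n"
    have roof: "\<not> \<beta> ` \<kappa> m x \<subseteq> U m" using roof_le[OF _ x, of N m] N by (auto simp: m_def)
    have "\<beta> (F x) \<in> \<kappa> m (limit_map x)"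
      using tower_succ[OF towers x roof] limit_map_eq[OF x roof] F_in_\<kappa>[OF x] by auto
    then show "\<beta> (F x) \<in> \<kappa> n (limit_map x)"
      using extends_subset(2)[OF towers towers extends_le[of n m] limit_map_in[OF x]] by (auto simp: m_def)
  qed
qed

lemma F_limit_map_funpow: "x \<in> X \<Longrightarrow> F ((limit_map ^^ n) x) = Y.T (int n) (F x) \<and> (limit_map ^^ n) x \<in> X"
proof (induction n)
  case (Suc n)
  then show ?case using F_limit_map[of "(limit_map ^^ n) x"] Y.T_Suc[OF F_in] limit_map_in by simp
qed simp

lemma limit_map_base:
  assumes x: "x \<in> X" and roof: "\<beta> ` \<kappa> n x \<subseteq> U n"
  shows "\<kappa> n (limit_map x) \<subseteq> U n"
proof (rule tower_meets_base[OF towers limit_map_in[OF x] F_in_\<kappa>[OF limit_map_in[OF x]]])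
  show "F (limit_map x) \<in> U n" unfolding F_limit_map[OF x] using roof F_in_\<kappa>[OF x] by blast
qed

lemma inj_limit_map: "inj_on limit_map X"
proof -
  have neq: "limit_map x \<noteq> q" if x: "x \<in> X" "x \<noteq> p" for x
  proof
    assume eq: "limit_map x = q"
    obtain n where n: "\<not> \<beta> ` \<kappa> n x \<subseteq> U n" using ex_off_roof[OF x] by blast
    then have "\<not> \<kappa> n (limit_map x) \<subseteq> U n"
      using tower_succ_base_iff[OF towers x(1)] limit_map_eq[OF x(1) n] by simp
    then show False using stage_base_q[OF stages] eq by simp
  qed
  have "x = x'" if x: "x \<in> X" "x' \<in> X" "x \<noteq> p" "x' \<noteq> p" "limit_map x = limit_map x'" for x x'
  proof -
    obtain n n' where "\<not> \<beta> ` \<kappa> n x \<subseteq> U n" "\<not> \<beta> ` \<kappa> n' x' \<subseteq> U n'" using ex_off_roof x by metis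
    then have "\<not> \<beta> ` \<kappa> (max n n') x \<subseteq> U (max n n')" "\<not> \<beta> ` \<kappa> (max n n') x' \<subseteq> U (max n n')"
      using roof_le[of n "max n n'" x] roof_le[of n' "max n n'" x'] x(1,2) by auto
    then have "\<gamma> (max n n') x = \<gamma> (max n n') x'" using limit_map_eq x(1,2,5) by metis
    then show ?thesis using tower_inv_cancel(2)[OF towers] x(1,2) by metis
  qed
  then show ?thesis using neq limit_map_p by (intro inj_onI) metis
qed

lemma limit_map_onto: "limit_map ` X = X"
proof (intro equalityI subsetI)
  fix y assume y: "y \<in> X"
  show "y \<in> limit_map ` X"
  proof (cases "y = q")
    case True
    then show ?thesis using p limit_map_p by force
  next
    case False
    obtain n where n: "\<not> \<kappa> n y \<subseteq> U n" using ex_off_base[OF y False] by blast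
    define x where "x = inv_into X (\<gamma> n) y"
    have x: "x \<in> X" "\<gamma> n x = y" unfolding x_def using tower_inv_in tower_inv_cancel(1) towers y by blast+
    then have "\<not> \<beta> ` \<kappa> n x \<subseteq> U n" using n tower_succ_base_iff[OF towers x(1), of n] by simp
    then have "limit_map x = y" using limit_map_eq[OF x(1)] x(2) by simp
    then show ?thesis using x(1) by blast
  qed
qed (use limit_map_in in blast)

lemma eventually_limit_map_eq:
  assumes x: "x \<in> X" "x \<noteq> p"
  shows "\<exists>n. limit_map x = \<gamma> n x \<and> (\<forall>\<^sub>F y in at x within X. limit_map y = \<gamma> n y)"
proof -
  obtain n where n: "\<not> \<beta> ` \<kappa> n x \<subseteq> U n" using ex_off_roof[OF x] by blast
  have "\<forall>\<^sub>F y in at x within X. \<kappa> n y = \<kappa> n x"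
    by (rule locally_constD[OF lift_locally_const[OF tower_lift_of[OF towers]] x(1)])
  then have "\<forall>\<^sub>F y in at x within X. limit_map y = \<gamma> n y"
    using eventually_at_within_mem by eventually_elim (use n limit_map_eq in simp)
  then show ?thesis using limit_map_eq[OF x(1) n] by blast
qed

lemma continuous_limit_map: "continuous_on X limit_map"
  unfolding continuous_on_def
proof
  fix x assume x: "x \<in> X"
  show "(limit_map \<longlongrightarrow> limit_map x) (at x within X)"
  proof (cases "x = p")
    case True
    show ?thesis
    proof (rule tendstoI)
      fix d :: real assume "d > 0"
      then obtain n where n: "e n < d" using e_small by blast
      have "\<forall>\<^sub>F y in at p within X. \<kappa> n y = \<kappa> n p"
        by (rule locally_constD[OF lift_locally_const[OF tower_lift_of[OF towers]] p])
      then show "\<forall>\<^sub>F y in at x within X. dist (limit_map y) (limit_map x) < d"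
        unfolding True limit_map_p using eventually_at_within_mem
      proof eventually_elim
        case (elim y)
        then have "\<beta> ` \<kappa> n y \<subseteq> U n" using stage_roof_p[OF stages] by simp
        then have "dist q (limit_map y) < e n" using base_near[OF limit_map_in limit_map_base] elim(2) by blast
        then show ?case using n by (simp add: dist_commute)
      qed
    qed
  next
    case False
    obtain n where n: "limit_map x = \<gamma> n x" "\<forall>\<^sub>F y in at x within X. limit_map y = \<gamma> n y"
      using eventually_limit_map_eq[OF x False] by blast
    have "(\<gamma> n \<longlongrightarrow> \<gamma> n x) (at x within X)"
      using X.continuous_piecewise_power[OF tower_power[OF towers]] x by (simp add: continuous_on_def)
    then show ?thesis
      unfolding n(1) by (rule Lim_transform_eventually) (use n(2) in eventually_elim, simp)
  qed
qed

lemma limit_map_full_group: "limit_map \<in> full_group X \<alpha>"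
proof -
  obtain g' where "homeomorphism X X limit_map g'"
    using homeomorphism_compact[OF X.compact_X continuous_limit_map limit_map_onto inj_limit_map] by blast
  moreover have "\<exists>k. limit_map x = X.T k x" if x: "x \<in> X" for x
  proof (cases "x = p")
    case True
    then show ?thesis using q_eq X.T_1[OF p] limit_map_p by metis
  next
    case False
    then show ?thesis
      using eventually_limit_map_eq[OF x False] tower_power[OF towers] x unfolding X.piecewise_power_def by metis
  qed
  ultimately show ?thesis by (auto simp: full_group_def is_homeo_def)
qed

lemma continuous_orbit_cocycle:
  assumes x: "x \<in> X" "x \<noteq> p"
  shows "continuous (at x within X) (\<lambda>y. real_of_int (orbit_cocycle X \<alpha> limit_map y))"
proof -
  obtain n where n: "limit_map x = \<gamma> n x" "\<forall>\<^sub>F y in at x within X. limit_map y = \<gamma> n y"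
    using eventually_limit_map_eq[OF x] by blast
  obtain k where k: "locally_const X k" "\<forall>x\<in>X. \<gamma> n x = X.T (k x) x"
    using tower_power[OF towers] unfolding X.piecewise_power_def by blast
  have cocycle: "orbit_cocycle X \<alpha> limit_map y = k y" if "y \<in> X" "limit_map y = \<gamma> n y" for y
    using X.orbit_cocycle_eq[OF that(1)] that k(2) by simp
  have "\<forall>\<^sub>F y in at x within X. orbit_cocycle X \<alpha> limit_map y = k x"
    using n(2) locally_constD[OF k(1) x(1)] eventually_at_within_mem
    by eventually_elim (simp add: cocycle)
  then show ?thesis
    unfolding continuous_within cocycle[OF x(1) n(1)] by (simp add: tendsto_of_int_iff)
qed

lemma minimal_limit_map: "minimal_on X limit_map"
  unfolding minimal_on_def
proof (intro allI impI)
  fix A assume A: "A \<subseteq> X" "closedin (top_of_set X) A" "limit_map ` A = A"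
  have closed: "closed A" using A(2) closedin_compact X.compact_X compact_imp_closed by blast
  have invariant: "(limit_map ^^ n) x \<in> A" if "x \<in> A" for n x
    using that A(3) by (induction n) auto
  show "A = {} \<or> A = X"
  proof (cases "A = {}")
    case False
    then obtain a where a: "a \<in> A" "a \<in> X" using A(1) by blast
    have near: "\<exists>w\<in>A. dist (z n) w < e n" for n
    proof -
      have "Y.clopen_base (U n)" by (rule stage_base[OF stages])
      then obtain j where "Y.T (int j) (F a) \<in> U n"
        using Y.hits_forward F_in[OF a(2)] unfolding Y.clopen_base_def by blast
      moreover define x where "x = (limit_map ^^ j) a"
      ultimately have x: "x \<in> A" "x \<in> X" "F x \<in> U n"
        using invariant[OF a(1)] F_limit_map_funpow[OF a(2), of j] by auto
      have "\<kappa> n x \<subseteq> U n" by (rule tower_meets_base[OF towers x(2) F_in_\<kappa>[OF x(2)] x(3)])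
      then obtain m where m: "\<forall>j<m. \<not> \<beta> ` \<kappa> n ((\<gamma> n ^^ j) x) \<subseteq> U n" "dist (z n) ((\<gamma> n ^^ m) x) < e n"
        using visits[OF x(2)] by blast
      have "(limit_map ^^ m) x = (\<gamma> n ^^ m) x"
        using limit_map_eq by (intro funpow_eq_off_roof[OF towers _ x(2) m(1)]) blast
      then show ?thesis using m(2) invariant[OF x(1), of m] by auto
    qed
    have "x \<in> closure A" if x: "x \<in> X" for x
      unfolding closure_approachable
    proof (intro allI impI)
      fix d :: real assume "d > 0"
      then obtain n where n: "dist (z n) x < d / 2" "e n < d / 2" using dense[OF x, of "d / 2"] by auto
      obtain w where w: "w \<in> A" "dist (z n) w < e n" using near by blast
      have "dist w x \<le> dist (z n) w + dist (z n) x" by (rule dist_triangle3)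
      then show "\<exists>w\<in>A. dist w x < d" using w n by (intro bexI[of _ w]) simp_all
    qed
    then show ?thesis using A(1) closed by auto
  qed simp
qed

end

lemma (in pointed_k0_morphism) ex_stage_sequence:
  assumes pq: "p \<noteq> q" and z: "\<And>n. z n \<in> X" and e: "\<And>n. e n > 0"
  obtains P U \<kappa> \<gamma> where "\<And>n :: nat. stage (P n) (U n) (\<kappa> n) (\<gamma> n)"
    "\<And>n. refined_at (z n) (e n) (P n) (U n) (\<kappa> n) (\<gamma> n)"
    "\<And>n. extends (U n) (\<kappa> n) (\<gamma> n) (U (Suc n)) (\<kappa> (Suc n)) (\<gamma> (Suc n))"
proof -
  define admissible where
    "admissible n s \<longleftrightarrow> (case s of (P, U, \<kappa>, \<gamma>) \<Rightarrow> stage P U \<kappa> \<gamma> \<and> refined_at (z n) (e n) P U \<kappa> \<gamma>)" for n s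
  define successor where
    "successor (n :: nat) s s' \<longleftrightarrow> (case (s, s') of ((P, U, \<kappa>, \<gamma>), (P', U', \<kappa>', \<gamma>')) \<Rightarrow> extends U \<kappa> \<gamma> U' \<kappa>' \<gamma>')"
    for n and s s' :: "'b set set \<times> 'b set \<times> ('a \<Rightarrow> 'b set) \<times> ('a \<Rightarrow> 'a)"
  have "\<exists>s. \<forall>n. admissible n (s n) \<and> successor n (s n) (s (Suc n))"
  proof (rule dependent_nat_choice)
    show "\<exists>s. admissible 0 s"
      unfolding admissible_def using ex_refined_stage[OF stage_trivial[OF pq] z e] by fastforce
    fix s n assume "admissible n s"
    moreover obtain P U \<kappa> \<gamma> where s: "s = (P, U, \<kappa>, \<gamma>)" by (cases s)
    ultimately have "stage P U \<kappa> \<gamma>" by (simp add: admissible_def)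
    then show "\<exists>s'. admissible (Suc n) s' \<and> successor n s s'"
      unfolding admissible_def successor_def s
      using ex_refined_stage[OF _ z e, of P U \<kappa> \<gamma> "Suc n" "Suc n"] by fastforce
  qed
  then obtain s where s: "\<And>n. admissible n (s n)" "\<And>n. successor n (s n) (s (Suc n))" by blast
  define P U \<kappa> \<gamma> where "P n = fst (s n)" and "U n = fst (snd (s n))" and "\<kappa> n = fst (snd (snd (s n)))"
    and "\<gamma> n = snd (snd (snd (s n)))" for n
  have "stage (P n) (U n) (\<kappa> n) (\<gamma> n)" "refined_at (z n) (e n) (P n) (U n) (\<kappa> n) (\<gamma> n)"
    "extends (U n) (\<kappa> n) (\<gamma> n) (U (Suc n)) (\<kappa> (Suc n)) (\<gamma> (Suc n))" for n
    using s[of n] by (auto simp: admissible_def successor_def P_def U_def \<kappa>_def \<gamma>_def split: prod.splits)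
  then show thesis by (rule that)
qed

lemma (in pointed_k0_morphism) ex_limit_of_stages:
  assumes stages: "\<And>n. stage (P n) (U n) (\<kappa> n) (\<gamma> n)"
    and refined: "\<And>n. refined_at (z n) (e n) (P n) (U n) (\<kappa> n) (\<gamma> n)"
    and extends: "\<And>n. extends (U n) (\<kappa> n) (\<gamma> n) (U (Suc n)) (\<kappa> (Suc n)) (\<gamma> (Suc n))"
    and e: "\<forall>d>0. \<exists>n. e n < d"
  obtains F where "continuous_on X F" "\<And>x n. x \<in> X \<Longrightarrow> F x \<in> \<kappa> n x"
proof (rule limit_of_nested_sets[of X \<kappa>])
  note towers = stage_tower[OF stages]
  fix n x assume x: "x \<in> X"
  note part = Y.kr_partition[OF tower_kr[OF towers]] and atom = tower_in[OF towers x]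
  show "\<kappa> n x \<noteq> {}" "compact (\<kappa> n x)"
    using clopen_partitionD(3)[OF part atom] clopen_in_compact[OF clopen_partitionD(4)[OF part atom] Y.compact_X] .
  show "\<kappa> (Suc n) x \<subseteq> \<kappa> n x" by (rule extends_subset(2)[OF towers towers extends x])
next
  note towers = stage_tower[OF stages]
  fix d :: real assume "d > 0"
  then obtain n where n: "e n < d" using e by blast
  have "dist y y' < d" if "x \<in> X" "y \<in> \<kappa> n x" "y' \<in> \<kappa> n x" for x y y'
    using refined[of n] tower_in[OF towers that(1)] that(2,3) n unfolding refined_at_def by force
  then show "\<exists>n. \<forall>x\<in>X. diam_less d (\<kappa> n x)" by blast
qed (use lift_locally_const[OF tower_lift_of[OF stage_tower[OF stages]]] that in auto)

context k0_morphism begin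

lemma ex_factor:
  "\<exists>F \<gamma>. continuous_on X F \<and> F ` X \<subseteq> Y \<and> \<gamma> \<in> full_group X \<alpha> \<and> minimal_on X \<gamma>
     \<and> (\<exists>p. \<forall>x\<in>X. x \<noteq> p \<longrightarrow> continuous (at x within X) (\<lambda>y. real_of_int (orbit_cocycle X \<alpha> \<gamma> y)))
     \<and> (\<forall>x\<in>X. \<beta> (F x) = F (\<gamma> x))"
proof -
  obtain p y0 where p: "p \<in> X" and y0: "y0 \<in> Y" using X.nonempty Y.nonempty by blast
  interpret pointed_k0_morphism X \<alpha> Y \<beta> r "\<alpha> p" p y0 by unfold_locales (simp_all add: p y0)
  obtain z :: "nat \<Rightarrow> 'a" where z: "range z \<subseteq> X"
    "\<forall>x\<in>X. \<forall>d>0. \<exists>n. dist (z n) x < d \<and> inverse (real (Suc n)) < d"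
    using compact_dense_sequence[OF X.compact_X X.nonempty] by blast
  define e where "e n = inverse (real (Suc n))" for n
  have zX: "z n \<in> X" and e: "e n > 0" for n using z(1) by (auto simp: e_def)
  have dense: "\<exists>n. dist (z n) x < d \<and> e n < d" if "x \<in> X" "d > 0" for x d
    using z(2) that by (simp add: e_def)
  have p_neq: "p \<noteq> \<alpha> p" using X.not_periodic[OF p, of 1] X.T_1[OF p] by simp
  obtain P U \<kappa> \<gamma> where stages: "\<And>n. stage (P n) (U n) (\<kappa> n) (\<gamma> n)"
    and refined: "\<And>n. refined_at (z n) (e n) (P n) (U n) (\<kappa> n) (\<gamma> n)"
    and extends: "\<And>n. extends (U n) (\<kappa> n) (\<gamma> n) (U (Suc n)) (\<kappa> (Suc n)) (\<gamma> (Suc n))"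
    by (rule ex_stage_sequence[where z=z and e=e, OF p_neq zX e]) (rule that)
  have e_small: "\<forall>d>0. \<exists>n. e n < d" using dense[OF p] by blast
  obtain F where F: "continuous_on X F" "\<And>x n. x \<in> X \<Longrightarrow> F x \<in> \<kappa> n x"
    by (rule ex_limit_of_stages[OF stages refined extends e_small]) (rule that)
  interpret stage_sequence X \<alpha> Y \<beta> r "\<alpha> p" p y0 P U \<kappa> \<gamma> z e F
    by unfold_locales (use stages extends refined dense F in auto)
  show ?thesis
    using F(1) F_in limit_map_full_group minimal_limit_map continuous_orbit_cocycle F_limit_map
    by (intro exI[of _ F] exI[of _ limit_map]) auto
qed

end

theorem theorem3p5:
  fixes X :: "'a::metric_space set" and \<alpha> :: "'a \<Rightarrow> 'a"
    and Y :: "'b::metric_space set" and \<beta> :: "'b \<Rightarrow> 'b"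
  assumes "cantor_minimal_system X \<alpha>" and "cantor_minimal_system Y \<beta>"
  defines "P1 \<equiv> (\<exists>\<rho>. unital_order_hom Y \<beta> X \<alpha> \<rho>)"
    and "P2 \<equiv> (\<exists>F \<gamma>. continuous_on X F \<and> F ` X \<subseteq> Y \<and> \<gamma> \<in> full_group X \<alpha>
               \<and> minimal_on X \<gamma>
               \<and> (\<exists>p. \<forall>x\<in>X. x \<noteq> p \<longrightarrow>
                      continuous (at x within X) (\<lambda>y. real_of_int (orbit_cocycle X \<alpha> \<gamma> y)))
               \<and> (\<forall>x\<in>X. \<beta> (F x) = F (\<gamma> x)))"
    and "P3 \<equiv> (\<exists>F. continuous_on X F \<and> F ` X \<subseteq> Y \<and>
               (\<forall>g. cob Y \<beta> g \<longrightarrow> cob X \<alpha> (g \<circ> F)))"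
    and "P4 \<equiv> (\<exists>\<sigma> :: nat \<Rightarrow> 'a \<Rightarrow> 'b.
               (\<forall>n. \<exists>\<tau>. homeomorphism X Y (\<sigma> n) \<tau>)
               \<and> uniform_limit Y (\<lambda>n y. \<sigma> n (\<alpha> (inv_into X (\<sigma> n) y))) \<beta> sequentially
               \<and> (\<forall>f. cont_int Y f \<longrightarrow>
                     (\<exists>c N. \<forall>n\<ge>N. k0_class X \<alpha> (f \<circ> \<sigma> n) = c)))"
  shows "(P1 \<longleftrightarrow> P2) \<and> (P1 \<longleftrightarrow> P3) \<and> (P1 \<longleftrightarrow> P4)"
proof -
  have X: "cantor_minimal X \<alpha>" and Y: "cantor_minimal Y \<beta>"
    using assms(1,2) by (simp_all add: cantor_minimal_def)
  have P1: "P1 \<longleftrightarrow> (\<exists>r. k0_morphism X \<alpha> Y \<beta> r)"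
    unfolding P1_def using k0_morphism_of_order_hom[OF X Y] k0_morphism.ex_order_hom by blast
  have "P1 \<Longrightarrow> P2" unfolding P1 P2_def using k0_morphism.ex_factor by blast
  moreover have "P2 \<Longrightarrow> P3" unfolding P2_def P3_def using cob_of_factor[OF X Y] by blast
  moreover have "P3 \<Longrightarrow> P1" unfolding P1 P3_def using k0_morphism_of_continuous_map[OF X Y] by blast
  moreover have "P1 \<Longrightarrow> P4" unfolding P1 P4_def using k0_morphism.ex_approximate_conjugacies by blast
  moreover have "P4 \<Longrightarrow> P1" unfolding P1 P4_def using k0_morphism_of_approximate_conjugacies[OF X Y] by blast
  ultimately show ?thesis by blast
qed

end
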